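(* If $A$ and $B$ are discrete groups that are weakly amenable with Cowling–Haagerup constant $1$, then the free product $A\ast B$ is weakly amenable with Cowling–Haagerup constant $1$.
   Context: A function $\varphi:G\to\mathbb{C}$ on a discrete group is completely bounded if the associated multiplication operator $\sum a_g g\mapsto\sum a_g\varphi(g)g$ is a completely bounded map on $C^*_r(G)$; $\|\varphi\|_{cb}$ denotes its cb-norm. $G$ is weakly amenable with Cowling–Haagerup constant $1$ if there is a net $(\varphi_n)$ of finitely supported completely bounded functions on $G$ with $\varphi_n\to1$ pointwise and $\limsup_n\|\varphi_n\|_{cb}\le1$. *)

theory Defs
  imports "HOL-Algebra.Group" "HOL-Library.Extended_Real" "HOL-Library.Liminf_Limsup"
begin

text \<open>An element of M_n(C[G]) is a finitely supported function x : G -> n x n complex matrices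
  (matrices as functions nat => nat => complex, only indices below n matter).
  A finitely supported vector of l2(G) tensor C^n is xi : G -> C^n.
  The left regular representation acts by (lambda(x) xi)(k) = sum_g x(g) xi(g^-1 k).\<close>

definition mat_supp :: "('g,'z) monoid_scheme \<Rightarrow> nat \<Rightarrow> ('g \<Rightarrow> nat \<Rightarrow> nat \<Rightarrow> complex) \<Rightarrow> 'g set" where
  "mat_supp G n x = {g \<in> carrier G. \<exists>i<n. \<exists>j<n. x g i j \<noteq> 0}"

definition vec_supp :: "('g,'z) monoid_scheme \<Rightarrow> nat \<Rightarrow> ('g \<Rightarrow> nat \<Rightarrow> complex) \<Rightarrow> 'g set" where
  "vec_supp G n \<xi> = {g \<in> carrier G. \<exists>i<n. \<xi> g i \<noteq> 0}"

definition lreg_apply :: "('g,'z) monoid_scheme \<Rightarrow> nat \<Rightarrow> ('g \<Rightarrow> nat \<Rightarrow> nat \<Rightarrow> complex)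
    \<Rightarrow> ('g \<Rightarrow> nat \<Rightarrow> complex) \<Rightarrow> ('g \<Rightarrow> nat \<Rightarrow> complex)" where
  "lreg_apply G n x \<xi> = (\<lambda>k i. \<Sum>g\<in>mat_supp G n x. \<Sum>j<n. x g i j * \<xi> (inv\<^bsub>G\<^esub> g \<otimes>\<^bsub>G\<^esub> k) j)"

definition vnorm :: "('g,'z) monoid_scheme \<Rightarrow> nat \<Rightarrow> ('g \<Rightarrow> nat \<Rightarrow> complex) \<Rightarrow> real" where
  "vnorm G n \<xi> = sqrt (\<Sum>k\<in>vec_supp G n \<xi>. \<Sum>i<n. (cmod (\<xi> k i))\<^sup>2)"

text \<open>Norm of lambda(x) in M_n(C*_r(G)) = B(l2(G)^n): supremum over the dense subspace
  of finitely supported unit vectors.\<close>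
definition op_norm :: "('g,'z) monoid_scheme \<Rightarrow> nat \<Rightarrow> ('g \<Rightarrow> nat \<Rightarrow> nat \<Rightarrow> complex) \<Rightarrow> ereal" where
  "op_norm G n x = (SUP \<xi>\<in>{\<xi>. finite (vec_supp G n \<xi>) \<and> vnorm G n \<xi> \<le> 1}.
                      ereal (vnorm G n (lreg_apply G n x \<xi>)))"

text \<open>cb-norm of the multiplier sum a_g g |-> sum a_g phi(g) g on C*_r(G): supremum over n
  of the norms of its amplifications to M_n(C*_r(G)), computed on the dense subalgebra
  M_n(C[G]) (value infinity iff phi is not completely bounded).\<close>
definition cb_norm :: "('g,'z) monoid_scheme \<Rightarrow> ('g \<Rightarrow> complex) \<Rightarrow> ereal" where
  "cb_norm G \<phi> = (SUP n\<in>UNIV. SUP x\<in>{x. finite (mat_supp G n x) \<and> op_norm G n x \<le> 1}.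
                     op_norm G n (\<lambda>g i j. \<phi> g * x g i j))"

text \<open>Weak amenability with Cowling-Haagerup constant 1: there is a net (here: a proper filter,
  e.g. the eventuality filter of a net) of finitely supported functions converging pointwise
  to 1 whose cb-norms have limsup at most 1.\<close>
definition weakly_amenable_CH1 :: "('g,'z) monoid_scheme \<Rightarrow> bool" where
  "weakly_amenable_CH1 G \<longleftrightarrow>
     (\<exists>F :: ('g \<Rightarrow> complex) filter. F \<noteq> bot \<and>
        eventually (\<lambda>\<phi>. finite {g \<in> carrier G. \<phi> g \<noteq> 0}) F \<and>
        (\<forall>g\<in>carrier G. ((\<lambda>\<phi>. \<phi> g) \<longlongrightarrow> 1) F) \<and>
        Limsup F (cb_norm G) \<le> 1)"

definition fp_letter_ok :: "('a,'m) monoid_scheme \<Rightarrow> ('b,'n) monoid_scheme \<Rightarrow> 'a + 'b \<Rightarrow> bool" where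
  "fp_letter_ok A B x = (case x of Inl a \<Rightarrow> a \<in> carrier A \<and> a \<noteq> \<one>\<^bsub>A\<^esub>
                                  | Inr b \<Rightarrow> b \<in> carrier B \<and> b \<noteq> \<one>\<^bsub>B\<^esub>)"

definition fp_reduced :: "('a,'m) monoid_scheme \<Rightarrow> ('b,'n) monoid_scheme \<Rightarrow> ('a + 'b) list \<Rightarrow> bool" where
  "fp_reduced A B w \<longleftrightarrow> (\<forall>x\<in>set w. fp_letter_ok A B x) \<and>
                          (\<forall>i. Suc i < length w \<longrightarrow> isl (w ! i) \<noteq> isl (w ! Suc i))"

fun fp_cons :: "('a,'m) monoid_scheme \<Rightarrow> ('b,'n) monoid_scheme \<Rightarrow> 'a + 'b \<Rightarrow> ('a + 'b) list \<Rightarrow> ('a + 'b) list" where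
  "fp_cons A B (Inl a) [] = (if a = \<one>\<^bsub>A\<^esub> then [] else [Inl a])"
| "fp_cons A B (Inr b) [] = (if b = \<one>\<^bsub>B\<^esub> then [] else [Inr b])"
| "fp_cons A B (Inl a) (Inl a' # w) =
     (if a \<otimes>\<^bsub>A\<^esub> a' = \<one>\<^bsub>A\<^esub> then w else Inl (a \<otimes>\<^bsub>A\<^esub> a') # w)"
| "fp_cons A B (Inr b) (Inr b' # w) =
     (if b \<otimes>\<^bsub>B\<^esub> b' = \<one>\<^bsub>B\<^esub> then w else Inr (b \<otimes>\<^bsub>B\<^esub> b') # w)"
| "fp_cons A B (Inl a) (Inr b # w) = (if a = \<one>\<^bsub>A\<^esub> then Inr b # w else Inl a # Inr b # w)"
| "fp_cons A B (Inr b) (Inl a # w) = (if b = \<one>\<^bsub>B\<^esub> then Inl a # w else Inr b # Inl a # w)"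

definition free_product :: "('a,'m) monoid_scheme \<Rightarrow> ('b,'n) monoid_scheme \<Rightarrow> ('a + 'b) list monoid" where
  "free_product A B = \<lparr>carrier = {w. fp_reduced A B w},
                        mult = (\<lambda>v w. foldr (fp_cons A B) v w),
                        one = []\<rparr>"

end

theory Submission
  imports Defs
begin

text \<open>
  By Haagerup's factorization, a multiplier \<open>\<phi>\<close> of \<open>A\<close> with \<open>\<phi>(1) = 1\<close> and cb-norm close to \<open>1\<close> gives a
  kernel \<open>\<phi>(s\<^sup>-\<^sup>1 t)\<close> that, on every finite set, is close in Schur norm to a positive definite kernel
  \<open>P\<close> with diagonal \<open>1\<close>; likewise for \<open>B\<close>. On \<open>A * B\<close> consider
  \<open>\<psi>(g\<^sub>1 \<dots> g\<^sub>n) = r\<^sup>n \<phi>(g\<^sub>1) \<dots> \<phi>(g\<^sub>n)\<close> for \<open>n \<le> D\<close> and \<open>\<psi> = 0\<close> on longer words. Replacing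
  \<open>\<phi>\<close> by \<open>P\<close> and removing the cutoff yields a positive definite kernel with diagonal \<open>1\<close>. The error is
  controlled layer by layer in the word length \<open>n\<close> of \<open>x\<^sup>-\<^sup>1 y\<close>: sorting pairs \<open>(x, y)\<close> by the numbers of
  letters after their longest common prefix splits the \<open>n\<close>-th layer into \<open>O(n)\<close> kernels of bounded
  Schur norm. So the tail \<open>n > D\<close> costs \<open>\<Sum> 4 (n + 1) r\<^sup>n\<close>, and for fixed \<open>D\<close> the replacement of \<open>\<phi>\<close> by
  \<open>P\<close> costs \<open>O(\<delta>)\<close>. Only finite sets of group elements matter for cb-norms.
\<close>

section \<open>Positive semidefinite kernels\<close>

text \<open>The obstacle is that the number of factors in
  \<open>\<phi>(g\<^sub>1) \<dots> \<phi>(g\<^sub>n)\<close> is unbounded, so a bound close to 1 for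
  each factor gives no uniform bound for the product. Positivity removes the obstacle: Gram
  constructions on words keep the diagonal equal to 1 at every length. So the leading term has to be
  exactly positive, and everything else has to be an error that is summable or lives on boundedly
  many layers. The tail bound grows only linearly because the entries of \<open>P\<close> have
  modulus at most 1; the replacement error may grow exponentially with the layer, since r and D are
  fixed before \<delta>.

  The kernel \<open>P\<close> need not be a function of \<open>s\<^sup>-\<^sup>1 t\<close>, and it
  changes with the finite set. Kernels on words are therefore built from three separate data: values
  on pairs of letters, values of a letter against the unit, and values of the unit against a letter.
  The normalizations \<open>\<phi>(1) = 1\<close> and \<open>P s s = 1\<close> are what lets a
  common prefix cancel with factor 1.\<close>

definition psd :: "'i set \<Rightarrow> ('i \<Rightarrow> 'i \<Rightarrow> complex) \<Rightarrow> bool" where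
  "psd I K \<longleftrightarrow> (\<forall>i\<in>I. \<forall>j\<in>I. K j i = cnj (K i j)) \<and>
     (\<forall>v. 0 \<le> Re (\<Sum>i\<in>I. \<Sum>j\<in>I. cnj (v i) * v j * K i j))"

lemma psdI:
  assumes "\<And>i j. i \<in> I \<Longrightarrow> j \<in> I \<Longrightarrow> K j i = cnj (K i j)"
    and "\<And>v. 0 \<le> Re (\<Sum>i\<in>I. \<Sum>j\<in>I. cnj (v i) * v j * K i j)"
  shows "psd I K"
  using assms unfolding psd_def by blast

lemma psd_herm: "psd I K \<Longrightarrow> i \<in> I \<Longrightarrow> j \<in> I \<Longrightarrow> K j i = cnj (K i j)"
  unfolding psd_def by blast

lemma psd_nonneg: "psd I K \<Longrightarrow> 0 \<le> Re (\<Sum>i\<in>I. \<Sum>j\<in>I. cnj (v i) * v j * K i j)"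
  unfolding psd_def by blast

lemma psd_cong:
  assumes "psd I K" "\<And>i j. i \<in> I \<Longrightarrow> j \<in> I \<Longrightarrow> K i j = K' i j"
  shows "psd I K'"
proof (rule psdI)
  fix i j assume "i \<in> I" "j \<in> I"
  then show "K' j i = cnj (K' i j)" using assms(2) psd_herm[OF assms(1)] by metis
next
  fix v
  have "(\<Sum>i\<in>I. \<Sum>j\<in>I. cnj (v i) * v j * K' i j) = (\<Sum>i\<in>I. \<Sum>j\<in>I. cnj (v i) * v j * K i j)"
    using assms(2) by (intro sum.cong) auto
  then show "0 \<le> Re (\<Sum>i\<in>I. \<Sum>j\<in>I. cnj (v i) * v j * K' i j)"
    using psd_nonneg[OF assms(1), of v] by simp
qed

lemma psd_subset:
  assumes "psd I K" "finite I" "J \<subseteq> I"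
  shows "psd J K"
proof (rule psdI)
  fix i j assume "i \<in> J" "j \<in> J"
  then show "K j i = cnj (K i j)" using assms by (meson psd_herm subsetD)
next
  fix v :: "'a \<Rightarrow> complex"
  let ?v = "\<lambda>i. if i \<in> J then v i else 0"
  have "(\<Sum>i\<in>I. \<Sum>j\<in>I. cnj (?v i) * ?v j * K i j) = (\<Sum>i\<in>J. \<Sum>j\<in>J. cnj (v i) * v j * K i j)"
    using assms by (intro sum.mono_neutral_cong_right) (auto intro!: sum.mono_neutral_cong_right)
  then show "0 \<le> Re (\<Sum>i\<in>J. \<Sum>j\<in>J. cnj (v i) * v j * K i j)"
    using psd_nonneg[OF assms(1), of ?v] by simp
qed

lemma psd_diag_real: "psd I K \<Longrightarrow> i \<in> I \<Longrightarrow> K i i = of_real (Re (K i i))"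
  using psd_herm[of I K i i] by (metis Reals_cnj_iff of_real_Re)

lemma psd_diag_nonneg:
  assumes "psd I K" "finite I" "i \<in> I"
  shows "0 \<le> Re (K i i)"
  using psd_nonneg[OF psd_subset[OF assms(1,2), of "{i}"], of "\<lambda>_. 1"] assms by simp

lemma psd_pair:
  assumes "psd I K" "finite I" "i \<in> I" "j \<in> I" "i \<noteq> j"
  shows "0 \<le> (cmod a)\<^sup>2 * Re (K i i) + 2 * Re (cnj a * b * K i j) + (cmod b)\<^sup>2 * Re (K j j)"
proof -
  let ?v = "\<lambda>k. if k = i then a else b"
  have "psd {i,j} K" using assms by (intro psd_subset[OF assms(1,2)]) auto
  from psd_nonneg[OF this, of ?v]
  have "0 \<le> Re (cnj a * a * K i i + cnj a * b * K i j + (cnj b * a * K j i + cnj b * b * K j j))"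
    using assms by simp
  moreover have "K j i = cnj (K i j)" using assms by (meson psd_herm)
  moreover have "Re (cnj b * a * cnj (K i j)) = Re (cnj a * b * K i j)"
    by (metis (no_types, lifting) complex_cnj_cnj complex_cnj_mult complex_cnj cnj.sel(1) mult.commute)
  moreover have "Re (cnj a * a * K i i) = (cmod a)\<^sup>2 * Re (K i i)"
    by (metis Re_complex_of_real complex_norm_square mult.commute of_real_mult psd_diag_real[OF assms(1,3)])
  moreover have "Re (cnj b * b * K j j) = (cmod b)\<^sup>2 * Re (K j j)"
    by (metis Re_complex_of_real complex_norm_square mult.commute of_real_mult psd_diag_real[OF assms(1,4)])
  ultimately show ?thesis by (simp only: plus_complex.sel)
qed

lemma psd_cauchy_schwarz:
  assumes "psd I K" "finite I" "i \<in> I" "j \<in> I"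
  shows "(cmod (K i j))\<^sup>2 \<le> Re (K i i) * Re (K j j)"
proof (cases "i = j")
  case True
  then show ?thesis using psd_diag_real[OF assms(1,3)] psd_diag_nonneg[OF assms(1,2,3)]
    by (metis abs_of_nonneg norm_of_real order_refl power2_eq_square)
next
  case False
  note pair = psd_pair[OF assms False]
  let ?a = "Re (K i i)" and ?b = "Re (K j j)" and ?m = "(cmod (K i j))\<^sup>2"
  have m: "Re (cnj (K i j) * K i j) = ?m"
    by (metis Re_complex_of_real complex_norm_square mult.commute)
  have a0: "0 \<le> ?a" using psd_diag_nonneg[OF assms(1-3)] .
  show ?thesis
  proof (cases "?a = 0")
    case True
    \<comment> \<open>Along the vectors \<open>(- s * K i j, 1)\<close> the form is affine in
      \<open>s\<close>; a nonzero \<open>K i j\<close> would make it negative for large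
      \<open>s\<close>.\<close>
    have "0 \<le> - 2 * s * ?m + ?b" if "s \<ge> 0" for s :: real
    proof -
      have "cnj (- of_real s * K i j) * 1 * K i j = of_real (- s) * (cnj (K i j) * K i j)" by simp
      then have "Re (cnj (- of_real s * K i j) * 1 * K i j) = - s * ?m"
        using m by (metis Re_complex_of_real complex_norm_square mult.commute of_real_mult)
      then show ?thesis using pair[of "- of_real s * K i j" 1] True by simp
    qed
    from this[of "(?b + 1) / (2 * ?m)"] psd_diag_nonneg[OF assms(1,2,4)]
    have "?m = 0" by (cases "?m = 0") (auto simp: field_simps)
    then show ?thesis using True by simp
  next
    case F: False
    \<comment> \<open>With entry \<open>K i i\<close> at \<open>j\<close>, the form is minimal when
      the entry at \<open>i\<close> is \<open>- K i j\<close>.\<close>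
    have "cnj (- K i j) * of_real ?a * K i j = of_real (- ?a) * (cnj (K i j) * K i j)" by simp
    then have "Re (cnj (- K i j) * of_real ?a * K i j) = - ?a * ?m"
      using m by (metis Re_complex_of_real complex_norm_square mult.commute of_real_mult)
    then have "0 \<le> ?m * ?a + 2 * (- ?a * ?m) + ?a\<^sup>2 * ?b"
      using pair[of "- K i j" "of_real ?a"] by simp
    then have "?a * ?m \<le> ?a * (?a * ?b)" by (simp add: power2_eq_square algebra_simps)
    then show ?thesis using a0 F by (metis mult_le_cancel_left_pos order_le_less)
  qed
qed

lemma psd_diag_zero:
  assumes "psd I K" "finite I" "i \<in> I" "j \<in> I" "K i i = 0"
  shows "K i j = 0"
  using psd_cauchy_schwarz[OF assms(1-4)] assms(5) by simp

lemma quadratic_form_insert: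
  fixes K :: "'i \<Rightarrow> 'i \<Rightarrow> complex"
  assumes "finite I" "p \<notin> I"
  shows "(\<Sum>i\<in>insert p I. \<Sum>j\<in>insert p I. cnj (v i) * v j * K i j) =
    cnj (v p) * v p * K p p + cnj (v p) * (\<Sum>j\<in>I. v j * K p j)
    + v p * (\<Sum>i\<in>I. cnj (v i) * K i p) + (\<Sum>i\<in>I. \<Sum>j\<in>I. cnj (v i) * v j * K i j)"
  using assms by (simp add: sum.distrib sum_distrib_left algebra_simps)

text \<open>For \<open>K p p = 0\<close> the row of \<open>p\<close> vanishes, and \<open>x / 0 = 0\<close> keeps the statement true.\<close>
lemma psd_schur_complement:
  assumes "psd (insert p I) K" "finite I" "p \<notin> I"
  shows "psd I (\<lambda>i j. K i j - K i p * K p j / K p p)"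
proof (rule psdI)
  fix i j assume "i \<in> I" "j \<in> I"
  then show "K j i - K j p * K p i / K p p = cnj (K i j - K i p * K p j / K p p)"
    using psd_herm[OF assms(1), of i j] psd_herm[OF assms(1), of i p] psd_herm[OF assms(1), of p j]
      psd_herm[OF assms(1), of p p] by simp
next
  fix v
  have fin: "finite (insert p I)" using assms by simp
  define S where "S = (\<Sum>j\<in>I. v j * K p j)"
  let ?c = "K p p"
  \<comment> \<open>Completing the square: this entry at \<open>p\<close> minimizes the form of
    \<open>K\<close>, and the minimum is the form of the complement. If \<open>?c = 0\<close> then
    \<open>S = 0\<close> as well.\<close>
  let ?v = "v(p := - S / ?c)"
  have herm: "K i p = cnj (K p i)" if "i \<in> I" for i
    using that psd_herm[OF assms(1)] by blast
  have cS: "(\<Sum>i\<in>I. cnj (v i) * K i p) = cnj S"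
    unfolding S_def by (simp add: herm cong: sum.cong)
  have cc: "cnj ?c = ?c" using psd_herm[OF assms(1), of p p] by simp
  have S0: "S = 0" if "?c = 0"
    unfolding S_def using psd_diag_zero[OF assms(1) fin _ _ that] by (intro sum.neutral) auto
  have eq: "(\<Sum>i\<in>I. \<Sum>j\<in>I. cnj (?v i) * ?v j * K i j) = (\<Sum>i\<in>I. \<Sum>j\<in>I. cnj (v i) * v j * K i j)"
    "(\<Sum>j\<in>I. ?v j * K p j) = S" "(\<Sum>i\<in>I. cnj (?v i) * K i p) = cnj S"
    unfolding S_def cS[unfolded S_def, symmetric] using assms(3)
    by (auto intro!: sum.cong)
  have "0 \<le> Re (\<Sum>i\<in>insert p I. \<Sum>j\<in>insert p I. cnj (?v i) * ?v j * K i j)"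
    by (rule psd_nonneg[OF assms(1)])
  also have "(\<Sum>i\<in>insert p I. \<Sum>j\<in>insert p I. cnj (?v i) * ?v j * K i j)
    = (\<Sum>i\<in>I. \<Sum>j\<in>I. cnj (v i) * v j * K i j) - cnj S * S / ?c"
    unfolding quadratic_form_insert[OF assms(2,3)] eq using S0 cc
    by (cases "?c = 0") (simp_all add: field_simps)
  also have "cnj S * S / ?c = (\<Sum>i\<in>I. cnj (v i) * K i p) * (\<Sum>j\<in>I. v j * K p j) / ?c"
    unfolding cS S_def[symmetric] ..
  also have "\<dots> = (\<Sum>i\<in>I. \<Sum>j\<in>I. cnj (v i) * v j * (K i p * K p j / ?c))"
    unfolding sum_product sum_divide_distrib by (simp add: algebra_simps)
  finally show "0 \<le> Re (\<Sum>i\<in>I. \<Sum>j\<in>I. cnj (v i) * v j * (K i j - K i p * K p j / K p p))"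
    by (simp add: algebra_simps sum_subtractf)
qed

text \<open>Cholesky elimination: splitting off \<open>p\<close> leaves a Schur complement, and the
  rank-one term removed contributes the one new coordinate \<open>h N\<close>.\<close>

lemma psd_gram:
  assumes "finite I" "psd I K"
  shows "\<exists>N g. \<forall>i\<in>I. \<forall>j\<in>I. K i j = (\<Sum>m<(N::nat). cnj (g m i) * g m j)"
  using assms
proof (induction I arbitrary: K rule: finite_induct)
  case empty
  then show ?case by simp
next
  case (insert p I)
  let ?K = "\<lambda>i j. K i j - K i p * K p j / K p p"
  obtain N g where g: "\<And>i j. i \<in> I \<Longrightarrow> j \<in> I \<Longrightarrow> ?K i j = (\<Sum>m<(N::nat). cnj (g m i) * g m j)"
    using insert.IH[OF psd_schur_complement[OF insert.prems insert.hyps]] by blast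
  define h where "h = (\<lambda>m i. if m < N then (if i = p then 0 else g m i)
    else K p i / of_real (sqrt (Re (K p p))))"
  have fin: "finite (insert p I)" using insert by simp
  have cc: "K p p = of_real (Re (K p p))" "0 \<le> Re (K p p)"
    using psd_diag_real[OF insert.prems] psd_diag_nonneg[OF insert.prems fin] by blast+
  have c: "cnj (of_real (sqrt (Re (K p p)))) * complex_of_real (sqrt (Re (K p p))) = K p p"
    using cc by (metis complex_cnj_complex_of_real of_real_mult real_sqrt_mult_self abs_of_nonneg)
  have hN: "cnj (h N i) * h N j = K i p * K p j / K p p" if "i \<in> insert p I" for i j
  proof -
    have "cnj (h N i) * h N j = cnj (K p i) * K p j /
      (cnj (of_real (sqrt (Re (K p p)))) * complex_of_real (sqrt (Re (K p p))))"
      unfolding h_def by simp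
    then show ?thesis unfolding c using psd_herm[OF insert.prems _ that, of p] by (metis complex_cnj_cnj insertI1)
  qed
  have p0: "K p j - K p p * K p j / K p p = 0" "K j p - K j p * K p p / K p p = 0" if "j \<in> insert p I" for j
  proof -
    have "K p p = 0 \<Longrightarrow> K p j = 0"
      using psd_diag_zero[OF insert.prems fin _ that, of p] by simp
    moreover then have "K p p = 0 \<Longrightarrow> K j p = 0" using psd_herm[OF insert.prems _ that, of p] by simp
    ultimately show "K p j - K p p * K p j / K p p = 0" "K j p - K j p * K p p / K p p = 0"
      by (cases "K p p = 0"; simp)+
  qed
  have "K i j = (\<Sum>m<Suc N. cnj (h m i) * h m j)" if ij: "i \<in> insert p I" "j \<in> insert p I" for i j
  proof -
    have "(\<Sum>m<N. cnj (h m i) * h m j) = ?K i j"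
    proof (cases "i = p \<or> j = p")
      case True
      then have "(\<Sum>m<N. cnj (h m i) * h m j) = 0" unfolding h_def by (intro sum.neutral) auto
      then show ?thesis using p0 ij True by auto
    next
      case False
      then have "(\<Sum>m<N. cnj (h m i) * h m j) = (\<Sum>m<N. cnj (g m i) * g m j)"
        unfolding h_def by (intro sum.cong) auto
      then show ?thesis using g False ij by auto
    qed
    then show ?thesis using hN[OF ij(1), of j] by simp
  qed
  then show ?case by blast
qed

section \<open>Operations that preserve positivity\<close>

lemma psd_of_gram:
  fixes N :: nat
  assumes "finite I" "\<And>i j. i \<in> I \<Longrightarrow> j \<in> I \<Longrightarrow> K i j = (\<Sum>m<N. cnj (g m i) * g m j)"
  shows "psd I K"
proof (rule psdI)
  fix i j assume "i \<in> I" "j \<in> I"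
  then show "K j i = cnj (K i j)" using assms by (simp add: mult.commute)
next
  fix v
  have "(\<Sum>i\<in>I. \<Sum>j\<in>I. cnj (v i) * v j * K i j)
      = (\<Sum>i\<in>I. \<Sum>j\<in>I. \<Sum>m<N. cnj (v i * g m i) * (v j * g m j))"
    using assms(2) by (intro sum.cong) (auto simp: sum_distrib_left algebra_simps)
  also have "\<dots> = (\<Sum>i\<in>I. \<Sum>m<N. \<Sum>j\<in>I. cnj (v i * g m i) * (v j * g m j))"
    by (intro sum.cong refl) (rule sum.swap)
  also have "\<dots> = (\<Sum>m<N. \<Sum>i\<in>I. \<Sum>j\<in>I. cnj (v i * g m i) * (v j * g m j))"
    by (rule sum.swap)
  also have "\<dots> = (\<Sum>m<N. cnj (\<Sum>i\<in>I. v i * g m i) * (\<Sum>j\<in>I. v j * g m j))"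
    by (simp add: sum_product)
  also have "\<dots> = of_real (\<Sum>m<N. (cmod (\<Sum>i\<in>I. v i * g m i))\<^sup>2)"
    by (subst of_real_sum, rule sum.cong[OF refl]) (metis complex_norm_square mult.commute)
  finally show "0 \<le> Re (\<Sum>i\<in>I. \<Sum>j\<in>I. cnj (v i) * v j * K i j)"
    by (simp add: sum_nonneg)
qed

text \<open>The new Gram vectors are \<open>w j * g m (h j)\<close>, which vanish with the weight.
  So \<open>h\<close> has to land in \<open>I\<close> only where the weight is nonzero, and maps
  such as "first letter of the suffix" can be used on words that are too short.\<close>

lemma psd_weighted_pullback:
  assumes "psd I K" "finite I" "finite J" "\<And>j. j \<in> J \<Longrightarrow> w j \<noteq> 0 \<Longrightarrow> h j \<in> I"
  shows "psd J (\<lambda>i j. cnj (w i) * w j * K (h i) (h j))"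
proof -
  obtain N g where g: "\<And>i j. i \<in> I \<Longrightarrow> j \<in> I \<Longrightarrow> K i j = (\<Sum>m<(N::nat). cnj (g m i) * g m j)"
    using psd_gram[OF assms(2,1)] by blast
  show ?thesis
  proof (rule psd_of_gram[OF assms(3), where N = N and g = "\<lambda>m j. w j * g m (h j)"])
    fix i j assume ij: "i \<in> J" "j \<in> J"
    show "cnj (w i) * w j * K (h i) (h j) = (\<Sum>m<N. cnj (w i * g m (h i)) * (w j * g m (h j)))"
    proof (cases "w i = 0 \<or> w j = 0")
      case False
      then show ?thesis using g[of "h i" "h j"] assms(4) ij by (simp add: sum_distrib_left algebra_simps)
    qed auto
  qed
qed

lemma psd_pullback:
  assumes "psd I K" "finite I" "finite J" "h ` J \<subseteq> I"
  shows "psd J (\<lambda>i j. K (h i) (h j))"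
  using psd_weighted_pullback[OF assms(1-3), of "\<lambda>_. 1" h] assms(4) by auto

text \<open>Schur product theorem: a Gram factorization of \<open>K\<close> turns the form of the
  product into a sum over \<open>m\<close> of forms of \<open>L\<close> at the vectors
  \<open>v i * g m i\<close>.\<close>

lemma psd_mult:
  assumes "psd I K" "psd I L" "finite I"
  shows "psd I (\<lambda>i j. K i j * L i j)"
proof -
  obtain N g where g: "\<And>i j. i \<in> I \<Longrightarrow> j \<in> I \<Longrightarrow> K i j = (\<Sum>m<(N::nat). cnj (g m i) * g m j)"
    using psd_gram[OF assms(3,1)] by blast
  show ?thesis
  proof (rule psdI)
    fix i j assume "i \<in> I" "j \<in> I"
    then show "K j i * L j i = cnj (K i j * L i j)" using psd_herm[OF assms(1), of i j] psd_herm[OF assms(2), of i j] by simp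
  next
    fix v
    have "(\<Sum>i\<in>I. \<Sum>j\<in>I. cnj (v i) * v j * (K i j * L i j))
      = (\<Sum>i\<in>I. \<Sum>j\<in>I. \<Sum>m<N. cnj (v i * g m i) * (v j * g m j) * L i j)"
      by (intro sum.cong refl) (simp add: g sum_distrib_left sum_distrib_right algebra_simps)
    also have "\<dots> = (\<Sum>i\<in>I. \<Sum>m<N. \<Sum>j\<in>I. cnj (v i * g m i) * (v j * g m j) * L i j)"
      by (intro sum.cong refl) (rule sum.swap)
    also have "\<dots> = (\<Sum>m<N. \<Sum>i\<in>I. \<Sum>j\<in>I. cnj (v i * g m i) * (v j * g m j) * L i j)"
      by (rule sum.swap)
    finally show "0 \<le> Re (\<Sum>i\<in>I. \<Sum>j\<in>I. cnj (v i) * v j * (K i j * L i j))"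
      by (simp only: Re_sum[of _ "{..<N}"]) (intro sum_nonneg psd_nonneg[OF assms(2)])
  qed
qed

lemma psd_add:
  assumes "psd I K" "psd I L"
  shows "psd I (\<lambda>i j. K i j + L i j)"
proof (rule psdI)
  fix i j assume "i \<in> I" "j \<in> I"
  then show "K j i + L j i = cnj (K i j + L i j)" using psd_herm[OF assms(1), of i j] psd_herm[OF assms(2), of i j] by simp
next
  fix v
  show "0 \<le> Re (\<Sum>i\<in>I. \<Sum>j\<in>I. cnj (v i) * v j * (K i j + L i j))"
    using psd_nonneg[OF assms(1), of v] psd_nonneg[OF assms(2), of v]
    by (simp add: distrib_left sum.distrib)
qed

lemma psd_rank_one: "finite I \<Longrightarrow> psd I (\<lambda>i j. cnj (u i) * u j)"
  by (rule psd_of_gram[where N = 1 and g = "\<lambda>_. u"]) auto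

lemma psd_scale:
  assumes "psd I K" "0 \<le> c"
  shows "psd I (\<lambda>i j. of_real c * K i j)"
proof (rule psdI)
  fix i j assume "i \<in> I" "j \<in> I"
  then show "of_real c * K j i = cnj (of_real c * K i j)" using psd_herm[OF assms(1), of i j] by simp
next
  fix v
  have "(\<Sum>i\<in>I. \<Sum>j\<in>I. cnj (v i) * v j * (of_real c * K i j)) = of_real c * (\<Sum>i\<in>I. \<Sum>j\<in>I. cnj (v i) * v j * K i j)"
    by (simp add: sum_distrib_left algebra_simps)
  then show "0 \<le> Re (\<Sum>i\<in>I. \<Sum>j\<in>I. cnj (v i) * v j * (of_real c * K i j))"
    using psd_nonneg[OF assms(1), of v] assms(2) by (simp add: Re_complex_of_real)
qed

lemma psd_delta: "finite I \<Longrightarrow> psd I (\<lambda>i j. of_bool (f i = f j))"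
proof -
  assume I: "finite I"
  have "psd (f ` I) (\<lambda>i j. of_bool (i = j))"
  proof (rule psdI)
    fix v
    have "(\<Sum>i\<in>f ` I. \<Sum>j\<in>f ` I. cnj (v i) * v j * of_bool (i = j)) = (\<Sum>i\<in>f ` I. cnj (v i) * v i)"
      using I by (intro sum.cong) (auto simp: of_bool_def if_distrib cong: if_cong)
    then show "0 \<le> Re (\<Sum>i\<in>f ` I. \<Sum>j\<in>f ` I. cnj (v i) * v j * of_bool (i = j))"
      by (simp add: sum_nonneg)
  qed auto
  then show ?thesis using psd_pullback[of "f ` I" "\<lambda>i j. of_bool (i = j)" I f] I by auto
qed

section \<open>Schur multipliers\<close>

text \<open>The factorization characterization of the Schur multiplier norm, taken as definition.
  For a finite set, a Gram factorization of \<open>R\<close> reads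
  \<open>k s t = \<langle>\<xi>\<^sub>s, \<eta>\<^sub>t\<rangle>\<close> with all squared norms at
  most \<open>c\<close>; the blocks of \<open>R\<close> on the two copies of \<open>S\<close> are
  left free.\<close>

definition schur_bd :: "'i set \<Rightarrow> real \<Rightarrow> ('i \<Rightarrow> 'i \<Rightarrow> complex) \<Rightarrow> bool" where
  "schur_bd S c k \<longleftrightarrow> (\<exists>R. psd (S <+> S) R \<and> (\<forall>s\<in>S. \<forall>t\<in>S. R (Inl s) (Inr t) = k s t) \<and>
     (\<forall>i\<in>S <+> S. Re (R i i) \<le> c))"

lemma schur_bdE:
  assumes "schur_bd S c k"
  obtains R where "psd (S <+> S) R" "\<And>s t. s \<in> S \<Longrightarrow> t \<in> S \<Longrightarrow> R (Inl s) (Inr t) = k s t"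
    "\<And>i. i \<in> S <+> S \<Longrightarrow> Re (R i i) \<le> c"
  using assms unfolding schur_bd_def by blast

lemma schur_bdI:
  assumes "psd (S <+> S) R" "\<And>s t. s \<in> S \<Longrightarrow> t \<in> S \<Longrightarrow> R (Inl s) (Inr t) = k s t"
    "\<And>i. i \<in> S <+> S \<Longrightarrow> Re (R i i) \<le> c"
  shows "schur_bd S c k"
  using assms unfolding schur_bd_def by blast

lemma schur_bd_mono:
  assumes "schur_bd S c k" "c \<le> d"
  shows "schur_bd S d k"
  using assms unfolding schur_bd_def by (meson order_trans)

lemma schur_bd_cong:
  assumes "schur_bd S c k" "\<And>s t. s \<in> S \<Longrightarrow> t \<in> S \<Longrightarrow> k s t = k' s t"
  shows "schur_bd S c k'"
  using assms unfolding schur_bd_def by metis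

lemma schur_bd_add:
  assumes "schur_bd S c k" "schur_bd S d l"
  shows "schur_bd S (c + d) (\<lambda>s t. k s t + l s t)"
proof -
  obtain R where R: "psd (S <+> S) R" "\<And>s t. s \<in> S \<Longrightarrow> t \<in> S \<Longrightarrow> R (Inl s) (Inr t) = k s t"
    "\<And>i. i \<in> S <+> S \<Longrightarrow> Re (R i i) \<le> c" using schur_bdE[OF assms(1)] by metis
  obtain Q where Q: "psd (S <+> S) Q" "\<And>s t. s \<in> S \<Longrightarrow> t \<in> S \<Longrightarrow> Q (Inl s) (Inr t) = l s t"
    "\<And>i. i \<in> S <+> S \<Longrightarrow> Re (Q i i) \<le> d" using schur_bdE[OF assms(2)] by metis
  show ?thesis
    by (rule schur_bdI[OF psd_add[OF R(1) Q(1)]]) (auto simp: R(2) Q(2) intro!: add_mono R(3) Q(3))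
qed

lemma schur_bd_zero: "finite S \<Longrightarrow> schur_bd S 0 (\<lambda>s t. 0)"
  using schur_bdI[of S "\<lambda>i j. 0" "\<lambda>s t. 0" 0] psd_rank_one[of "S <+> S" "\<lambda>_. 0"] by auto

lemma schur_bd_sum:
  assumes "finite S" "finite M" "\<And>m. m \<in> M \<Longrightarrow> schur_bd S (c m) (k m)"
  shows "schur_bd S (sum c M) (\<lambda>s t. \<Sum>m\<in>M. k m s t)"
  using assms(2,3)
proof (induction M rule: finite_induct)
  case empty
  then show ?case using schur_bd_zero[OF assms(1)] by simp
next
  case (insert m M)
  then show ?case using schur_bd_add[of S "c m" "k m"] by simp
qed

text \<open>Rescaling the two halves by reciprocal factors balances the diagonal.\<close>
lemma schur_bd_unbalanced:
  assumes S: "finite S" and R: "psd (S <+> S) R"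
    and ab: "\<And>s. s \<in> S \<Longrightarrow> Re (R (Inl s) (Inl s)) \<le> a" "\<And>s. s \<in> S \<Longrightarrow> Re (R (Inr s) (Inr s)) \<le> b"
    and "0 \<le> a" "0 \<le> b"
  shows "schur_bd S (sqrt (a * b)) (\<lambda>s t. R (Inl s) (Inr t))"
proof (cases "a = 0 \<or> b = 0")
  \<comment> \<open>The reciprocal factors do not exist here, but Cauchy-Schwarz makes the kernel
    zero.\<close>
  case True
  have fin: "finite (S <+> S)" using S by simp
  have "R (Inl s) (Inr t) = 0" if "s \<in> S" "t \<in> S" for s t
  proof -
    have "(cmod (R (Inl s) (Inr t)))\<^sup>2 \<le> Re (R (Inl s) (Inl s)) * Re (R (Inr t) (Inr t))"
      using psd_cauchy_schwarz[OF R fin] that by auto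
    also have "\<dots> \<le> a * b"
      using ab that assms(5,6) psd_diag_nonneg[OF R fin] by (intro mult_mono) auto
    finally show ?thesis using True by auto
  qed
  then show ?thesis using schur_bd_cong[OF schur_bd_zero[OF S]] True by auto
next
  case False
  then have pos: "0 < a" "0 < b" using assms by auto
  define q where "q = sqrt (sqrt (b / a))"
  have q: "0 < q" "q\<^sup>2 * a = sqrt (a * b)" "(1 / q)\<^sup>2 * b = sqrt (a * b)"
    unfolding q_def using pos by (auto simp: power_divide real_sqrt_divide real_sqrt_mult field_simps)
  define w :: "'a + 'a \<Rightarrow> complex"
    where "w = (\<lambda>i. complex_of_real (case i of Inl s \<Rightarrow> q | Inr t \<Rightarrow> 1 / q))"
  have fin: "finite (S <+> S)" using S by simp
  show ?thesis
  proof (rule schur_bdI[OF psd_weighted_pullback[OF R fin fin, of w "\<lambda>i. i"]])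
    fix i assume i: "i \<in> S <+> S"
    have *: "Re (cnj (of_real x) * of_real x * z) = x\<^sup>2 * Re z" for x :: real and z
      by (simp add: power2_eq_square)
    show "Re (cnj (w i) * w i * R i i) \<le> sqrt (a * b)"
    proof (cases i)
      case (Inl s)
      then have "Re (cnj (w i) * w i * R i i) = q\<^sup>2 * Re (R i i)" unfolding w_def by (simp only: * sum.case)
      also have "\<dots> \<le> q\<^sup>2 * a" using ab(1) i Inl by (intro mult_left_mono) auto
      finally show ?thesis using q by simp
    next
      case (Inr s)
      then have "Re (cnj (w i) * w i * R i i) = (1 / q)\<^sup>2 * Re (R i i)" unfolding w_def by (simp only: * sum.case)
      also have "\<dots> \<le> (1 / q)\<^sup>2 * b" using ab(2) i Inr by (intro mult_left_mono) auto
      finally show ?thesis using q by simp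
    qed
  qed (use q in \<open>auto simp: w_def\<close>)
qed

text \<open>Folding the two copies of \<open>S\<close> together exhibits \<open>P\<close> as an
  off-diagonal block of its own pullback, so the diagonal alone controls the Schur norm.\<close>

lemma schur_bd_psd:
  assumes "psd S P" "finite S" "\<And>s. s \<in> S \<Longrightarrow> Re (P s s) \<le> c"
  shows "schur_bd S c P"
proof -
  let ?h = "case_sum (\<lambda>s. s) (\<lambda>s. s)"
  have "?h ` (S <+> S) \<subseteq> S" by auto
  then have "psd (S <+> S) (\<lambda>i j. P (?h i) (?h j))"
    using psd_pullback[OF assms(1,2), of "S <+> S" ?h] assms(2) by auto
  then show ?thesis by (rule schur_bdI) (auto intro: assms(3))
qed

text \<open>Rows and columns live on disjoint copies, so they can be moved by unrelated maps
  \<open>f\<close> and \<open>g\<close>. The squared norms become at most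
  \<open>a\<^sup>2 * c\<close> and \<open>b\<^sup>2 * c\<close>, and balancing gives
  \<open>a * c * b\<close>.\<close>

lemma schur_bd_weighted_pullback:
  assumes k: "schur_bd S c k" and fin: "finite S" "finite T"
    and F: "\<And>x. x \<in> T \<Longrightarrow> F x \<noteq> 0 \<Longrightarrow> f x \<in> S" "\<And>x. x \<in> T \<Longrightarrow> cmod (F x) \<le> a"
    and G: "\<And>y. y \<in> T \<Longrightarrow> G y \<noteq> 0 \<Longrightarrow> g y \<in> S" "\<And>y. y \<in> T \<Longrightarrow> cmod (G y) \<le> b"
    and nonneg: "0 \<le> a" "0 \<le> b" "0 \<le> c"
  shows "schur_bd T (a * c * b) (\<lambda>x y. F x * k (f x) (g y) * G y)"
proof -
  obtain R where R: "psd (S <+> S) R" "\<And>s t. s \<in> S \<Longrightarrow> t \<in> S \<Longrightarrow> R (Inl s) (Inr t) = k s t"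
    "\<And>i. i \<in> S <+> S \<Longrightarrow> Re (R i i) \<le> c" using schur_bdE[OF k] by metis
  \<comment> \<open>The pullback conjugates the weight of its first argument, hence the
    \<open>cnj\<close> on \<open>F\<close>.\<close>
  define w where "w = case_sum (\<lambda>x. cnj (F x)) G"
  define h where "h = case_sum (\<lambda>x. Inl (f x) :: 'a + 'a) (\<lambda>y. Inr (g y))"
  have psd: "psd (T <+> T) (\<lambda>i j. cnj (w i) * w j * R (h i) (h j))"
    by (rule psd_weighted_pullback[OF R(1)]) (use fin F(1) G(1) in \<open>auto simp: w_def h_def\<close>)
  have diag: "Re (cnj z * z * R i i) \<le> d\<^sup>2 * c" if "cmod z \<le> d" "z \<noteq> 0 \<Longrightarrow> i \<in> S <+> S" for z d i
  proof (cases "z = 0")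
    case True
    then show ?thesis using nonneg by simp
  next
    case False
    have "cnj z * z = of_real ((cmod z)\<^sup>2)" by (metis complex_norm_square mult.commute)
    then have "Re (cnj z * z * R i i) = (cmod z)\<^sup>2 * Re (R i i)"
      by (metis Re_complex_of_real psd_diag_real[OF R(1) that(2)[OF False]] of_real_mult)
    also have "\<dots> \<le> (cmod z)\<^sup>2 * c" using R(3) that(2) False by (intro mult_left_mono) auto
    also have "\<dots> \<le> d\<^sup>2 * c" using that(1) nonneg by (intro mult_right_mono power_mono) auto
    finally show ?thesis .
  qed
  have "schur_bd T (sqrt ((a\<^sup>2 * c) * (b\<^sup>2 * c))) (\<lambda>x y. cnj (w (Inl x)) * w (Inr y) * R (h (Inl x)) (h (Inr y)))"
  proof (rule schur_bd_unbalanced[OF fin(2) psd])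
    fix x assume "x \<in> T"
    then show "Re (cnj (w (Inl x)) * w (Inl x) * R (h (Inl x)) (h (Inl x))) \<le> a\<^sup>2 * c"
      by (intro diag) (use F in \<open>auto simp: w_def h_def\<close>)
    show "Re (cnj (w (Inr x)) * w (Inr x) * R (h (Inr x)) (h (Inr x))) \<le> b\<^sup>2 * c"
      using \<open>x \<in> T\<close> by (intro diag) (use G in \<open>auto simp: w_def h_def\<close>)
  qed (use nonneg in auto)
  moreover have "sqrt ((a\<^sup>2 * c) * (b\<^sup>2 * c)) = a * c * b"
  proof -
    have "(a\<^sup>2 * c) * (b\<^sup>2 * c) = (a * c * b)\<^sup>2" by (simp add: power2_eq_square)
    then show ?thesis using nonneg by simp
  qed
  ultimately have "schur_bd T (a * c * b) (\<lambda>x y. cnj (w (Inl x)) * w (Inr y) * R (h (Inl x)) (h (Inr y)))"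
    by simp
  then show ?thesis
  proof (rule schur_bd_cong)
    fix x y assume "x \<in> T" "y \<in> T"
    then show "cnj (w (Inl x)) * w (Inr y) * R (h (Inl x)) (h (Inr y)) = F x * k (f x) (g y) * G y"
      using F(1) G(1) R(2)[of "f x" "g y"] by (cases "F x = 0 \<or> G y = 0") (auto simp: w_def h_def)
  qed
qed

lemma schur_bd_weighted:
  assumes "schur_bd S c k" "finite S"
    and "\<And>x. x \<in> S \<Longrightarrow> cmod (F x) \<le> a" "\<And>y. y \<in> S \<Longrightarrow> cmod (G y) \<le> b" "0 \<le> a" "0 \<le> b" "0 \<le> c"
  shows "schur_bd S (a * c * b) (\<lambda>x y. F x * k x y * G y)"
  by (rule schur_bd_weighted_pullback[where f = "\<lambda>x. x" and g = "\<lambda>x. x"]) (use assms in auto)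

lemma schur_bd_cmult:
  assumes "schur_bd S c k" "finite S" "0 \<le> c"
  shows "schur_bd S (cmod z * c) (\<lambda>x y. z * k x y)"
  using schur_bd_weighted[OF assms(1,2), of "\<lambda>_. z" "cmod z" "\<lambda>_. 1" 1] assms(3) by simp

lemma schur_bd_diff:
  assumes "schur_bd S c k" "schur_bd S d l" "finite S" "0 \<le> d"
  shows "schur_bd S (c + d) (\<lambda>s t. k s t - l s t)"
  using schur_bd_add[OF assms(1) schur_bd_cmult[OF assms(2,3,4), of "-1"]] by simp

text \<open>The indicator is a block of the equality kernel of \<open>case_sum p q\<close>, which is
  positive with unit diagonal. Restricting to pairs with equal prefixes therefore costs
  nothing.\<close>

lemma schur_bd_mult_delta:
  assumes k: "schur_bd S c k" and fin: "finite S"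
  shows "schur_bd S c (\<lambda>x y. of_bool (p x = q y) * k x y)"
proof -
  obtain R where R: "psd (S <+> S) R" "\<And>s t. s \<in> S \<Longrightarrow> t \<in> S \<Longrightarrow> R (Inl s) (Inr t) = k s t"
    "\<And>i. i \<in> S <+> S \<Longrightarrow> Re (R i i) \<le> c" using schur_bdE[OF k] by metis
  have "psd (S <+> S) (\<lambda>i j. of_bool (case_sum p q i = case_sum p q j) * R i j)"
    using fin by (intro psd_mult psd_delta R(1)) auto
  then show ?thesis by (rule schur_bdI) (auto simp: R(2) intro: R(3))
qed

lemma schur_bd_delta: "finite S \<Longrightarrow> schur_bd S 1 (\<lambda>x y. of_bool (p x = q y))"
  using schur_bd_mult_delta[OF schur_bd_psd[OF psd_rank_one[of S "\<lambda>_. 1"]], of 1 p q] by simp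

lemma schur_bd_norm:
  assumes "schur_bd S c k" "finite S" "s \<in> S" "t \<in> S"
  shows "cmod (k s t) \<le> c"
proof -
  obtain R where R: "psd (S <+> S) R" "\<And>s t. s \<in> S \<Longrightarrow> t \<in> S \<Longrightarrow> R (Inl s) (Inr t) = k s t"
    "\<And>i. i \<in> S <+> S \<Longrightarrow> Re (R i i) \<le> c" using schur_bdE[OF assms(1)] by metis
  have fin: "finite (S <+> S)" using assms by simp
  have st: "Inl s \<in> S <+> S" "Inr t \<in> S <+> S" using assms by auto
  have nn: "0 \<le> Re (R (Inl s) (Inl s))" "0 \<le> Re (R (Inr t) (Inr t))"
    using psd_diag_nonneg[OF R(1) fin] st by auto
  then have "(cmod (R (Inl s) (Inr t)))\<^sup>2 \<le> c * c"
    using psd_cauchy_schwarz[OF R(1) fin st] R(3)[OF st(1)] R(3)[OF st(2)]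
    by (meson mult_mono order_trans)
  moreover have "0 \<le> c" using nn R(3)[OF st(1)] by linarith
  ultimately show ?thesis using R(2)[OF assms(3,4)] by (metis power2_eq_square power2_le_imp_le)
qed

section \<open>From Schur multipliers to cb-norms\<close>

lemma vnorm_sq:
  assumes "vec_supp G n \<xi> \<subseteq> V" "finite V" "V \<subseteq> carrier G"
  shows "(vnorm G n \<xi>)\<^sup>2 = (\<Sum>k\<in>V. \<Sum>i<n. (cmod (\<xi> k i))\<^sup>2)"
proof -
  have "(vnorm G n \<xi>)\<^sup>2 = (\<Sum>k\<in>vec_supp G n \<xi>. \<Sum>i<n. (cmod (\<xi> k i))\<^sup>2)"
    unfolding vnorm_def by (intro real_sqrt_pow2 sum_nonneg) auto
  also have "\<dots> = (\<Sum>k\<in>V. \<Sum>i<n. (cmod (\<xi> k i))\<^sup>2)"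
    by (rule sum.mono_neutral_left[OF assms(2,1)])
      (use assms(3) in \<open>auto simp: vec_supp_def intro!: sum.neutral\<close>)
  finally show ?thesis .
qed

lemma vnorm_nonneg: "0 \<le> vnorm G n \<xi>"
  unfolding vnorm_def by (intro real_sqrt_ge_zero sum_nonneg) auto

lemma lreg_apply_superset:
  assumes "mat_supp G n x \<subseteq> X" "finite X" "X \<subseteq> carrier G" "i < n"
  shows "lreg_apply G n x \<xi> k i = (\<Sum>g\<in>X. \<Sum>j<n. x g i j * \<xi> (inv\<^bsub>G\<^esub> g \<otimes>\<^bsub>G\<^esub> k) j)"
  unfolding lreg_apply_def
  by (rule sum.mono_neutral_left[OF assms(2,1)])
    (use assms(3,4) in \<open>fastforce simp: mat_supp_def intro!: sum.neutral\<close>)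

lemma vec_supp_lreg_apply:
  fixes G (structure)
  assumes "group G"
  shows "vec_supp G n (lreg_apply G n x \<xi>) \<subseteq> (\<lambda>(g, h). g \<otimes>\<^bsub>G\<^esub> h) ` (mat_supp G n x \<times> vec_supp G n \<xi>)"
proof
  interpret group G by fact
  fix k assume "k \<in> vec_supp G n (lreg_apply G n x \<xi>)"
  then obtain i where k: "k \<in> carrier G" "lreg_apply G n x \<xi> k i \<noteq> 0" by (auto simp: vec_supp_def)
  from k(2) obtain g where g: "g \<in> mat_supp G n x" "(\<Sum>j<n. x g i j * \<xi> (inv g \<otimes> k) j) \<noteq> 0"
    unfolding lreg_apply_def by (rule sum.not_neutral_contains_not_neutral)
  then obtain j where "j < n" "\<xi> (inv g \<otimes> k) j \<noteq> 0"
    using sum.neutral[of "{..<n}" "\<lambda>j. x g i j * \<xi> (inv g \<otimes> k) j"] by auto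
  moreover have gc: "g \<in> carrier G" using g by (auto simp: mat_supp_def)
  ultimately have "inv g \<otimes> k \<in> vec_supp G n \<xi>" using k by (auto simp: vec_supp_def)
  moreover have "k = g \<otimes> (inv g \<otimes> k)" using gc k by (simp add: m_assoc[symmetric])
  ultimately show "k \<in> (\<lambda>(g, h). g \<otimes> h) ` (mat_supp G n x \<times> vec_supp G n \<xi>)" using g(1) by force
qed

lemma vec_supp_lreg_cover:
  fixes G (structure)
  assumes "group G" "mat_supp G n x \<subseteq> X" "finite X" "X \<subseteq> carrier G" "finite (vec_supp G n \<xi>)"
  defines "V \<equiv> (\<lambda>(g, h). g \<otimes>\<^bsub>G\<^esub> h) ` (X \<times> vec_supp G n \<xi>)"
  shows "vec_supp G n (lreg_apply G n x \<xi>) \<subseteq> V" "finite V" "V \<subseteq> carrier G"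
proof -
  interpret group G by fact
  show "vec_supp G n (lreg_apply G n x \<xi>) \<subseteq> V"
    using vec_supp_lreg_apply[OF assms(1)] assms(2) unfolding V_def by fast
  show "finite V" unfolding V_def using assms by simp
  show "V \<subseteq> carrier G" unfolding V_def using assms(4) by (auto simp: vec_supp_def)
qed

lemma vnorm_scale:
  assumes "0 < t"
  shows "vnorm G n (\<lambda>k i. of_real t * \<xi> k i) = t * vnorm G n \<xi>"
proof -
  have "vec_supp G n (\<lambda>k i. of_real t * \<xi> k i) = vec_supp G n \<xi>"
    using assms by (auto simp: vec_supp_def)
  moreover have "(\<Sum>k\<in>A. \<Sum>i<n. (cmod (of_real t * \<xi> k i))\<^sup>2) = t\<^sup>2 * (\<Sum>k\<in>A. \<Sum>i<n. (cmod (\<xi> k i))\<^sup>2)" for A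
    by (simp add: norm_mult power_mult_distrib sum_distrib_left)
  ultimately show ?thesis unfolding vnorm_def using assms by (simp add: real_sqrt_mult)
qed

lemma vnorm_lreg_le:
  assumes "op_norm G n x \<le> ereal C" "finite (vec_supp G n \<xi>)" "0 \<le> C"
  shows "vnorm G n (lreg_apply G n x \<xi>) \<le> C * vnorm G n \<xi>"
proof -
  let ?a = "vnorm G n \<xi>" and ?b = "vnorm G n (lreg_apply G n x \<xi>)"
  have *: "t * ?b \<le> C" if "0 < t" "t * ?a \<le> 1" for t
  proof -
    let ?\<xi> = "\<lambda>k i. of_real t * \<xi> k i"
    have "vec_supp G n ?\<xi> = vec_supp G n \<xi>" using that by (auto simp: vec_supp_def)
    then have "ereal (vnorm G n (lreg_apply G n x ?\<xi>)) \<le> op_norm G n x"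
      unfolding op_norm_def using assms(2) that vnorm_scale[OF that(1), of G n \<xi>]
      by (intro SUP_upper) auto
    then have "vnorm G n (lreg_apply G n x ?\<xi>) \<le> C" using assms(1) by (metis ereal_less_eq(3) order_trans)
    moreover have "lreg_apply G n x ?\<xi> = (\<lambda>k i. of_real t * lreg_apply G n x \<xi> k i)"
      unfolding lreg_apply_def by (simp add: sum_distrib_left algebra_simps)
    ultimately show ?thesis using vnorm_scale[OF that(1)] by metis
  qed
  show ?thesis
  proof (cases "?a = 0")
    case False
    then have "0 < ?a" using vnorm_nonneg[of G n \<xi>] by linarith
    then show ?thesis using *[of "1 / ?a"] by (simp add: field_simps)
  next
    case True
    \<comment> \<open>Every positive multiple of \<open>\<xi>\<close> lies in the unit ball, so
      \<open>*\<close> bounds all multiples of \<open>?b\<close> by the same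
      \<open>C\<close>.\<close>
    have "?b \<le> 0"
    proof (rule ccontr)
      assume "\<not> ?b \<le> 0"
      then show False using *[of "(C + 1) / ?b"] True assms(3) by (simp add: field_simps)
    qed
    then show ?thesis using True by simp
  qed
qed

text \<open>Weighted AM-GM. It replaces Cauchy-Schwarz for multiple sums: it is applied term by
  term, and \<open>t\<close> is chosen once after summation.\<close>

lemma two_Re_cnj_mult_le:
  assumes "0 < t"
  shows "2 * Re (cnj p * q) \<le> t * (cmod p)\<^sup>2 + (cmod q)\<^sup>2 / t"
proof -
  have "2 * Re (cnj p * q) \<le> 2 * (cmod p * cmod q)"
    by (metis complex_Re_le_cmod complex_mod_cnj mult_left_mono norm_mult zero_le_numeral)
  also have "\<dots> \<le> t * (cmod p)\<^sup>2 + (cmod q)\<^sup>2 / t"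
  proof -
    have "0 \<le> (t * cmod p - cmod q)\<^sup>2" by simp
    then have "2 * (t * (cmod p * cmod q)) \<le> t * (t * (cmod p)\<^sup>2) + (cmod q)\<^sup>2"
      by (simp add: power2_eq_square algebra_simps)
    then show ?thesis using assms by (simp add: field_simps)
  qed
  finally show ?thesis .
qed

text \<open>A Gram factorization of the kernel writes \<open>\<lambda>(\<phi> x)\<close> as a row of diagonal operators times
  an amplification of \<open>\<lambda>(x)\<close> times a column of diagonal operators.\<close>
lemma vnorm_multiplier_le:
  fixes G (structure)
  assumes "group G" and schur: "\<And>S. finite S \<Longrightarrow> S \<subseteq> carrier G \<Longrightarrow> schur_bd S c (\<lambda>s t. \<phi> (inv\<^bsub>G\<^esub> s \<otimes>\<^bsub>G\<^esub> t))"
    and x: "finite (mat_supp G n x)" "op_norm G n x \<le> 1"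
    and \<xi>: "finite (vec_supp G n \<xi>)" "vnorm G n \<xi> \<le> 1" and c: "0 \<le> c"
  shows "vnorm G n (lreg_apply G n (\<lambda>g i j. \<phi> g * x g i j) \<xi>) \<le> c"
proof -
  interpret group G by fact
  let ?y = "\<lambda>g i j. \<phi> g * x g i j"
  define X where "X = mat_supp G n x"
  define U where "U = vec_supp G n \<xi>"
  define V where "V = (\<lambda>(g, h). g \<otimes> h) ` (X \<times> U)"
  define \<eta> where "\<eta> = lreg_apply G n ?y \<xi>"
  have X: "finite X" "X \<subseteq> carrier G" "mat_supp G n ?y \<subseteq> X" "mat_supp G n x \<subseteq> X"
    using x by (auto simp: X_def mat_supp_def)
  have U: "finite U" "U \<subseteq> carrier G" using \<xi> by (auto simp: U_def vec_supp_def)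
  note cover = vec_supp_lreg_cover[OF assms(1) _ X(1,2)]
  have V: "vec_supp G n \<eta> \<subseteq> V" "finite V" "V \<subseteq> carrier G"
    using cover[OF X(3) \<xi>(1)] unfolding V_def \<eta>_def U_def by blast+
  \<comment> \<open>With \<open>h = inv g \<otimes> k\<close> one has
    \<open>g = inv (inv k) \<otimes> inv h\<close>, so \<open>\<phi> g\<close> is the kernel entry
    at \<open>(inv k, inv h)\<close>; \<open>V\<close> carries the outputs \<open>k\<close> and
    \<open>U\<close> the inputs \<open>h\<close>.\<close>
  define S where "S = (\<lambda>k. inv k) ` (V \<union> U)"
  have S: "finite S" "S \<subseteq> carrier G" using V U by (auto simp: S_def)
  obtain R where R: "psd (S <+> S) R" "\<And>s t. s \<in> S \<Longrightarrow> t \<in> S \<Longrightarrow> R (Inl s) (Inr t) = \<phi> (inv s \<otimes> t)"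
    "\<And>i. i \<in> S <+> S \<Longrightarrow> Re (R i i) \<le> c" using schur_bdE[OF schur[OF S]] by metis
  obtain N \<gamma> where \<gamma>: "\<And>i j. i \<in> S <+> S \<Longrightarrow> j \<in> S <+> S \<Longrightarrow> R i j = (\<Sum>m<(N::nat). cnj (\<gamma> m i) * \<gamma> m j)"
    using psd_gram[OF finite_Plus[OF S(1) S(1)] R(1)] by blast
  define a where "a = (\<lambda>m k. \<gamma> m (Inl (inv k)))"
  define b where "b = (\<lambda>m k. \<gamma> m (Inr (inv k)))"
  define L where "L = (\<lambda>m. lreg_apply G n x (\<lambda>h j. b m h * \<xi> h j))"
  have diag: "(\<Sum>m<N. (cmod (\<gamma> m i))\<^sup>2) \<le> c" if "i \<in> S <+> S" for i
  proof -
    have "R i i = of_real (\<Sum>m<N. (cmod (\<gamma> m i))\<^sup>2)"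
      unfolding \<gamma>[OF that that] of_real_sum by (intro sum.cong) (metis complex_norm_square mult.commute)+
    then show ?thesis using R(3)[OF that] by simp
  qed
  have a: "(\<Sum>m<N. (cmod (a m k))\<^sup>2) \<le> c" if "k \<in> V" for k
    unfolding a_def by (rule diag) (use that in \<open>auto simp: S_def\<close>)
  have b: "(\<Sum>m<N. (cmod (b m k))\<^sup>2) \<le> c" if "k \<in> U" for k
    unfolding b_def by (rule diag) (use that in \<open>auto simp: S_def\<close>)
  have \<eta>: "\<eta> k i = (\<Sum>m<N. cnj (a m k) * L m k i)" if k: "k \<in> V" and i: "i < n" for k i
  proof -
    have kc: "k \<in> carrier G" using V k by blast
    have term_eq: "\<phi> g * x g i j * \<xi> (inv g \<otimes> k) j
        = (\<Sum>m<N. cnj (a m k) * (x g i j * (b m (inv g \<otimes> k) * \<xi> (inv g \<otimes> k) j)))"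
      if g: "g \<in> X" and j: "j < n" for g j
    proof (cases "\<xi> (inv g \<otimes> k) j = 0")
      case False
      have gc: "g \<in> carrier G" using X g by blast
      then have h: "inv g \<otimes> k \<in> U" using False j kc by (auto simp: U_def vec_supp_def)
      have "inv k \<in> S" "inv (inv g \<otimes> k) \<in> S" using k h by (auto simp: S_def)
      then have "\<phi> g = R (Inl (inv k)) (Inr (inv (inv g \<otimes> k)))"
        using R(2)[of "inv k" "inv (inv g \<otimes> k)"] gc kc by (simp add: inv_mult_group m_assoc[symmetric])
      also have "\<dots> = (\<Sum>m<N. cnj (a m k) * b m (inv g \<otimes> k))"
        unfolding a_def b_def by (rule \<gamma>) (use k h in \<open>auto simp: S_def\<close>)
      finally show ?thesis by (simp add: sum_distrib_left sum_distrib_right algebra_simps)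
    qed simp
    have "\<eta> k i = (\<Sum>g\<in>X. \<Sum>j<n. \<phi> g * x g i j * \<xi> (inv g \<otimes> k) j)"
      unfolding \<eta>_def by (rule lreg_apply_superset[OF X(3,1,2) i])
    also have "\<dots> = (\<Sum>g\<in>X. \<Sum>j<n. \<Sum>m<N. cnj (a m k) * (x g i j * (b m (inv g \<otimes> k) * \<xi> (inv g \<otimes> k) j)))"
      by (intro sum.cong refl) (use term_eq in auto)
    also have "\<dots> = (\<Sum>g\<in>X. \<Sum>m<N. \<Sum>j<n. cnj (a m k) * (x g i j * (b m (inv g \<otimes> k) * \<xi> (inv g \<otimes> k) j)))"
      by (rule sum.cong[OF refl], rule sum.swap)
    also have "\<dots> = (\<Sum>m<N. \<Sum>g\<in>X. \<Sum>j<n. cnj (a m k) * (x g i j * (b m (inv g \<otimes> k) * \<xi> (inv g \<otimes> k) j)))"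
      by (rule sum.swap)
    also have "\<dots> = (\<Sum>m<N. cnj (a m k) * L m k i)"
      unfolding L_def lreg_apply_superset[OF X(4,1,2) i] by (simp add: sum_distrib_left)
    finally show ?thesis .
  qed
  have L: "(\<Sum>k\<in>V. \<Sum>i<n. (cmod (L m k i))\<^sup>2) \<le> (\<Sum>k\<in>U. \<Sum>i<n. (cmod (b m k))\<^sup>2 * (cmod (\<xi> k i))\<^sup>2)" for m
  proof -
    let ?\<zeta> = "\<lambda>h j. b m h * \<xi> h j"
    have sub: "vec_supp G n ?\<zeta> \<subseteq> U" by (auto simp: U_def vec_supp_def)
    then have fin: "finite (vec_supp G n ?\<zeta>)" using U finite_subset by blast
    have "vec_supp G n (L m) \<subseteq> V"
      using cover(1)[OF X(4) fin] sub unfolding V_def L_def by fast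
    then have "(\<Sum>k\<in>V. \<Sum>i<n. (cmod (L m k i))\<^sup>2) = (vnorm G n (L m))\<^sup>2" using vnorm_sq V by metis
    also have "\<dots> \<le> (vnorm G n ?\<zeta>)\<^sup>2"
      using vnorm_lreg_le[of G n x 1 ?\<zeta>] x(2) fin vnorm_nonneg[of G n "L m"]
      unfolding L_def by (intro power_mono) (auto simp: one_ereal_def)
    also have "\<dots> = (\<Sum>k\<in>U. \<Sum>i<n. (cmod (?\<zeta> k i))\<^sup>2)" using vnorm_sq[OF sub U] .
    finally show ?thesis by (simp add: norm_mult power_mult_distrib)
  qed
  define H where "H = vnorm G n \<eta>"
  have H2: "H\<^sup>2 = (\<Sum>k\<in>V. \<Sum>i<n. (cmod (\<eta> k i))\<^sup>2)" unfolding H_def using vnorm_sq[OF V] .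
  \<comment> \<open>\<open>H\<^sup>2\<close> is the pairing of \<open>\<eta>\<close> with its own
    expansion, that is, of the vectors \<open>a m k * \<eta> k\<close> with \<open>L m\<close>.
    AM-GM separates the two; the value \<open>t = 1 / H\<close> balances them.\<close>
  have main: "2 * H\<^sup>2 \<le> t * (c * H\<^sup>2) + c / t" if t: "0 < t" for t
  proof -
    have "2 * H\<^sup>2 = (\<Sum>k\<in>V. \<Sum>i<n. \<Sum>m<N. 2 * Re (cnj (a m k * \<eta> k i) * L m k i))"
      unfolding H2 sum_distrib_left
    proof (intro sum.cong refl)
      fix k i assume "k \<in> V" "i \<in> {..<n}"
      then have "of_real ((cmod (\<eta> k i))\<^sup>2) = (\<Sum>m<N. cnj (a m k * \<eta> k i) * L m k i)"
        using \<eta>[of k i] by (simp add: complex_norm_square sum_distrib_left mult_ac del: of_real_power)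
      then have "(cmod (\<eta> k i))\<^sup>2 = Re (\<Sum>m<N. cnj (a m k * \<eta> k i) * L m k i)"
        by (metis Re_complex_of_real)
      then show "2 * (cmod (\<eta> k i))\<^sup>2 = (\<Sum>m<N. 2 * Re (cnj (a m k * \<eta> k i) * L m k i))"
        by (simp only: Re_sum sum_distrib_left)
    qed
    also have "\<dots> \<le> (\<Sum>k\<in>V. \<Sum>i<n. \<Sum>m<N. t * (cmod (a m k * \<eta> k i))\<^sup>2 + (cmod (L m k i))\<^sup>2 / t)"
      by (intro sum_mono two_Re_cnj_mult_le t)
    also have "\<dots> = (\<Sum>k\<in>V. \<Sum>i<n. \<Sum>m<N. t * (cmod (a m k * \<eta> k i))\<^sup>2)
        + (\<Sum>k\<in>V. \<Sum>i<n. \<Sum>m<N. (cmod (L m k i))\<^sup>2 / t)"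
      by (simp only: sum.distrib)
    also have "\<dots> \<le> t * (c * H\<^sup>2) + c / t"
    proof (rule add_mono)
      have "(\<Sum>k\<in>V. \<Sum>i<n. \<Sum>m<N. t * (cmod (a m k * \<eta> k i))\<^sup>2)
          = t * (\<Sum>k\<in>V. \<Sum>i<n. (\<Sum>m<N. (cmod (a m k))\<^sup>2) * (cmod (\<eta> k i))\<^sup>2)"
        by (simp add: norm_mult power_mult_distrib sum_distrib_left sum_distrib_right)
      also have "\<dots> \<le> t * (\<Sum>k\<in>V. \<Sum>i<n. c * (cmod (\<eta> k i))\<^sup>2)"
        using t a by (intro mult_left_mono sum_mono mult_right_mono) auto
      also have "\<dots> = t * (c * H\<^sup>2)" unfolding H2 by (simp add: sum_distrib_left)
      finally show "(\<Sum>k\<in>V. \<Sum>i<n. \<Sum>m<N. t * (cmod (a m k * \<eta> k i))\<^sup>2) \<le> t * (c * H\<^sup>2)" .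
    next
      have "(\<Sum>k\<in>V. \<Sum>i<n. \<Sum>m<N. (cmod (L m k i))\<^sup>2 / t) = (\<Sum>k\<in>V. \<Sum>m<N. \<Sum>i<n. (cmod (L m k i))\<^sup>2 / t)"
        by (rule sum.cong[OF refl], rule sum.swap)
      also have "\<dots> = (\<Sum>m<N. \<Sum>k\<in>V. \<Sum>i<n. (cmod (L m k i))\<^sup>2 / t)" by (rule sum.swap)
      also have "\<dots> = (\<Sum>m<N. \<Sum>k\<in>V. \<Sum>i<n. (cmod (L m k i))\<^sup>2) / t" by (simp add: sum_divide_distrib)
      also have "\<dots> \<le> (\<Sum>m<N. \<Sum>k\<in>U. \<Sum>i<n. (cmod (b m k))\<^sup>2 * (cmod (\<xi> k i))\<^sup>2) / t"
        using t L by (intro divide_right_mono sum_mono) auto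
      also have "(\<Sum>m<N. \<Sum>k\<in>U. \<Sum>i<n. (cmod (b m k))\<^sup>2 * (cmod (\<xi> k i))\<^sup>2)
          = (\<Sum>k\<in>U. \<Sum>m<N. \<Sum>i<n. (cmod (b m k))\<^sup>2 * (cmod (\<xi> k i))\<^sup>2)" by (rule sum.swap)
      also have "\<dots> = (\<Sum>k\<in>U. (\<Sum>m<N. (cmod (b m k))\<^sup>2) * (\<Sum>i<n. (cmod (\<xi> k i))\<^sup>2))"
        by (simp add: sum_product)
      also have "\<dots> / t \<le> (\<Sum>k\<in>U. c * (\<Sum>i<n. (cmod (\<xi> k i))\<^sup>2)) / t"
        using t b by (intro divide_right_mono sum_mono mult_right_mono sum_nonneg) auto
      also have "(\<Sum>k\<in>U. c * (\<Sum>i<n. (cmod (\<xi> k i))\<^sup>2)) = c * (vnorm G n \<xi>)\<^sup>2"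
        using vnorm_sq[of G n \<xi> U] U unfolding U_def by (simp add: sum_distrib_left)
      also have "\<dots> / t \<le> c / t"
        using t c \<xi>(2) vnorm_nonneg[of G n \<xi>] by (intro divide_right_mono mult_left_le power_le_one) auto
      finally show "(\<Sum>k\<in>V. \<Sum>i<n. \<Sum>m<N. (cmod (L m k i))\<^sup>2 / t) \<le> c / t" .
    qed
    finally show ?thesis .
  qed
  show ?thesis
  proof (cases "H = 0")
    case True
    then show ?thesis using c unfolding H_def \<eta>_def by simp
  next
    case False
    then have H: "0 < H" using vnorm_nonneg[of G n \<eta>] unfolding H_def by linarith
    then have "2 * H\<^sup>2 \<le> 2 * (c * H)" using main[of "1 / H"] by (simp add: power2_eq_square)
    then have "H \<le> c" using H by (simp add: power2_eq_square)
    then show ?thesis unfolding H_def \<eta>_def .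
  qed
qed

lemma cb_norm_le:
  assumes "group G" "\<And>S. finite S \<Longrightarrow> S \<subseteq> carrier G \<Longrightarrow> schur_bd S c (\<lambda>s t. \<phi> (inv\<^bsub>G\<^esub> s \<otimes>\<^bsub>G\<^esub> t))" "0 \<le> c"
  shows "cb_norm G \<phi> \<le> ereal c"
  unfolding cb_norm_def
proof (intro SUP_least)
  fix n x assume x: "x \<in> {x. finite (mat_supp G n x) \<and> op_norm G n x \<le> 1}"
  show "op_norm G n (\<lambda>g i j. \<phi> g * x g i j) \<le> ereal c"
    unfolding op_norm_def[of G n "\<lambda>g i j. \<phi> g * x g i j"]
    using vnorm_multiplier_le[OF assms(1,2)] x assms(3) by (intro SUP_least) auto
qed

section \<open>From cb-norms to positive definite kernels\<close>

lemma sum_translate_le: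
  fixes G (structure) and f :: "'a \<Rightarrow> real"
  assumes "group G" "a \<in> carrier G" "finite A" "A \<subseteq> carrier G" "finite H"
    "\<And>h. 0 \<le> f h" "\<And>h. h \<in> carrier G \<Longrightarrow> h \<notin> H \<Longrightarrow> f h = 0"
  shows "(\<Sum>k\<in>A. f (a \<otimes> k)) \<le> (\<Sum>h\<in>H. f h)"
proof -
  interpret group G by fact
  let ?B = "(\<lambda>k. a \<otimes> k) ` A"
  have inj: "inj_on (\<lambda>k. a \<otimes> k) A"
    using inj_on_subset[OF inj_on_cmult[OF assms(2)] assms(4)] .
  have "(\<Sum>k\<in>A. f (a \<otimes> k)) = (\<Sum>h\<in>?B. f h)" by (simp add: sum.reindex[OF inj])
  also have "\<dots> = (\<Sum>h\<in>?B \<inter> H. f h)"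
    using assms m_closed[OF assms(2)] by (intro sum.mono_neutral_right) (auto, blast)
  also have "\<dots> \<le> (\<Sum>h\<in>H. f h)" using assms by (intro sum_mono2) auto
  finally show ?thesis .
qed

text \<open>The matrix \<open>b\<close> on \<open>S\<close> is turned into the element \<open>(b s t \<lambda>(s\<^sup>-\<^sup>1 t))\<close> of \<open>M\<^sub>n(C[G])\<close>, which is
  unitarily conjugate to \<open>b \<otimes> 1\<close>; multiplication by \<open>\<phi>\<close> becomes the Schur product.\<close>
lemma schur_multiplier_contractive:
  fixes G (structure)
  assumes "group G" and cb: "cb_norm G \<phi> \<le> ereal C" "0 \<le> C" and S: "finite S" "S \<subseteq> carrier G"
    and b: "\<And>v. (\<Sum>s\<in>S. (cmod (\<Sum>t\<in>S. b s t * v t))\<^sup>2) \<le> (\<Sum>t\<in>S. (cmod (v t))\<^sup>2)"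
  shows "(\<Sum>s\<in>S. (cmod (\<Sum>t\<in>S. \<phi> (inv s \<otimes> t) * b s t * v t))\<^sup>2) \<le> C\<^sup>2 * (\<Sum>t\<in>S. (cmod (v t))\<^sup>2)"
proof -
  interpret group G by fact
  define n where "n = card S"
  obtain e where "bij_betw e {0..<card S} S" using ex_bij_betw_nat_finite[OF S(1)] by blast
  then have e: "bij_betw e {..<n} S" unfolding n_def by (simp add: atLeast0LessThan)
  have eS: "e i \<in> S" if "i < n" for i using that e by (auto simp: bij_betw_def)
  have ec: "e i \<in> carrier G" if "i < n" for i using eS[OF that] S by blast
  have reindex: "(\<Sum>i<n. f (e i)) = (\<Sum>s\<in>S. f s)" for f :: "'a \<Rightarrow> 'c::comm_monoid_add"
    by (rule sum.reindex_bij_betw[OF e])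
  define x where "x = (\<lambda>g i j. if g = inv (e i) \<otimes> e j then b (e i) (e j) else 0)"
  define X where "X = (\<lambda>(i, j). inv (e i) \<otimes> e j) ` ({..<n} \<times> {..<n})"
  have X: "finite X" "X \<subseteq> carrier G" unfolding X_def using ec by auto
  have supp: "mat_supp G n (\<lambda>g i j. \<psi> g * x g i j) \<subseteq> X" for \<psi>
    by (auto simp: mat_supp_def x_def X_def split: if_splits)
  have supp1: "mat_supp G n x \<subseteq> X" using supp[of "\<lambda>_. 1"] by simp
  have lreg: "lreg_apply G n (\<lambda>g i j. \<psi> g * x g i j) \<xi> k i
      = (\<Sum>j<n. \<psi> (inv (e i) \<otimes> e j) * b (e i) (e j) * \<xi> (inv (e j) \<otimes> (e i \<otimes> k)) j)"
    if i: "i < n" and k: "k \<in> carrier G" for \<psi> \<xi> k i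
  proof -
    have "lreg_apply G n (\<lambda>g i j. \<psi> g * x g i j) \<xi> k i
        = (\<Sum>g\<in>X. \<Sum>j<n. \<psi> g * x g i j * \<xi> (inv g \<otimes> k) j)"
      by (rule lreg_apply_superset[OF supp X i])
    also have "\<dots> = (\<Sum>j<n. \<Sum>g\<in>X. \<psi> g * x g i j * \<xi> (inv g \<otimes> k) j)" by (rule sum.swap)
    also have "\<dots> = (\<Sum>j<n. \<psi> (inv (e i) \<otimes> e j) * b (e i) (e j) * \<xi> (inv (e j) \<otimes> (e i \<otimes> k)) j)"
    proof (rule sum.cong[OF refl])
      fix j assume j: "j \<in> {..<n}"
      let ?g = "inv (e i) \<otimes> e j"
      have "(\<Sum>g\<in>X. \<psi> g * x g i j * \<xi> (inv g \<otimes> k) j)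
          = (\<Sum>g\<in>X. if g = ?g then \<psi> ?g * b (e i) (e j) * \<xi> (inv ?g \<otimes> k) j else 0)"
        by (rule sum.cong) (auto simp: x_def)
      also have "\<dots> = \<psi> ?g * b (e i) (e j) * \<xi> (inv ?g \<otimes> k) j"
        using X(1) i j by (auto simp: X_def)
      also have "inv ?g \<otimes> k = inv (e j) \<otimes> (e i \<otimes> k)"
        using ec i j k by (simp add: inv_mult_group m_assoc)
      finally show "(\<Sum>g\<in>X. \<psi> g * x g i j * \<xi> (inv g \<otimes> k) j)
        = \<psi> ?g * b (e i) (e j) * \<xi> (inv (e j) \<otimes> (e i \<otimes> k)) j" .
    qed
    finally show ?thesis .
  qed
  \<comment> \<open>The substitution \<open>h = e i \<otimes> k\<close> removes the translation from
    row \<open>i\<close>. For each fixed \<open>h\<close> the operator is then the matrix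
    \<open>b\<close> applied to the vector with entries
    \<open>\<xi> (inv (e j) \<otimes> h) j\<close>.\<close>
  have contr: "vnorm G n (lreg_apply G n x \<xi>) \<le> 1"
    if fin: "finite (vec_supp G n \<xi>)" and le1: "vnorm G n \<xi> \<le> 1" for \<xi>
  proof -
    define U where "U = vec_supp G n \<xi>"
    define V where "V = (\<lambda>(g, h). g \<otimes> h) ` (X \<times> U)"
    have V: "vec_supp G n (lreg_apply G n x \<xi>) \<subseteq> V" "finite V" "V \<subseteq> carrier G"
      using vec_supp_lreg_cover[OF assms(1) supp1 X fin] unfolding V_def U_def by blast+
    define H where "H = (\<lambda>(j, h). e j \<otimes> h) ` ({..<n} \<times> U)"
    have U: "finite U" "U \<subseteq> carrier G" using fin by (auto simp: U_def vec_supp_def)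
    have H: "finite H" "H \<subseteq> carrier G" unfolding H_def using U ec by auto
    define f where "f = (\<lambda>i h. (cmod (\<Sum>j<n. b (e i) (e j) * \<xi> (inv (e j) \<otimes> h) j))\<^sup>2)"
    have out: "\<xi> (inv (e j) \<otimes> h) j = 0" if "j < n" "h \<in> carrier G" "h \<notin> H" for j h
    proof (rule ccontr)
      assume "\<xi> (inv (e j) \<otimes> h) j \<noteq> 0"
      then have "inv (e j) \<otimes> h \<in> U" using that ec by (auto simp: U_def vec_supp_def)
      moreover have "h = e j \<otimes> (inv (e j) \<otimes> h)" using ec that by (simp add: m_assoc[symmetric])
      ultimately have "h \<in> H" unfolding H_def using that(1) by force
      then show False using that by blast
    qed
    have "(vnorm G n (lreg_apply G n x \<xi>))\<^sup>2 = (\<Sum>k\<in>V. \<Sum>i<n. f i (e i \<otimes> k))"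
      unfolding vnorm_sq[OF V] f_def using lreg[of _ _ "\<lambda>_. 1" \<xi>] V(3) by (auto intro!: sum.cong)
    also have "\<dots> = (\<Sum>i<n. \<Sum>k\<in>V. f i (e i \<otimes> k))" by (rule sum.swap)
    also have "\<dots> \<le> (\<Sum>i<n. \<Sum>h\<in>H. f i h)"
      using ec V(2,3) H(1) out by (intro sum_mono sum_translate_le[OF assms(1)]) (auto simp: f_def intro!: sum.neutral)
    also have "\<dots> = (\<Sum>h\<in>H. \<Sum>i<n. f i h)" by (rule sum.swap)
    also have "\<dots> \<le> (\<Sum>h\<in>H. \<Sum>j<n. (cmod (\<xi> (inv (e j) \<otimes> h) j))\<^sup>2)"
    proof (rule sum_mono)
      fix h
      define v where "v = (\<lambda>s. \<xi> (inv s \<otimes> h) (the_inv_into {..<n} e s))"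
      have v: "v (e j) = \<xi> (inv (e j) \<otimes> h) j" if "j < n" for j
        unfolding v_def using e that by (simp add: the_inv_into_f_f bij_betw_def)
      have "(\<Sum>i<n. f i h) = (\<Sum>i<n. (cmod (\<Sum>j<n. b (e i) (e j) * v (e j)))\<^sup>2)"
        unfolding f_def using v by simp
      also have "\<dots> = (\<Sum>s\<in>S. (cmod (\<Sum>t\<in>S. b s t * v t))\<^sup>2)"
        unfolding reindex[of "\<lambda>t. b s t * v t" for s] by (rule reindex)
      also have "\<dots> \<le> (\<Sum>t\<in>S. (cmod (v t))\<^sup>2)" by (rule b)
      also have "\<dots> = (\<Sum>j<n. (cmod (v (e j)))\<^sup>2)" by (rule reindex[symmetric])
      finally show "(\<Sum>i<n. f i h) \<le> (\<Sum>j<n. (cmod (\<xi> (inv (e j) \<otimes> h) j))\<^sup>2)" using v by simp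
    qed
    also have "\<dots> = (\<Sum>j<n. \<Sum>h\<in>H. (cmod (\<xi> (inv (e j) \<otimes> h) j))\<^sup>2)" by (rule sum.swap)
    also have "\<dots> \<le> (\<Sum>j<n. \<Sum>k\<in>U. (cmod (\<xi> k j))\<^sup>2)"
      using ec H U(1) by (intro sum_mono sum_translate_le[OF assms(1), where f = "\<lambda>k. (cmod (\<xi> k _))\<^sup>2"])
        (auto simp: U_def vec_supp_def)
    also have "\<dots> = (\<Sum>k\<in>U. \<Sum>j<n. (cmod (\<xi> k j))\<^sup>2)" by (rule sum.swap)
    also have "\<dots> = (vnorm G n \<xi>)\<^sup>2" by (rule vnorm_sq[symmetric]) (use U in \<open>auto simp: U_def\<close>)
    also have "\<dots> \<le> 1" using le1 vnorm_nonneg[of G n \<xi>] by (simp add: power_le_one)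
    finally show ?thesis by (simp add: power_le_one_iff vnorm_nonneg abs_square_le_1)
  qed
  have "op_norm G n x \<le> 1"
    unfolding op_norm_def by (rule SUP_least) (use contr in \<open>auto simp: one_ereal_def\<close>)
  moreover have "finite (mat_supp G n x)" using supp1 X(1) finite_subset by blast
  ultimately have "op_norm G n (\<lambda>g i j. \<phi> g * x g i j) \<le> cb_norm G \<phi>"
    unfolding cb_norm_def by (intro SUP_upper2[of n] SUP_upper) auto
  then have op: "op_norm G n (\<lambda>g i j. \<phi> g * x g i j) \<le> ereal C" using cb(1) by (rule order_trans)
  \<comment> \<open>Coordinate \<open>j\<close> is placed at \<open>inv (e j)\<close>, so that the
    output in coordinate \<open>i\<close> at the point \<open>inv (e i)\<close> is row
    \<open>i\<close> of the Schur product applied to \<open>v\<close>.\<close>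
  define \<xi> where "\<xi> = (\<lambda>g j. if g = inv (e j) then v (e j) else 0)"
  define W where "W = (\<lambda>s. inv s) ` S"
  have W: "finite W" "W \<subseteq> carrier G" using S by (auto simp: W_def)
  have \<xi>W: "vec_supp G n \<xi> \<subseteq> W" using eS by (auto simp: vec_supp_def \<xi>_def W_def split: if_splits)
  then have fin: "finite (vec_supp G n \<xi>)" using W finite_subset by blast
  have "(vnorm G n \<xi>)\<^sup>2 = (\<Sum>k\<in>W. \<Sum>j<n. (cmod (\<xi> k j))\<^sup>2)" by (rule vnorm_sq[OF \<xi>W W])
  also have "\<dots> = (\<Sum>j<n. \<Sum>k\<in>W. (cmod (\<xi> k j))\<^sup>2)" by (rule sum.swap)
  also have "\<dots> = (\<Sum>j<n. \<Sum>k\<in>W. if k = inv (e j) then (cmod (v (e j)))\<^sup>2 else 0)"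
    by (intro sum.cong refl) (auto simp: \<xi>_def)
  also have "\<dots> = (\<Sum>j<n. (cmod (v (e j)))\<^sup>2)"
    using W eS by (intro sum.cong refl) (auto simp: W_def)
  also have "\<dots> = (\<Sum>t\<in>S. (cmod (v t))\<^sup>2)" by (rule reindex)
  finally have norm\<xi>: "(vnorm G n \<xi>)\<^sup>2 = (\<Sum>t\<in>S. (cmod (v t))\<^sup>2)" .
  define \<eta> where "\<eta> = lreg_apply G n (\<lambda>g i j. \<phi> g * x g i j) \<xi>"
  define V where "V = (\<lambda>(g, h). g \<otimes> h) ` (X \<times> vec_supp G n \<xi>)"
  have V: "vec_supp G n \<eta> \<subseteq> V" "finite V" "V \<subseteq> carrier G"
    using vec_supp_lreg_cover[OF assms(1) supp[of \<phi>] X fin] unfolding V_def \<eta>_def by blast+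
  have \<eta>: "\<eta> (inv (e i)) i = (\<Sum>t\<in>S. \<phi> (inv (e i) \<otimes> t) * b (e i) t * v t)" if "i < n" for i
  proof -
    have "\<eta> (inv (e i)) i = (\<Sum>j<n. \<phi> (inv (e i) \<otimes> e j) * b (e i) (e j) * v (e j))"
      unfolding \<eta>_def lreg[OF that inv_closed[OF ec[OF that]]]
      by (intro sum.cong refl) (use that ec in \<open>auto simp: \<xi>_def\<close>)
    then show ?thesis unfolding reindex[of "\<lambda>t. \<phi> (inv (e i) \<otimes> t) * b (e i) t * v t"] .
  qed
  have "(\<Sum>s\<in>S. (cmod (\<Sum>t\<in>S. \<phi> (inv s \<otimes> t) * b s t * v t))\<^sup>2)
      = (\<Sum>i<n. (cmod (\<Sum>t\<in>S. \<phi> (inv (e i) \<otimes> t) * b (e i) t * v t))\<^sup>2)" by (rule reindex[symmetric])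
  also have "\<dots> = (\<Sum>i<n. (cmod (\<eta> (inv (e i)) i))\<^sup>2)" using \<eta> by simp
  also have "\<dots> \<le> (\<Sum>i<n. \<Sum>k\<in>V \<union> W. (cmod (\<eta> k i))\<^sup>2)"
    using V W eS by (intro sum_mono member_le_sum) (auto simp: W_def)
  also have "\<dots> = (\<Sum>k\<in>V \<union> W. \<Sum>i<n. (cmod (\<eta> k i))\<^sup>2)" by (rule sum.swap)
  also have "\<dots> = (vnorm G n \<eta>)\<^sup>2" by (rule vnorm_sq[symmetric]) (use V W in auto)
  also have "\<dots> \<le> (C * vnorm G n \<xi>)\<^sup>2"
    unfolding \<eta>_def by (intro power_mono vnorm_lreg_le op fin cb(2) vnorm_nonneg)
  finally show ?thesis unfolding power_mult_distrib norm\<xi> .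
qed

section \<open>Riesz extension and completion of partial positive kernels\<close>

lemma positive_extension_step:
  fixes L l :: "'v \<Rightarrow> real"
  assumes comb: "\<And>Y Z s t. Y \<in> C \<Longrightarrow> Z \<in> C \<Longrightarrow> 0 < s \<Longrightarrow> 0 < t \<Longrightarrow>
      \<exists>X\<in>C. L X = s * L Y + t * L Z \<and> l X = s * l Y + t * l Z"
    and flip: "\<And>Z. Z \<in> C \<Longrightarrow> \<exists>Z'\<in>C. l Z' = - l Z"
    and pos: "\<And>Z. Z \<in> C \<Longrightarrow> l Z = 0 \<Longrightarrow> 0 \<le> L Z"
  shows "\<exists>c. \<forall>Z\<in>C. 0 \<le> L Z + c * l Z"
proof (cases "\<forall>Z\<in>C. l Z = 0")
  case True
  then show ?thesis using pos by (intro exI[of _ 0]) auto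
next
  case False
  then obtain P M where P: "P \<in> C" "0 < l P" and M: "M \<in> C" "l M < 0"
    using flip by (metis linorder_less_linear neg_0_less_iff_less neg_less_0_iff_less)
  \<comment> \<open>Elements with \<open>l > 0\<close> bound the wanted \<open>c\<close> from below,
    those with \<open>l < 0\<close> from above. The positive combination on which \<open>l\<close>
    vanishes shows that the bounds are compatible; \<open>flip\<close> has supplied elements of both
    kinds.\<close>
  have key: "- L Y / l Y \<le> L Z / (- l Z)" if YZ: "Y \<in> C" "Z \<in> C" "0 < l Y" "l Z < 0" for Y Z
  proof -
    obtain X where "X \<in> C" "L X = (- l Z) * L Y + l Y * L Z" "l X = (- l Z) * l Y + l Y * l Z"
      using comb[OF YZ(1,2), of "- l Z" "l Y"] YZ by auto
    then have "0 \<le> (- l Z) * L Y + l Y * L Z" using pos[of X] by (simp add: algebra_simps)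
    then have "- (l Y * L Z) \<le> - (l Z * L Y)" by simp
    then show ?thesis using YZ by (simp add: field_simps)
  qed
  define c where "c = (SUP Y\<in>{Y\<in>C. 0 < l Y}. - L Y / l Y)"
  have ne: "{Y\<in>C. 0 < l Y} \<noteq> {}" using P by blast
  have bdd: "bdd_above ((\<lambda>Y. - L Y / l Y) ` {Y\<in>C. 0 < l Y})"
    using key M by (intro bdd_aboveI2[of _ _ "L M / (- l M)"]) auto
  have "0 \<le> L Z + c * l Z" if Z: "Z \<in> C" for Z
  proof -
    consider "l Z = 0" | "0 < l Z" | "l Z < 0" by linarith
    then show ?thesis
    proof cases
      case 1
      then show ?thesis using pos Z by simp
    next
      case 2
      then have "- L Z / l Z \<le> c" unfolding c_def using Z bdd by (intro cSUP_upper) auto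
      then show ?thesis using 2 by (simp add: field_simps)
    next
      case 3
      then have "c \<le> L Z / (- l Z)" unfolding c_def using Z key by (intro cSUP_least[OF ne]) auto
      then show ?thesis using 3 by (simp add: field_simps)
    qed
  qed
  then show ?thesis by blast
qed

text \<open>M. Riesz extension, with the symmetry \<open>flip\<close> in place of the usual order unit.\<close>
lemma positive_extension:
  fixes L :: "'v \<Rightarrow> real" and l :: "'f \<Rightarrow> 'v \<Rightarrow> real"
  assumes "finite F"
    and "\<And>Y Z s t. Y \<in> C \<Longrightarrow> Z \<in> C \<Longrightarrow> 0 < s \<Longrightarrow> 0 < t \<Longrightarrow>
      \<exists>X\<in>C. L X = s * L Y + t * L Z \<and> (\<forall>f\<in>F. l f X = s * l f Y + t * l f Z)"
    and "\<And>Z f. Z \<in> C \<Longrightarrow> f \<in> F \<Longrightarrow> \<exists>Z'\<in>C. l f Z' = - l f Z \<and> (\<forall>g\<in>F. l g Z = 0 \<longrightarrow> l g Z' = 0)"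
    and "\<And>Z. Z \<in> C \<Longrightarrow> \<forall>f\<in>F. l f Z = 0 \<Longrightarrow> 0 \<le> L Z"
  shows "\<exists>c. \<forall>Z\<in>C. 0 \<le> L Z + (\<Sum>f\<in>F. c f * l f Z)"
  using assms
proof (induction F arbitrary: C rule: finite_induct)
  case empty
  then show ?case by simp
next
  case (insert f F)
  note comb = insert.prems(1) and flip = insert.prems(2) and pos = insert.prems(3)
  \<comment> \<open>The other functionals are treated on the kernel of \<open>l f\<close>, and the
    coefficient of \<open>l f\<close> is added last. The second clause of \<open>flip\<close> keeps
    the flipped element inside this kernel.\<close>
  let ?C = "{Z \<in> C. l f Z = 0}"
  have "\<exists>c. \<forall>Z\<in>?C. 0 \<le> L Z + (\<Sum>g\<in>F. c g * l g Z)"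
  proof (rule insert.IH)
    fix Y Z s t assume "Y \<in> ?C" "Z \<in> ?C" "(0::real) < s" "(0::real) < t"
    then show "\<exists>X\<in>?C. L X = s * L Y + t * L Z \<and> (\<forall>f\<in>F. l f X = s * l f Y + t * l f Z)"
      using comb[of Y Z s t] by fastforce
  next
    fix Z g assume "Z \<in> ?C" "g \<in> F"
    then show "\<exists>Z'\<in>?C. l g Z' = - l g Z \<and> (\<forall>g\<in>F. l g Z = 0 \<longrightarrow> l g Z' = 0)"
      using flip[of Z g] by fastforce
  next
    fix Z assume "Z \<in> ?C" "\<forall>f\<in>F. l f Z = 0"
    then show "0 \<le> L Z" using pos[of Z] by simp
  qed
  then obtain c where c: "\<And>Z. Z \<in> C \<Longrightarrow> l f Z = 0 \<Longrightarrow> 0 \<le> L Z + (\<Sum>g\<in>F. c g * l g Z)" by blast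
  have "\<exists>d. \<forall>Z\<in>C. 0 \<le> (L Z + (\<Sum>g\<in>F. c g * l g Z)) + d * l f Z"
  proof (rule positive_extension_step)
    fix Y Z s t assume YZ: "Y \<in> C" "Z \<in> C" "(0::real) < s" "(0::real) < t"
    then obtain X where X: "X \<in> C" "L X = s * L Y + t * L Z"
      "\<And>g. g \<in> insert f F \<Longrightarrow> l g X = s * l g Y + t * l g Z" using comb[of Y Z s t] by blast
    have "(\<Sum>g\<in>F. c g * l g X) = s * (\<Sum>g\<in>F. c g * l g Y) + t * (\<Sum>g\<in>F. c g * l g Z)"
      unfolding sum_distrib_left sum.distrib[symmetric] using X(3)
      by (intro sum.cong) (auto simp: algebra_simps)
    then show "\<exists>X\<in>C. L X + (\<Sum>g\<in>F. c g * l g X)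
        = s * (L Y + (\<Sum>g\<in>F. c g * l g Y)) + t * (L Z + (\<Sum>g\<in>F. c g * l g Z))
        \<and> l f X = s * l f Y + t * l f Z"
      using X by (intro bexI[of _ X]) (auto simp: algebra_simps)
  next
    fix Z assume "Z \<in> C"
    then show "\<exists>Z'\<in>C. l f Z' = - l f Z" using flip[of Z f] by blast
  qed (use c in auto)
  then obtain d where d: "\<forall>Z\<in>C. 0 \<le> (L Z + (\<Sum>g\<in>F. c g * l g Z)) + d * l f Z" by blast
  have "(\<Sum>g\<in>insert f F. (c(f := d)) g * l g Z) = d * l f Z + (\<Sum>g\<in>F. c g * l g Z)" for Z
    using insert.hyps by (auto intro!: sum.cong)
  then show ?case using d by (intro exI[of _ "c(f := d)"]) (auto simp: algebra_simps)
qed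

text \<open>Duality for matrix completion, with \<open>E\<close> the set of unspecified positions.
  Real and imaginary parts of the entries in \<open>E\<close> are the functionals to be compensated,
  and the coefficients found by the extension lemma become the missing entries. Testing on rank-one
  \<open>Z\<close> then gives positivity.\<close>

lemma psd_completion:
  fixes R\<^sub>0 :: "'i \<Rightarrow> 'i \<Rightarrow> complex"
  assumes fin: "finite I"
    and herm: "\<And>p q. p \<in> I \<Longrightarrow> q \<in> I \<Longrightarrow> R\<^sub>0 q p = cnj (R\<^sub>0 p q)"
    and E: "\<And>p q. (p, q) \<in> E \<Longrightarrow> p \<in> I \<and> q \<in> I \<and> p \<noteq> q \<and> (q, p) \<in> E"
    and pos: "\<And>Z. psd I Z \<Longrightarrow> (\<And>p q. (p, q) \<in> E \<Longrightarrow> Z p q = 0) \<Longrightarrow>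
      0 \<le> Re (\<Sum>p\<in>I. \<Sum>q\<in>I. Z p q * R\<^sub>0 p q)"
  shows "\<exists>R. psd I R \<and> (\<forall>p\<in>I. \<forall>q\<in>I. (p, q) \<notin> E \<longrightarrow> R p q = R\<^sub>0 p q)"
proof -
  define L where "L = (\<lambda>Z. Re (\<Sum>p\<in>I. \<Sum>q\<in>I. Z p q * R\<^sub>0 p q))"
  define l where "l = (\<lambda>(e, b) (Z :: 'i \<Rightarrow> 'i \<Rightarrow> complex).
    if b then Re (Z (fst e) (snd e)) else Im (Z (fst e) (snd e)))"
  have finE: "finite E" by (rule finite_subset[of _ "I \<times> I"]) (use E fin in auto)
  define F where "F = E \<times> (UNIV :: bool set)"
  have "\<exists>c. \<forall>Z\<in>{Z. psd I Z}. 0 \<le> L Z + (\<Sum>f\<in>F. c f * l f Z)"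
  proof (rule positive_extension)
    show "finite F" using finE by (simp add: F_def)
  next
    fix Y Z and s t :: real
    assume YZ: "Y \<in> {Z. psd I Z}" "Z \<in> {Z. psd I Z}" "0 < s" "0 < t"
    let ?X = "\<lambda>p q. of_real s * Y p q + of_real t * Z p q"
    have "psd I ?X" using YZ by (intro psd_add psd_scale) auto
    moreover have "(\<Sum>p\<in>I. \<Sum>q\<in>I. ?X p q * R\<^sub>0 p q)
        = of_real s * (\<Sum>p\<in>I. \<Sum>q\<in>I. Y p q * R\<^sub>0 p q) + of_real t * (\<Sum>p\<in>I. \<Sum>q\<in>I. Z p q * R\<^sub>0 p q)"
      by (simp add: sum_distrib_left sum.distrib algebra_simps)
    then have "L ?X = s * L Y + t * L Z" unfolding L_def
      by (simp only: plus_complex.sel Re_complex_of_real Im_complex_of_real times_complex.sel mult_zero_left diff_zero)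
    moreover have "\<forall>f\<in>F. l f ?X = s * l f Y + t * l f Z" by (auto simp: l_def)
    ultimately show "\<exists>X\<in>{Z. psd I Z}. L X = s * L Y + t * L Z \<and> (\<forall>f\<in>F. l f X = s * l f Y + t * l f Z)"
      by blast
  next
    \<comment> \<open>Changing the sign of the basis vector \<open>p\<close> flips the entry \<open>(p, q)\<close>.\<close>
    fix Z f assume Z: "Z \<in> {Z. psd I Z}" and f: "f \<in> F"
    obtain p q b where pq: "f = ((p, q), b)" "(p, q) \<in> E" using f by (auto simp: F_def)
    define w where "w = (\<lambda>i. if i = p then - 1 else 1 :: complex)"
    have "psd I (\<lambda>i j. cnj (w i) * w j * Z i j)"
      by (rule psd_weighted_pullback[OF _ fin fin, of Z w "\<lambda>i. i"]) (use Z in auto)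
    moreover have "l f (\<lambda>i j. cnj (w i) * w j * Z i j) = - l f Z"
      using E[OF pq(2)] by (auto simp: l_def pq(1) w_def)
    moreover have "\<forall>g\<in>F. l g Z = 0 \<longrightarrow> l g (\<lambda>i j. cnj (w i) * w j * Z i j) = 0"
      by (auto simp: l_def w_def)
    ultimately show "\<exists>Z'\<in>{Z. psd I Z}. l f Z' = - l f Z \<and> (\<forall>g\<in>F. l g Z = 0 \<longrightarrow> l g Z' = 0)"
      by blast
  next
    fix Z assume Z: "Z \<in> {Z. psd I Z}" and zero: "\<forall>f\<in>F. l f Z = 0"
    have "Z p q = 0" if "(p, q) \<in> E" for p q
    proof -
      have "l ((p, q), True) Z = 0" "l ((p, q), False) Z = 0" using zero that by (auto simp: F_def)
      then show ?thesis by (simp add: l_def complex_eq_iff)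
    qed
    then show "0 \<le> L Z" unfolding L_def using pos Z by blast
  qed
  then obtain c where c: "\<And>Z. psd I Z \<Longrightarrow> 0 \<le> L Z + (\<Sum>f\<in>F. c f * l f Z)" by blast
  \<comment> \<open>The sign makes \<open>Re (Z p q * Complex a (- b))\<close> equal to
    \<open>a * Re (Z p q) + b * Im (Z p q)\<close>.\<close>
  define R\<^sub>1 where "R\<^sub>1 = (\<lambda>p q. R\<^sub>0 p q + (if (p, q) \<in> E then Complex (c ((p, q), True)) (- c ((p, q), False)) else 0))"
  have R1: "0 \<le> Re (\<Sum>p\<in>I. \<Sum>q\<in>I. Z p q * R\<^sub>1 p q)" if "psd I Z" for Z
  proof -
    have "(\<Sum>f\<in>F. c f * l f Z) = (\<Sum>e\<in>E. \<Sum>b\<in>UNIV. c (e, b) * l (e, b) Z)"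
      unfolding F_def sum.cartesian_product by (rule sum.cong) auto
    also have "\<dots> = (\<Sum>(p, q)\<in>E. Re (Z p q * Complex (c ((p, q), True)) (- c ((p, q), False))))"
      by (rule sum.cong) (auto simp: l_def UNIV_bool)
    also have "\<dots> = (\<Sum>(p, q)\<in>I \<times> I. if (p, q) \<in> E then Re (Z p q * Complex (c ((p, q), True)) (- c ((p, q), False))) else 0)"
      by (rule sum.mono_neutral_cong_left) (use fin E in auto)
    also have "\<dots> = (\<Sum>p\<in>I. \<Sum>q\<in>I. Re (Z p q * (if (p, q) \<in> E then Complex (c ((p, q), True)) (- c ((p, q), False)) else 0)))"
      unfolding sum.cartesian_product by (rule sum.cong) auto
    finally have "L Z + (\<Sum>f\<in>F. c f * l f Z) = Re (\<Sum>p\<in>I. \<Sum>q\<in>I. Z p q * R\<^sub>1 p q)"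
      unfolding L_def R\<^sub>1_def Re_sum distrib_left plus_complex.sel sum.distrib by simp
    then show ?thesis using c[OF that] by simp
  qed
  \<comment> \<open>The pairing with hermitian \<open>Z\<close> sees only the hermitian part.
    Outside the symmetric set \<open>E\<close> that part is still \<open>R\<^sub>0\<close>, which is
    hermitian itself.\<close>
  define R where "R = (\<lambda>p q. (R\<^sub>1 p q + cnj (R\<^sub>1 q p)) / 2)"
  have R2: "2 * R p q = R\<^sub>1 p q + cnj (R\<^sub>1 q p)" for p q by (simp add: R_def)
  have "psd I R"
  proof (rule psdI)
    fix v
    let ?Q = "\<Sum>p\<in>I. \<Sum>q\<in>I. cnj (v p) * v q * R\<^sub>1 p q"
    have "cnj ?Q = (\<Sum>p\<in>I. \<Sum>q\<in>I. v p * cnj (v q) * cnj (R\<^sub>1 p q))" by simp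
    also have "\<dots> = (\<Sum>q\<in>I. \<Sum>p\<in>I. v p * cnj (v q) * cnj (R\<^sub>1 p q))" by (rule sum.swap)
    finally have "cnj ?Q = (\<Sum>p\<in>I. \<Sum>q\<in>I. cnj (v p) * v q * cnj (R\<^sub>1 q p))" by (simp add: mult.commute)
    then have "?Q + cnj ?Q = (\<Sum>p\<in>I. \<Sum>q\<in>I. cnj (v p) * v q * (2 * R p q))"
      by (simp only: sum.distrib[symmetric]) (simp only: R2 distrib_left)
    also have "\<dots> = 2 * (\<Sum>p\<in>I. \<Sum>q\<in>I. cnj (v p) * v q * R p q)"
      by (simp add: sum_distrib_left mult_ac)
    finally have "(\<Sum>p\<in>I. \<Sum>q\<in>I. cnj (v p) * v q * R p q) = (?Q + cnj ?Q) / 2" by simp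
    also have "\<dots> = of_real (Re ?Q)" unfolding complex_add_cnj by simp
    finally have "Re (\<Sum>p\<in>I. \<Sum>q\<in>I. cnj (v p) * v q * R p q) = Re ?Q" by (simp only: Re_complex_of_real)
    then show "0 \<le> Re (\<Sum>p\<in>I. \<Sum>q\<in>I. cnj (v p) * v q * R p q)"
      using R1[OF psd_rank_one[OF fin, of v]] by (simp only:)
  qed (simp add: R_def)
  moreover have "R p q = R\<^sub>0 p q" if "p \<in> I" "q \<in> I" "(p, q) \<notin> E" for p q
  proof -
    have "(q, p) \<notin> E" using E that by blast
    then show ?thesis using that herm[OF that(1,2)] by (simp add: R_def R\<^sub>1_def)
  qed
  ultimately show ?thesis by blast
qed

section \<open>Haagerup factorization on finite sets\<close>

lemma sum_block_diagonal:
  fixes Z f :: "'s + 's \<Rightarrow> 's + 's \<Rightarrow> complex"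
  assumes "finite S" "\<And>s s'. s \<in> S \<Longrightarrow> s' \<in> S \<Longrightarrow> s \<noteq> s' \<Longrightarrow> Z (Inl s) (Inl s') = 0 \<and> Z (Inr s) (Inr s') = 0"
  shows "(\<Sum>i\<in>S <+> S. \<Sum>j\<in>S <+> S. f i j * Z i j) =
    (\<Sum>s\<in>S. f (Inl s) (Inl s) * Z (Inl s) (Inl s)) + (\<Sum>s\<in>S. \<Sum>t\<in>S. f (Inl s) (Inr t) * Z (Inl s) (Inr t))
    + ((\<Sum>s\<in>S. \<Sum>t\<in>S. f (Inr t) (Inl s) * Z (Inr t) (Inl s)) + (\<Sum>t\<in>S. f (Inr t) (Inr t) * Z (Inr t) (Inr t)))"
proof -
  have Plus: "(\<Sum>i\<in>S <+> S. g i) = (\<Sum>s\<in>S. g (Inl s)) + (\<Sum>s\<in>S. g (Inr s))" for g :: "'s + 's \<Rightarrow> complex"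
    using sum.Plus[OF assms(1) assms(1), of g] by simp
  have l: "(\<Sum>s'\<in>S. f (Inl s) (Inl s') * Z (Inl s) (Inl s')) = f (Inl s) (Inl s) * Z (Inl s) (Inl s)" if "s \<in> S" for s
    using sum.remove[OF assms(1) that, of "\<lambda>s'. f (Inl s) (Inl s') * Z (Inl s) (Inl s')"] assms(2)[OF that] sum.neutral[of "S - {s}" "\<lambda>s'. f (Inl s) (Inl s') * Z (Inl s) (Inl s')"] by force
  have r: "(\<Sum>s'\<in>S. f (Inr s) (Inr s') * Z (Inr s) (Inr s')) = f (Inr s) (Inr s) * Z (Inr s) (Inr s)" if "s \<in> S" for s
    using sum.remove[OF assms(1) that, of "\<lambda>s'. f (Inr s) (Inr s') * Z (Inr s) (Inr s')"] assms(2)[OF that] sum.neutral[of "S - {s}" "\<lambda>s'. f (Inr s) (Inr s') * Z (Inr s) (Inr s')"] by force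
  have swap: "(\<Sum>t\<in>S. \<Sum>s\<in>S. f (Inr t) (Inl s) * Z (Inr t) (Inl s)) = (\<Sum>s\<in>S. \<Sum>t\<in>S. f (Inr t) (Inl s) * Z (Inr t) (Inl s))"
    by (rule sum.swap)
  show ?thesis unfolding Plus sum.distrib using l r swap by simp
qed

text \<open>Haagerup's factorization of a contractive Schur multiplier, on a finite set.\<close>
lemma psd_extension_of_schur_contraction:
  assumes S: "finite S"
    and contr: "\<And>b v. (\<And>v. (\<Sum>s\<in>S. (cmod (\<Sum>t\<in>S. b s t * v t))\<^sup>2) \<le> (\<Sum>t\<in>S. (cmod (v t))\<^sup>2)) \<Longrightarrow>
      (\<Sum>s\<in>S. (cmod (\<Sum>t\<in>S. k s t * b s t * v t))\<^sup>2) \<le> (\<Sum>t\<in>S. (cmod (v t))\<^sup>2)"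
  shows "\<exists>R. psd (S <+> S) R \<and> (\<forall>s\<in>S. \<forall>t\<in>S. R (Inl s) (Inr t) = k s t) \<and> (\<forall>i\<in>S <+> S. R i i = 1)"
proof -
  let ?I = "S <+> S"
  \<comment> \<open>Free are the off-diagonal entries inside the two diagonal blocks: the inner
    products among the \<open>\<xi>\<^sub>s\<close> and among the
    \<open>\<eta>\<^sub>t\<close>.\<close>
  define E where "E = {(Inl s, Inl s') | s s'. s \<in> S \<and> s' \<in> S \<and> s \<noteq> s'}
    \<union> {(Inr s, Inr s') | s s'. s \<in> S \<and> s' \<in> S \<and> s \<noteq> (s' :: 'a)}"
  define R\<^sub>0 where "R\<^sub>0 = (\<lambda>i j. case i of Inl s \<Rightarrow> (case j of Inl s' \<Rightarrow> of_bool (s = s') | Inr t \<Rightarrow> k s t)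
    | Inr t \<Rightarrow> (case j of Inl s \<Rightarrow> cnj (k s t) | Inr t' \<Rightarrow> of_bool (t = t')))"
  have "\<exists>R. psd ?I R \<and> (\<forall>p\<in>?I. \<forall>q\<in>?I. (p, q) \<notin> E \<longrightarrow> R p q = R\<^sub>0 p q)"
  proof (rule psd_completion)
    show "finite ?I" using S by simp
    show "R\<^sub>0 q p = cnj (R\<^sub>0 p q)" if "p \<in> ?I" "q \<in> ?I" for p q
      by (cases p; cases q) (auto simp: R\<^sub>0_def)
    show "p \<in> ?I \<and> q \<in> ?I \<and> p \<noteq> q \<and> (q, p) \<in> E" if "(p, q) \<in> E" for p q
      using that by (auto simp: E_def)
  next
    fix Z assume Z: "psd ?I Z" and zero: "\<And>p q. (p, q) \<in> E \<Longrightarrow> Z p q = 0"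
    have fin: "finite ?I" using S by simp
    have diag: "\<And>s s'. s \<in> S \<Longrightarrow> s' \<in> S \<Longrightarrow> s \<noteq> s' \<Longrightarrow> Z (Inl s) (Inl s') = 0 \<and> Z (Inr s) (Inr s') = 0"
      using zero by (auto simp: E_def)
    have block: "(\<Sum>i\<in>?I. \<Sum>j\<in>?I. f i j * Z i j) =
      (\<Sum>s\<in>S. f (Inl s) (Inl s) * Z (Inl s) (Inl s)) + (\<Sum>s\<in>S. \<Sum>t\<in>S. f (Inl s) (Inr t) * Z (Inl s) (Inr t))
      + ((\<Sum>s\<in>S. \<Sum>t\<in>S. f (Inr t) (Inl s) * Z (Inr t) (Inl s)) + (\<Sum>t\<in>S. f (Inr t) (Inr t) * Z (Inr t) (Inr t)))" for f
      by (rule sum_block_diagonal[OF S]) (use diag in auto)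
    define d where "d = (\<lambda>i. Re (Z i i))"
    have Zd: "Z i i = of_real (d i)" "0 \<le> d i" if "i \<in> ?I" for i
      unfolding d_def using psd_diag_real[OF Z that] psd_diag_nonneg[OF Z fin that] by auto
    have Zc: "Z (Inr t) (Inl s) = cnj (Z (Inl s) (Inr t))" if "s \<in> S" "t \<in> S" for s t
      using psd_herm[OF Z, of "Inl s" "Inr t"] that by auto
    define r where "r = (\<lambda>i. complex_of_real (sqrt (d i)))"
    have r2: "cnj (r i) * r i = of_real (d i)" if "i \<in> ?I" for i
      using Zd(2)[OF that] by (simp add: r_def flip: of_real_mult)
    \<comment> \<open>The diagonal blocks of \<open>Z\<close> are diagonal matrices, so positivity
      of \<open>Z\<close> says that its corner, normalized by the square roots of the diagonal, is a
      contraction.\<close>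
    define b where "b = (\<lambda>s t. Z (Inl s) (Inr t) / (r (Inl s) * r (Inr t)))"
    have b: "(\<Sum>s\<in>S. (cmod (\<Sum>t\<in>S. b s t * v t))\<^sup>2) \<le> (\<Sum>t\<in>S. (cmod (v t))\<^sup>2)" for v
    proof -
      define u where "u = (\<lambda>s. \<Sum>t\<in>S. b s t * v t)"
      \<comment> \<open>The vector \<open>(- b v, v)\<close>, rescaled to undo the normalization.
        Where \<open>d\<close> vanishes the division yields 0, which is why \<open>d1\<close> is
        only an inequality.\<close>
      define w where "w = case_sum (\<lambda>s. - u s / r (Inl s)) (\<lambda>t. v t / r (Inr t))"
      have d1: "Re (\<Sum>s\<in>S. cnj (w (h s)) * w (h s) * Z (h s) (h s)) \<le> (\<Sum>s\<in>S. (cmod (z s))\<^sup>2)"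
        if h: "\<And>s. s \<in> S \<Longrightarrow> h s \<in> ?I" "\<And>s. w (h s) = z s / r (h s)" for h :: "'a \<Rightarrow> 'a + 'a" and z
        unfolding Re_sum
      proof (rule sum_mono)
        fix s assume s: "s \<in> S"
        have "cnj (w (h s)) * w (h s) * Z (h s) (h s) = cnj (z s) * z s * (of_real (d (h s)) / (cnj (r (h s)) * r (h s)))"
          unfolding h(2) using Zd(1)[OF h(1)[OF s]] by simp
        also have "\<dots> = of_real ((cmod (z s))\<^sup>2) * (if d (h s) = 0 then 0 else 1)"
          unfolding r2[OF h(1)[OF s]] by (simp add: complex_norm_square mult.commute del: of_real_power)
        finally show "Re (cnj (w (h s)) * w (h s) * Z (h s) (h s)) \<le> (cmod (z s))\<^sup>2"
          by (simp del: of_real_power)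
      qed
      have cross: "(\<Sum>s\<in>S. \<Sum>t\<in>S. cnj (w (Inl s)) * w (Inr t) * Z (Inl s) (Inr t)) = - of_real (\<Sum>s\<in>S. (cmod (u s))\<^sup>2)"
      proof -
        have "(\<Sum>t\<in>S. cnj (w (Inl s)) * w (Inr t) * Z (Inl s) (Inr t)) = - of_real ((cmod (u s))\<^sup>2)" for s
        proof -
          have "(\<Sum>t\<in>S. cnj (w (Inl s)) * w (Inr t) * Z (Inl s) (Inr t)) = (\<Sum>t\<in>S. - cnj (u s) * (b s t * v t))"
            by (rule sum.cong) (auto simp: w_def b_def r_def)
          also have "\<dots> = - (cnj (u s) * u s)" unfolding u_def by (simp add: sum_distrib_left sum_negf)
          finally show ?thesis by (simp add: complex_norm_square mult.commute del: of_real_power)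
        qed
        then show ?thesis by (simp add: sum_negf del: of_real_power)
      qed
      have "(\<Sum>s\<in>S. \<Sum>t\<in>S. cnj (w (Inr t)) * w (Inl s) * Z (Inr t) (Inl s))
          = cnj (\<Sum>s\<in>S. \<Sum>t\<in>S. cnj (w (Inl s)) * w (Inr t) * Z (Inl s) (Inr t))"
        by (simp add: Zc mult_ac)
      then have cross': "(\<Sum>s\<in>S. \<Sum>t\<in>S. cnj (w (Inr t)) * w (Inl s) * Z (Inr t) (Inl s)) = - of_real (\<Sum>s\<in>S. (cmod (u s))\<^sup>2)"
        unfolding cross by simp
      have "0 \<le> Re (\<Sum>i\<in>?I. \<Sum>j\<in>?I. cnj (w i) * w j * Z i j)" by (rule psd_nonneg[OF Z])
      also have "\<dots> = Re (\<Sum>s\<in>S. cnj (w (Inl s)) * w (Inl s) * Z (Inl s) (Inl s)) - (\<Sum>s\<in>S. (cmod (u s))\<^sup>2)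
        + (- (\<Sum>s\<in>S. (cmod (u s))\<^sup>2) + Re (\<Sum>t\<in>S. cnj (w (Inr t)) * w (Inr t) * Z (Inr t) (Inr t)))"
        unfolding block[of "\<lambda>i j. cnj (w i) * w j"] cross cross' by (simp only: plus_complex.sel uminus_complex.sel Re_complex_of_real)
      also have "\<dots> \<le> (\<Sum>s\<in>S. (cmod (- u s))\<^sup>2) - (\<Sum>s\<in>S. (cmod (u s))\<^sup>2) + (- (\<Sum>s\<in>S. (cmod (u s))\<^sup>2) + (\<Sum>t\<in>S. (cmod (v t))\<^sup>2))"
        by (intro add_mono diff_mono d1 order_refl) (auto simp: w_def)
      finally show ?thesis unfolding u_def by simp
    qed
    \<comment> \<open>The pairing of \<open>Z\<close> with \<open>R\<^sub>0\<close> is the trace of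
      \<open>Z\<close> plus \<open>2 * Re T\<close>. Since \<open>T\<close> pairs the Schur product
      of \<open>k\<close> and \<open>b\<close> with the vectors of square roots \<open>r\<close>,
      the contraction hypothesis and AM-GM bound \<open>- 2 * Re T\<close> by the trace.\<close>
    define T where "T = (\<Sum>s\<in>S. \<Sum>t\<in>S. Z (Inl s) (Inr t) * k s t)"
    have "T = (\<Sum>s\<in>S. cnj (r (Inl s)) * (\<Sum>t\<in>S. k s t * b s t * r (Inr t)))"
      unfolding T_def sum_distrib_left
    proof (intro sum.cong refl)
      fix s t assume st: "s \<in> S" "t \<in> S"
      have "Z (Inl s) (Inr t) = r (Inl s) * b s t * r (Inr t)"
      proof (cases "r (Inl s) = 0 \<or> r (Inr t) = 0")
        case True
        then have "d (Inl s) = 0 \<or> d (Inr t) = 0" using st Zd(2) by (auto simp: r_def)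
        moreover have "(cmod (Z (Inl s) (Inr t)))\<^sup>2 \<le> d (Inl s) * d (Inr t)"
          unfolding d_def using psd_cauchy_schwarz[OF Z fin] st by auto
        ultimately show ?thesis using True by auto
      qed (simp add: b_def)
      then show "Z (Inl s) (Inr t) * k s t = cnj (r (Inl s)) * (k s t * b s t * r (Inr t))"
        by (simp add: r_def)
    qed
    then have "- 2 * Re T = (\<Sum>s\<in>S. 2 * Re (cnj (- r (Inl s)) * (\<Sum>t\<in>S. k s t * b s t * r (Inr t))))"
      by (simp add: sum_distrib_left sum_negf del: times_complex.sel)
    also have "\<dots> \<le> (\<Sum>s\<in>S. 1 * (cmod (- r (Inl s)))\<^sup>2 + (cmod (\<Sum>t\<in>S. k s t * b s t * r (Inr t)))\<^sup>2 / 1)"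
      by (intro sum_mono two_Re_cnj_mult_le) auto
    also have "\<dots> = (\<Sum>s\<in>S. (cmod (r (Inl s)))\<^sup>2) + (\<Sum>s\<in>S. (cmod (\<Sum>t\<in>S. k s t * b s t * r (Inr t)))\<^sup>2)"
      by (simp add: sum.distrib)
    also have "\<dots> \<le> (\<Sum>s\<in>S. (cmod (r (Inl s)))\<^sup>2) + (\<Sum>t\<in>S. (cmod (r (Inr t)))\<^sup>2)"
      using contr[of b "\<lambda>t. r (Inr t)"] b by simp
    also have "\<dots> = (\<Sum>s\<in>S. d (Inl s)) + (\<Sum>t\<in>S. d (Inr t))"
      using Zd(2) by (intro arg_cong2[where f = "(+)"] sum.cong) (auto simp: r_def)
    finally have T: "- 2 * Re T \<le> (\<Sum>s\<in>S. d (Inl s)) + (\<Sum>t\<in>S. d (Inr t))" .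
    have T': "(\<Sum>s\<in>S. \<Sum>t\<in>S. Z (Inr t) (Inl s) * cnj (k s t)) = cnj T"
      unfolding T_def by (simp add: Zc)
    have "(\<Sum>p\<in>?I. \<Sum>q\<in>?I. Z p q * R\<^sub>0 p q) = (\<Sum>p\<in>?I. \<Sum>q\<in>?I. R\<^sub>0 p q * Z p q)" by (simp add: mult.commute)
    also have "\<dots> = (\<Sum>s\<in>S. of_real (d (Inl s))) + T + (cnj T + (\<Sum>t\<in>S. of_real (d (Inr t))))"
    proof -
      have "(\<Sum>s\<in>S. Z (Inl s) (Inl s)) = (\<Sum>s\<in>S. of_real (d (Inl s)))"
        "(\<Sum>s\<in>S. Z (Inr s) (Inr s)) = (\<Sum>s\<in>S. of_real (d (Inr s)))"
        using Zd(1) by (auto intro!: sum.cong)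
      then show ?thesis unfolding block[of R\<^sub>0] T'[symmetric] unfolding T_def by (simp add: R\<^sub>0_def mult.commute)
    qed
    finally show "0 \<le> Re (\<Sum>p\<in>?I. \<Sum>q\<in>?I. Z p q * R\<^sub>0 p q)" using T by simp
  qed
  then obtain R where R: "psd ?I R" "\<And>p q. p \<in> ?I \<Longrightarrow> q \<in> ?I \<Longrightarrow> (p, q) \<notin> E \<Longrightarrow> R p q = R\<^sub>0 p q" by blast
  have "R (Inl s) (Inr t) = k s t" if "s \<in> S" "t \<in> S" for s t
    using R(2)[of "Inl s" "Inr t"] that by (auto simp: E_def R\<^sub>0_def)
  moreover have "R i i = 1" if "i \<in> ?I" for i
    using R(2)[OF that that] that by (auto simp: E_def R\<^sub>0_def split: sum.splits)
  ultimately show ?thesis using R(1) by blast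
qed

section \<open>Congruences, and approximation of multipliers by positive definite kernels\<close>

lemma psd_sum_kernel:
  assumes "psd I K" "finite I" "finite J"
  shows "psd J (\<lambda>i j. \<Sum>p\<in>I. \<Sum>q\<in>I. cnj (M p i) * M q j * K p q)"
proof (rule psdI)
  fix i j assume "i \<in> J" "j \<in> J"
  have "(\<Sum>p\<in>I. \<Sum>q\<in>I. cnj (M p j) * M q i * K p q) = (\<Sum>q\<in>I. \<Sum>p\<in>I. cnj (M p j) * M q i * K p q)"
    by (rule sum.swap)
  also have "\<dots> = cnj (\<Sum>p\<in>I. \<Sum>q\<in>I. cnj (M p i) * M q j * K p q)"
    unfolding cnj_sum
  proof (intro sum.cong refl)
    fix p q assume "p \<in> I" "q \<in> I"
    then show "cnj (M q j) * M p i * K q p = cnj (cnj (M p i) * M q j * K p q)"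
      using psd_herm[OF assms(1), of p q] by simp
  qed
  finally show "(\<Sum>p\<in>I. \<Sum>q\<in>I. cnj (M p j) * M q i * K p q) = cnj (\<Sum>p\<in>I. \<Sum>q\<in>I. cnj (M p i) * M q j * K p q)" .
next
  fix v
  have "(\<Sum>i\<in>J. \<Sum>j\<in>J. cnj (v i) * v j * (\<Sum>p\<in>I. \<Sum>q\<in>I. cnj (M p i) * M q j * K p q))
    = (\<Sum>(i, j)\<in>J \<times> J. \<Sum>(p, q)\<in>I \<times> I. cnj (M p i * v i) * (M q j * v j) * K p q)"
    by (simp add: sum.cartesian_product[symmetric] sum_distrib_left mult_ac)
  also have "\<dots> = (\<Sum>(p, q)\<in>I \<times> I. \<Sum>(i, j)\<in>J \<times> J. cnj (M p i * v i) * (M q j * v j) * K p q)"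
    unfolding case_prod_unfold by (rule sum.swap)
  also have "\<dots> = (\<Sum>p\<in>I. \<Sum>q\<in>I. cnj (\<Sum>i\<in>J. M p i * v i) * (\<Sum>j\<in>J. M q j * v j) * K p q)"
    unfolding sum.cartesian_product[symmetric] by (simp add: sum_distrib_left sum_distrib_right mult_ac)
  finally show "0 \<le> Re (\<Sum>i\<in>J. \<Sum>j\<in>J. cnj (v i) * v j * (\<Sum>p\<in>I. \<Sum>q\<in>I. cnj (M p i) * M q j * K p q))"
    using psd_nonneg[OF assms(1), of "\<lambda>p. \<Sum>i\<in>J. M p i * v i"] by (simp only:)
qed

text \<open>If \<open>\<langle>\<xi>\<^sub>s, \<eta>\<^sub>t\<rangle>\<close> is the kernel and \<open>\<xi>\<^sub>s\<close>, \<open>\<eta>\<^sub>s\<close> are unit vectors, then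
  \<open>\<parallel>\<xi>\<^sub>s - \<eta>\<^sub>s\<parallel>\<^sup>2 = 2 - 2 Re \<langle>\<xi>\<^sub>s, \<eta>\<^sub>s\<rangle>\<close>, and \<open>\<langle>\<xi>\<^sub>s, \<xi>\<^sub>t\<rangle>\<close> is the approximating kernel.\<close>
lemma schur_bd_diff_psd:
  assumes R: "psd (S <+> S) R" "\<And>i. i \<in> S <+> S \<Longrightarrow> R i i = 1" and S: "finite S"
    and a: "\<And>s. s \<in> S \<Longrightarrow> 2 - 2 * Re (R (Inl s) (Inr s)) \<le> a"
  shows "schur_bd S (sqrt a) (\<lambda>s t. R (Inl s) (Inr t) - R (Inl s) (Inl t))"
proof (cases "S = {}")
  case True
  have "schur_bd S (sqrt a) (\<lambda>s t. 0)" by (rule schur_bdI[of _ "\<lambda>i j. 0"]) (auto simp: True psd_def)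
  then show ?thesis by (rule schur_bd_cong) (use True in auto)
next
  case False
  have fin: "finite (S <+> S)" using S by simp
  have nn: "0 \<le> a"
  proof -
    obtain s where s: "s \<in> S" using False by blast
    then have i: "Inl s \<in> S <+> S" "Inr s \<in> S <+> S" by auto
    have "(cmod (R (Inl s) (Inr s)))\<^sup>2 \<le> 1"
      using psd_cauchy_schwarz[OF R(1) fin i] R(2)[OF i(1)] R(2)[OF i(2)] by simp
    then have "cmod (R (Inl s) (Inr s)) \<le> 1" by (simp add: abs_square_le_1)
    then show ?thesis using a[OF s] complex_Re_le_cmod[of "R (Inl s) (Inr s)"] by linarith
  qed
  \<comment> \<open>The Gram kernel of the vectors \<open>\<xi>\<^sub>s\<close> and
    \<open>\<eta>\<^sub>s - \<xi>\<^sub>s\<close>, obtained from \<open>R\<close> by the congruence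
    \<open>M\<close>. Its diagonal is bounded by 1 on one copy and by \<open>a\<close> on the other,
    hence \<open>sqrt a\<close>.\<close>
  define Q where "Q = (\<lambda>i j :: 'a + 'a. case i of
      Inl s \<Rightarrow> (case j of Inl t \<Rightarrow> R (Inl s) (Inl t) | Inr t \<Rightarrow> R (Inl s) (Inr t) - R (Inl s) (Inl t))
    | Inr s \<Rightarrow> (case j of Inl t \<Rightarrow> R (Inr s) (Inl t) - R (Inl s) (Inl t)
        | Inr t \<Rightarrow> R (Inr s) (Inr t) - R (Inr s) (Inl t) - (R (Inl s) (Inr t) - R (Inl s) (Inl t))))"
  define M where "M = (\<lambda>p i :: 'a + 'a. of_bool (p = i) - (case i of Inl _ \<Rightarrow> 0 | Inr t \<Rightarrow> of_bool (p = Inl t)) :: complex)"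
  have "psd (S <+> S) (\<lambda>i j. \<Sum>p\<in>S <+> S. \<Sum>q\<in>S <+> S. cnj (M p i) * M q j * R p q)"
    by (rule psd_sum_kernel[OF R(1) fin fin])
  then have "psd (S <+> S) Q"
  proof (rule psd_cong)
    fix i j assume ij: "i \<in> S <+> S" "j \<in> S <+> S"
    have cnjM: "cnj (M p j) = M p j" for p j by (simp add: M_def split: sum.splits)
    have M: "(\<Sum>q\<in>S <+> S. M q j * f q) = f j - (case j of Inl _ \<Rightarrow> 0 | Inr t \<Rightarrow> f (Inl t))"
      if "j \<in> S <+> S" for j f
      using that fin by (auto simp: M_def of_bool_def if_distrib[of "\<lambda>x. x * _"] left_diff_distrib sum_subtractf split: sum.splits cong: if_cong)
    have "(\<Sum>p\<in>S <+> S. \<Sum>q\<in>S <+> S. cnj (M p i) * M q j * R p q)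
        = (\<Sum>p\<in>S <+> S. M p i * (\<Sum>q\<in>S <+> S. M q j * R p q))"
      by (simp add: sum_distrib_left mult.assoc cnjM)
    also have "\<dots> = Q i j" unfolding M[OF ij(2)] M[OF ij(1)]
      by (auto simp: Q_def split: sum.splits)
    finally show "(\<Sum>p\<in>S <+> S. \<Sum>q\<in>S <+> S. cnj (M p i) * M q j * R p q) = Q i j" .
  qed
  then have "schur_bd S (sqrt (1 * a)) (\<lambda>s t. Q (Inl s) (Inr t))"
  proof (rule schur_bd_unbalanced[OF S])
    fix s assume s: "s \<in> S"
    then show "Re (Q (Inl s) (Inl s)) \<le> 1" using R(2)[OF InlI[OF s]] by (simp add: Q_def)
    have "R (Inr s) (Inl s) = cnj (R (Inl s) (Inr s))" using psd_herm[OF R(1), of "Inl s" "Inr s"] s by auto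
    then show "Re (Q (Inr s) (Inr s)) \<le> a"
      using R(2)[OF InlI[OF s]] R(2)[OF InrI[OF s]] a[OF s] by (simp add: Q_def)
  qed (use nn in auto)
  then show ?thesis by (simp add: Q_def)
qed

text \<open>Factorize \<open>\<phi> / (1 + d)\<close> through unit vectors. Its value on the
  diagonal has real part at least \<open>1 - 2 * d\<close>, so the vectors
  \<open>\<xi>\<^sub>s\<close> and \<open>\<eta>\<^sub>s\<close> have squared distance at most
  \<open>4 * d\<close>, which gives the square root. The second \<open>4 * d\<close> pays for
  dividing by \<open>\<phi> \<one>\<close> instead of \<open>1 + d\<close>.\<close>

lemma positive_definite_approximation:
  fixes G (structure)
  assumes "group G" and S: "finite S" "S \<subseteq> carrier G"
    and cb: "cb_norm G \<phi> \<le> ereal (1 + d)" "cmod (\<phi> \<one> - 1) \<le> d" and d: "0 < d" "d \<le> 1 / 2"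
  shows "\<exists>P. psd S P \<and> (\<forall>s\<in>S. P s s = 1) \<and>
    schur_bd S (sqrt (4 * d) + 4 * d) (\<lambda>s t. \<phi> (inv s \<otimes> t) / \<phi> \<one> - P s t)"
proof -
  interpret group G by fact
  define C where "C = 1 + d"
  have C: "1 \<le> C" "0 < C" using d by (auto simp: C_def)
  define k where "k = (\<lambda>s t. \<phi> (inv s \<otimes> t) / of_real C)"
  have "\<exists>R. psd (S <+> S) R \<and> (\<forall>s\<in>S. \<forall>t\<in>S. R (Inl s) (Inr t) = k s t) \<and> (\<forall>i\<in>S <+> S. R i i = 1)"
  proof (rule psd_extension_of_schur_contraction[OF S(1)])
    fix b v
    assume b: "\<And>v. (\<Sum>s\<in>S. (cmod (\<Sum>t\<in>S. b s t * v t))\<^sup>2) \<le> (\<Sum>t\<in>S. (cmod (v t))\<^sup>2)"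
    have "(cmod (\<Sum>t\<in>S. k s t * b s t * v t))\<^sup>2 = (cmod (\<Sum>t\<in>S. \<phi> (inv s \<otimes> t) * b s t * v t))\<^sup>2 / C\<^sup>2" for s
    proof -
      have "(\<Sum>t\<in>S. k s t * b s t * v t) = (\<Sum>t\<in>S. \<phi> (inv s \<otimes> t) * b s t * v t) / of_real C"
        by (simp add: k_def sum_divide_distrib)
      then show ?thesis using C by (simp add: norm_divide power_divide)
    qed
    then have "(\<Sum>s\<in>S. (cmod (\<Sum>t\<in>S. k s t * b s t * v t))\<^sup>2)
        = (\<Sum>s\<in>S. (cmod (\<Sum>t\<in>S. \<phi> (inv s \<otimes> t) * b s t * v t))\<^sup>2) / C\<^sup>2"
      by (simp add: sum_divide_distrib)
    also have "\<dots> \<le> C\<^sup>2 * (\<Sum>t\<in>S. (cmod (v t))\<^sup>2) / C\<^sup>2"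
      using schur_multiplier_contractive[OF assms(1) cb(1)[folded C_def] _ S b] C
      by (intro divide_right_mono) auto
    finally show "(\<Sum>s\<in>S. (cmod (\<Sum>t\<in>S. k s t * b s t * v t))\<^sup>2) \<le> (\<Sum>t\<in>S. (cmod (v t))\<^sup>2)"
      using C by simp
  qed
  then obtain R where R: "psd (S <+> S) R" "\<And>s t. s \<in> S \<Longrightarrow> t \<in> S \<Longrightarrow> R (Inl s) (Inr t) = k s t"
    "\<And>i. i \<in> S <+> S \<Longrightarrow> R i i = 1" by blast
  define P where "P = (\<lambda>s t. R (Inl s) (Inl t))"
  have "psd S P" unfolding P_def
    by (rule psd_pullback[OF R(1)]) (use S in auto)
  moreover have "\<forall>s\<in>S. P s s = 1" using R(3) by (auto simp: P_def)
  moreover have "schur_bd S (sqrt (4 * d) + 4 * d) (\<lambda>s t. \<phi> (inv s \<otimes> t) / \<phi> \<one> - P s t)"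
  proof -
    have \<phi>1: "1 - d \<le> Re (\<phi> \<one>)" "1 / 2 \<le> cmod (\<phi> \<one>)"
    proof -
      have "\<bar>Re (\<phi> \<one> - 1)\<bar> \<le> d" using abs_Re_le_cmod[of "\<phi> \<one> - 1"] cb(2) by linarith
      then show "1 - d \<le> Re (\<phi> \<one>)" by simp
      then show "1 / 2 \<le> cmod (\<phi> \<one>)" using complex_Re_le_cmod[of "\<phi> \<one>"] d by linarith
    qed
    have 1: "schur_bd S (sqrt (4 * d)) (\<lambda>s t. R (Inl s) (Inr t) - R (Inl s) (Inl t))"
    proof (rule schur_bd_diff_psd[OF R(1,3) S(1)])
      fix s assume s: "s \<in> S"
      then have "inv s \<otimes> s = \<one>" using S by (meson l_inv subsetD)
      then have "Re (R (Inl s) (Inr s)) = Re (\<phi> \<one>) / C" using R(2)[OF s s] by (simp add: k_def)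
      also have "\<dots> \<ge> 1 - 2 * d"
      proof -
        have "(1 - 2 * d) * C \<le> 1 - d" using d by (simp add: C_def algebra_simps)
        then have "(1 - 2 * d) * C \<le> Re (\<phi> \<one>)" using \<phi>1 by linarith
        then show ?thesis using C by (simp add: field_simps)
      qed
      finally show "2 - 2 * Re (R (Inl s) (Inr s)) \<le> 4 * d" by simp
    qed
    have "schur_bd S 1 k"
      by (rule schur_bdI[OF R(1)]) (use R(2,3) in auto)
    then have 2: "schur_bd S (cmod (of_real C / \<phi> \<one> - 1) * 1) (\<lambda>s t. (of_real C / \<phi> \<one> - 1) * k s t)"
      by (rule schur_bd_cmult) (use S in auto)
    have "cmod (of_real C / \<phi> \<one> - 1) \<le> 4 * d"
    proof -
      have "of_real C / \<phi> \<one> - 1 = (of_real d - (\<phi> \<one> - 1)) / \<phi> \<one>"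
        using \<phi>1(2) by (cases "\<phi> \<one> = 0") (auto simp: field_simps C_def)
      moreover have "cmod (of_real d - (\<phi> \<one> - 1)) \<le> 2 * d"
        using norm_triangle_ineq4[of "complex_of_real d" "\<phi> \<one> - 1"] cb(2) d by simp
      ultimately have "cmod (of_real C / \<phi> \<one> - 1) \<le> (2 * d) / (1 / 2)"
        using \<phi>1(2) d by (simp only: norm_divide) (intro frac_le, auto)
      then show ?thesis by simp
    qed
    then have "schur_bd S (4 * d) (\<lambda>s t. (of_real C / \<phi> \<one> - 1) * k s t)"
      using schur_bd_mono[OF 2] by simp
    from schur_bd_add[OF 1 this] show ?thesis
    proof (rule schur_bd_cong)
      fix s t assume "s \<in> S" "t \<in> S"
      then show "R (Inl s) (Inr t) - R (Inl s) (Inl t) + (of_real C / \<phi> \<one> - 1) * k s t = \<phi> (inv s \<otimes> t) / \<phi> \<one> - P s t"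
        using R(2) C by (simp add: P_def k_def field_simps)
    qed
  qed
  ultimately show ?thesis by blast
qed

text \<open>The order of quantifiers matters: one \<open>\<phi>\<close> serves all finite sets
  \<open>S\<close> with the same \<open>\<delta>\<close>, while \<open>P\<close> may depend on
  \<open>S\<close>.\<close>

lemma normalized_multipliers:
  fixes G (structure)
  assumes "group G" "weakly_amenable_CH1 G" "finite E" "E \<subseteq> carrier G" "0 < \<delta>"
  obtains \<phi> where "finite {g \<in> carrier G. \<phi> g \<noteq> 0}" "\<phi> \<one> = 1" "\<And>g. g \<in> E \<Longrightarrow> cmod (\<phi> g - 1) \<le> \<delta>"
    "\<And>S. finite S \<Longrightarrow> S \<subseteq> carrier G \<Longrightarrow> \<exists>P. psd S P \<and> (\<forall>s\<in>S. P s s = 1) \<and>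
      schur_bd S \<delta> (\<lambda>s t. \<phi> (inv s \<otimes> t) - P s t)"
proof -
  interpret group G by fact
  define m where "m = min \<delta> 1"
  have m: "0 < m" "m \<le> 1" "m \<le> \<delta>" using assms(5) by (auto simp: m_def)
  \<comment> \<open>Then \<open>sqrt (4 * d) = m / 2\<close> and \<open>4 * d \<le> m / 4\<close>,
    so the total error stays below \<open>\<delta>\<close>.\<close>
  define d where "d = m\<^sup>2 / 16"
  have d: "0 < d" "d \<le> 1 / 2" using m power_le_one[of m 2] by (auto simp: d_def)
  have d4: "4 * d \<le> m / 4" using m by (simp add: d_def power2_eq_square)
  have sd: "sqrt (4 * d) = m / 2" using m by (simp add: d_def real_sqrt_divide)
  obtain F where F: "F \<noteq> bot" "eventually (\<lambda>\<phi>. finite {g \<in> carrier G. \<phi> g \<noteq> 0}) F"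
    "\<And>g. g \<in> carrier G \<Longrightarrow> ((\<lambda>\<phi>. \<phi> g) \<longlongrightarrow> (1::complex)) F" "Limsup F (cb_norm G) \<le> 1"
    using assms(2) unfolding weakly_amenable_CH1_def by blast
  have "eventually (\<lambda>\<phi>. cb_norm G \<phi> < ereal (1 + d)) F"
    by (rule Limsup_lessD, rule le_less_trans[OF F(4)]) (use d in \<open>simp add: one_ereal_def\<close>)
  moreover have "eventually (\<lambda>\<phi>. \<forall>g\<in>insert \<one> E. cmod (\<phi> g - 1) < d) F"
  proof -
    have "eventually (\<lambda>\<phi>. cmod (\<phi> g - 1) < d) F" if "g \<in> insert \<one> E" for g
      using tendstoD[OF F(3) d(1), of g] that assms(4) by (auto simp: dist_norm)
    then show ?thesis using assms(3) by (intro eventually_ball_finite) auto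
  qed
  ultimately have "eventually (\<lambda>\<phi>. finite {g \<in> carrier G. \<phi> g \<noteq> 0} \<and> cb_norm G \<phi> < ereal (1 + d)
      \<and> (\<forall>g\<in>insert \<one> E. cmod (\<phi> g - 1) < d)) F"
    using F(2) by eventually_elim blast
  then obtain \<phi> where \<phi>: "finite {g \<in> carrier G. \<phi> g \<noteq> 0}" "cb_norm G \<phi> < ereal (1 + d)"
    "\<And>g. g \<in> insert \<one> E \<Longrightarrow> cmod (\<phi> g - 1) < d" using eventually_happens'[OF F(1)] by blast
  have \<phi>1: "1 / 2 \<le> cmod (\<phi> \<one>)"
    using \<phi>(3)[of \<one>] norm_triangle_ineq2[of 1 "\<phi> \<one>"] d by (simp add: norm_minus_commute)
  then have ne: "\<phi> \<one> \<noteq> 0" by auto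
  show ?thesis
  proof (rule that[of "\<lambda>g. \<phi> g / \<phi> \<one>"])
    show "finite {g \<in> carrier G. \<phi> g / \<phi> \<one> \<noteq> 0}" using \<phi>(1) by (rule rev_finite_subset) auto
    show "\<phi> \<one> / \<phi> \<one> = 1" using ne by simp
  next
    fix g assume g: "g \<in> E"
    have "cmod (\<phi> g - \<phi> \<one>) \<le> cmod (\<phi> g - 1) + cmod (\<phi> \<one> - 1)"
      using norm_triangle_ineq4[of "\<phi> g - 1" "\<phi> \<one> - 1"] by simp
    then have "cmod (\<phi> g - \<phi> \<one>) \<le> 2 * d" using \<phi>(3)[of g] \<phi>(3)[of \<one>] g by auto
    moreover have "\<phi> g / \<phi> \<one> - 1 = (\<phi> g - \<phi> \<one>) / \<phi> \<one>" using ne by (simp add: field_simps)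
    ultimately have "cmod (\<phi> g / \<phi> \<one> - 1) \<le> (2 * d) / (1 / 2)"
      using \<phi>1 d by (simp only: norm_divide) (intro frac_le, auto)
    then show "cmod (\<phi> g / \<phi> \<one> - 1) \<le> \<delta>" using d4 m by simp
  next
    fix S assume S: "finite S" "S \<subseteq> carrier G"
    have "cb_norm G \<phi> \<le> ereal (1 + d)" "cmod (\<phi> \<one> - 1) \<le> d" using \<phi>(2) \<phi>(3)[of \<one>] by auto
    from positive_definite_approximation[OF assms(1) S this d]
    show "\<exists>P. psd S P \<and> (\<forall>s\<in>S. P s s = 1) \<and> schur_bd S \<delta> (\<lambda>s t. \<phi> (inv s \<otimes> t) / \<phi> \<one> - P s t)"
      using schur_bd_mono[of S "m / 2 + 4 * d" _ \<delta>] d4 m unfolding sd by fastforce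
  qed
qed

section \<open>Words in the free product\<close>

text \<open>Unlike \<open>fp_letter_ok\<close> this admits the units, because the product of two
  letters can be trivial and still has to act on words.\<close>

definition fp_letter_in :: "('a,'m) monoid_scheme \<Rightarrow> ('b,'n) monoid_scheme \<Rightarrow> 'a + 'b \<Rightarrow> bool" where
  "fp_letter_in A B x = (case x of Inl a \<Rightarrow> a \<in> carrier A | Inr b \<Rightarrow> b \<in> carrier B)"

definition fp_linv :: "('a,'m) monoid_scheme \<Rightarrow> ('b,'n) monoid_scheme \<Rightarrow> 'a + 'b \<Rightarrow> 'a + 'b" where
  "fp_linv A B x = (case x of Inl a \<Rightarrow> Inl (inv\<^bsub>A\<^esub> a) | Inr b \<Rightarrow> Inr (inv\<^bsub>B\<^esub> b))"

lemma isl_fp_linv [simp]: "isl (fp_linv A B x) = isl x"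
  by (cases x) (auto simp: fp_linv_def)

lemma fp_reduced_successively:
  "fp_reduced A B w \<longleftrightarrow> (\<forall>x\<in>set w. fp_letter_ok A B x) \<and> successively (\<lambda>x y. isl x \<noteq> isl y) w"
  unfolding fp_reduced_def successively_conv_nth by (auto simp: Suc_lessI)

lemma fp_reduced_Nil [simp]: "fp_reduced A B []"
  by (simp add: fp_reduced_def)

lemma fp_reduced_Cons:
  "fp_reduced A B (x # w) \<longleftrightarrow> fp_letter_ok A B x \<and> fp_reduced A B w \<and> (w = [] \<or> isl x \<noteq> isl (hd w))"
  unfolding fp_reduced_successively by (auto simp: successively_Cons)

lemma fp_reduced_append:
  "fp_reduced A B (u @ v) \<longleftrightarrow> fp_reduced A B u \<and> fp_reduced A B v \<and> (u = [] \<or> v = [] \<or> isl (last u) \<noteq> isl (hd v))"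
  unfolding fp_reduced_successively by (auto simp: successively_append_iff)

lemma fp_cons_reduced_eq:
  assumes "fp_reduced A B (x # w)"
  shows "fp_cons A B x w = x # w"
proof (cases w)
  case Nil
  then show ?thesis using assms by (cases x) (auto simp: fp_reduced_Cons fp_letter_ok_def)
next
  case (Cons y v)
  then show ?thesis using assms by (cases x; cases y) (auto simp: fp_reduced_Cons fp_letter_ok_def)
qed

lemma foldr_fp_cons_append: "fp_reduced A B (v @ w) \<Longrightarrow> foldr (fp_cons A B) v w = v @ w"
proof (induction v)
  case (Cons x v)
  then have "foldr (fp_cons A B) v w = v @ w" by (auto simp: fp_reduced_Cons)
  then show ?case using fp_cons_reduced_eq[of A B x "v @ w"] Cons.prems by simp
qed simp

section \<open>Van der Waerden's construction: the factors act on reduced words\<close>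

locale two_groups = A: group A + B: group B
  for A :: "('a,'m) monoid_scheme" and B :: "('b,'n) monoid_scheme"
begin

abbreviation "red \<equiv> fp_reduced A B"
abbreviation "act \<equiv> fp_cons A B"
abbreviation "linv \<equiv> fp_linv A B"
abbreviation "FP \<equiv> free_product A B"

lemma letter_in_of_ok: "fp_letter_ok A B x \<Longrightarrow> fp_letter_in A B x"
  by (cases x) (auto simp: fp_letter_ok_def fp_letter_in_def)

lemma red_act:
  assumes "fp_letter_in A B x" "red w"
  shows "red (act x w)"
proof (cases w)
  case Nil
  then show ?thesis using assms by (cases x) (auto simp: fp_reduced_Cons fp_letter_ok_def fp_letter_in_def)
next
  case (Cons y v)
  then show ?thesis using assms
    by (cases x; cases y; cases "v = []") (auto simp: fp_reduced_Cons fp_letter_ok_def fp_letter_in_def)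
qed

lemma act_one: "red w \<Longrightarrow> act (Inl \<one>\<^bsub>A\<^esub>) w = w" "red w \<Longrightarrow> act (Inr \<one>\<^bsub>B\<^esub>) w = w"
  by (cases w; cases "hd w"; auto simp: fp_reduced_Cons fp_letter_ok_def)+

text \<open>The action law for one factor. Together with its counterpart for \<open>B\<close> it
  yields associativity without comparing reductions of three concatenated words.\<close>

lemma act_mult_Inl:
  assumes "a \<in> carrier A" "a' \<in> carrier A" "red w"
  shows "act (Inl a) (act (Inl a') w) = act (Inl (a \<otimes>\<^bsub>A\<^esub> a')) w"
proof (cases w)
  case Nil
  then show ?thesis using assms by auto
next
  case (Cons y v)
  show ?thesis
  proof (cases y)
    case (Inr b)
    then show ?thesis using assms Cons by auto
  next
    case (Inl c)
    then have c: "c \<in> carrier A" and v: "red v"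
      using assms(3) Cons by (auto simp: fp_reduced_Cons fp_letter_ok_def)
    \<comment> \<open>If \<open>a'\<close> cancels the first letter, the rest begins on the other
      side, so \<open>a\<close> is simply put in front.\<close>
    have v': "v = [] \<or> (\<exists>b u. v = Inr b # u)"
      using assms(3) Cons Inl by (cases v; cases "hd v") (auto simp: fp_reduced_Cons)
    have assoc: "a \<otimes>\<^bsub>A\<^esub> a' \<otimes>\<^bsub>A\<^esub> c = a \<otimes>\<^bsub>A\<^esub> (a' \<otimes>\<^bsub>A\<^esub> c)" using assms c by (simp add: A.m_assoc)
    show ?thesis
    proof (cases "a' \<otimes>\<^bsub>A\<^esub> c = \<one>\<^bsub>A\<^esub>")
      case True
      then show ?thesis using v v' assms(1) assoc by (auto simp: Cons Inl)
    next
      case False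
      then show ?thesis using assoc by (simp add: Cons Inl)
    qed
  qed
qed

lemma act_mult_Inr:
  assumes "a \<in> carrier B" "a' \<in> carrier B" "red w"
  shows "act (Inr a) (act (Inr a') w) = act (Inr (a \<otimes>\<^bsub>B\<^esub> a')) w"
proof (cases w)
  case Nil
  then show ?thesis using assms by auto
next
  case (Cons y v)
  show ?thesis
  proof (cases y)
    case (Inl b)
    then show ?thesis using assms Cons by auto
  next
    case (Inr c)
    then have c: "c \<in> carrier B" and v: "red v"
      using assms(3) Cons by (auto simp: fp_reduced_Cons fp_letter_ok_def)
    have v': "v = [] \<or> (\<exists>b u. v = Inl b # u)"
      using assms(3) Cons Inr by (cases v; cases "hd v") (auto simp: fp_reduced_Cons)
    have assoc: "a \<otimes>\<^bsub>B\<^esub> a' \<otimes>\<^bsub>B\<^esub> c = a \<otimes>\<^bsub>B\<^esub> (a' \<otimes>\<^bsub>B\<^esub> c)" using assms c by (simp add: B.m_assoc)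
    show ?thesis
    proof (cases "a' \<otimes>\<^bsub>B\<^esub> c = \<one>\<^bsub>B\<^esub>")
      case True
      then show ?thesis using v v' assms(1) assoc by (auto simp: Cons Inr)
    next
      case False
      then show ?thesis using assoc by (simp add: Cons Inr)
    qed
  qed
qed

lemma red_foldr_act: "\<forall>x\<in>set v. fp_letter_in A B x \<Longrightarrow> red w \<Longrightarrow> red (foldr act v w)"
  by (induction v) (auto intro: red_act)

lemma red_letters: "red v \<Longrightarrow> \<forall>x\<in>set v. fp_letter_in A B x"
  by (auto simp: fp_reduced_def intro: letter_in_of_ok)

text \<open>A word acts through its letters. Changing its front by \<open>x\<close> either adds a
  letter or merges two letters of one factor, and merging is compatible with the action by the
  action law.\<close>

lemma foldr_act_act:
  assumes x: "fp_letter_in A B x" and "red v" and w: "red w"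
  shows "foldr act (act x v) w = act x (foldr act v w)"
proof (cases v)
  case Nil
  then show ?thesis using act_one[OF w] by (cases x) auto
next
  case (Cons y u)
  have u: "red u" and y: "fp_letter_ok A B y" using assms Cons by (auto simp: fp_reduced_Cons)
  have r: "red (foldr act u w)" using red_foldr_act[OF red_letters[OF u] w] .
  then have r': "red (act y (foldr act u w))" using red_act letter_in_of_ok y by blast
  show ?thesis
  proof (cases x; cases y)
    fix a a' assume "x = Inl a" "y = Inl a'"
    then show ?thesis using act_mult_Inl[of a a' "foldr act u w"] x y r act_one[OF r] Cons
      by (auto simp: fp_letter_in_def fp_letter_ok_def)
  next
    fix a a' assume "x = Inr a" "y = Inr a'"
    then show ?thesis using act_mult_Inr[of a a' "foldr act u w"] x y r act_one[OF r] Cons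
      by (auto simp: fp_letter_in_def fp_letter_ok_def)
  next
    fix a b assume "x = Inl a" "y = Inr b"
    then show ?thesis using act_one(1)[OF r'] Cons by auto
  next
    fix a b assume "x = Inr a" "y = Inl b"
    then show ?thesis using act_one(2)[OF r'] Cons by auto
  qed
qed

lemma foldr_act_assoc:
  assumes "red v" "red w"
  shows "\<forall>x\<in>set u. fp_letter_in A B x \<Longrightarrow> foldr act (foldr act u v) w = foldr act u (foldr act v w)"
proof (induction u)
  case (Cons x u)
  then show ?case using foldr_act_act[OF _ red_foldr_act[OF _ assms(1)] assms(2)] by simp
qed simp

lemma fp_letter_ok_linv: "fp_letter_ok A B x \<Longrightarrow> fp_letter_ok A B (linv x)"
  by (cases x) (auto simp: fp_letter_ok_def fp_linv_def)

lemma red_rev_linv: "red w \<Longrightarrow> red (rev (map linv w))"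
  unfolding fp_reduced_successively
  by (auto simp: successively_map fp_letter_ok_linv elim!: successively_mono)

lemma act_linv_Cons: "red (x # w) \<Longrightarrow> act (linv x) (x # w) = w"
  by (cases x) (auto simp: fp_reduced_Cons fp_letter_ok_def fp_linv_def)

lemma foldr_act_rev_linv: "red w \<Longrightarrow> foldr act (rev (map linv w)) w = []"
proof (induction w)
  case (Cons x w)
  then show ?case using act_linv_Cons[of x w] by (auto simp: fp_reduced_Cons)
qed simp

lemma free_product_group: "group FP"
proof (rule groupI)
  fix x y assume "x \<in> carrier FP" "y \<in> carrier FP"
  then show "x \<otimes>\<^bsub>FP\<^esub> y \<in> carrier FP"
    using red_foldr_act[OF red_letters] by (simp add: free_product_def)
next
  fix x y z assume "x \<in> carrier FP" "y \<in> carrier FP" "z \<in> carrier FP"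
  then show "x \<otimes>\<^bsub>FP\<^esub> y \<otimes>\<^bsub>FP\<^esub> z = x \<otimes>\<^bsub>FP\<^esub> (y \<otimes>\<^bsub>FP\<^esub> z)"
    using foldr_act_assoc[OF _ _ red_letters] by (simp add: free_product_def)
next
  fix x assume "x \<in> carrier FP"
  then show "\<exists>y\<in>carrier FP. y \<otimes>\<^bsub>FP\<^esub> x = \<one>\<^bsub>FP\<^esub>"
    using red_rev_linv[of x] foldr_act_rev_linv[of x] by (auto simp: free_product_def)
qed (auto simp: free_product_def)

lemma free_product_inv:
  assumes "red x"
  shows "inv\<^bsub>FP\<^esub> x = rev (map linv x)"
  by (rule group.inv_equality[OF free_product_group])
    (use assms red_rev_linv[of x] foldr_act_rev_linv[of x] in \<open>auto simp: free_product_def\<close>)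

end

section \<open>The kernel of \<open>x\<^sup>-\<^sup>1 y\<close> on pairs of reduced words\<close>

text \<open>Length of \<open>x\<^sup>-\<^sup>1 y\<close>, and the kernel \<open>\<Phi>(x\<^sup>-\<^sup>1 y)\<close> for a multiplicative \<open>\<Phi>\<close>: the common prefix of
  \<open>x\<close> and \<open>y\<close> cancels, and the two letters following it either merge or stay separate.\<close>
fun word_dist :: "('a + 'b) list \<Rightarrow> ('a + 'b) list \<Rightarrow> nat" where
  "word_dist [] y = length y"
| "word_dist (a # x) [] = length (a # x)"
| "word_dist (a # x) (b # y) = (if a = b then word_dist x y
     else length x + length y + (if isl a = isl b then 1 else 2))"

fun word_kernel :: "('l \<Rightarrow> 'l \<Rightarrow> complex) \<Rightarrow> ('l \<Rightarrow> complex) \<Rightarrow> ('l \<Rightarrow> complex) \<Rightarrow> 'l list \<Rightarrow> 'l list \<Rightarrow> complex" where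
  "word_kernel q f g [] y = prod_list (map g y)"
| "word_kernel q f g (a # x) [] = prod_list (map f (a # x))"
| "word_kernel q f g (a # x) (b # y) = (if a = b then word_kernel q f g x y
     else q a b * prod_list (map f x) * prod_list (map g y))"

lemma word_kernel_Nil2: "word_kernel q f g x [] = prod_list (map f x)"
  by (cases x) auto

definition same_side :: "('a \<Rightarrow> 'a \<Rightarrow> complex) \<Rightarrow> ('b \<Rightarrow> 'b \<Rightarrow> complex) \<Rightarrow> 'a + 'b \<Rightarrow> 'a + 'b \<Rightarrow> complex" where
  "same_side k k' x y = (case x of Inl a \<Rightarrow> (case y of Inl a' \<Rightarrow> k a a' | Inr b' \<Rightarrow> 0)
     | Inr b \<Rightarrow> (case y of Inl a' \<Rightarrow> 0 | Inr b' \<Rightarrow> k' b b'))"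

text \<open>The value at the first pair of differing letters: letters of one factor merge into a
  single letter, letters of different factors remain two.\<close>

definition mixed :: "('a + 'b \<Rightarrow> 'a + 'b \<Rightarrow> complex) \<Rightarrow> ('a + 'b \<Rightarrow> complex) \<Rightarrow> ('a + 'b \<Rightarrow> complex)
    \<Rightarrow> 'a + 'b \<Rightarrow> 'a + 'b \<Rightarrow> complex" where
  "mixed \<kappa> f g x y = (if isl x = isl y then \<kappa> x y else f x * g y)"

lemma prod_list_map_rev: "prod_list (map f (rev w)) = (prod_list (map f w) :: 'c :: comm_monoid_mult)"
  by (induction w) (auto simp: mult.commute)

context two_groups
begin

text \<open>After the common prefix has cancelled, two different letters meet. If they belong to one
  factor, their merger is nontrivial, so cancellation stops and the result is reduced. Letters of
  \<open>x\<close> enter inverted, hence \<open>\<phi> (linv l)\<close>.\<close>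

lemma foldr_act_inverse_product:
  fixes \<phi> :: "'a + 'b \<Rightarrow> complex"
  assumes "red x" "red y"
  defines "z \<equiv> foldr act (rev (map linv x)) y"
  defines "\<kappa> \<equiv> same_side (\<lambda>a a'. \<phi> (Inl (inv\<^bsub>A\<^esub> a \<otimes>\<^bsub>A\<^esub> a'))) (\<lambda>b b'. \<phi> (Inr (inv\<^bsub>B\<^esub> b \<otimes>\<^bsub>B\<^esub> b')))"
  shows "length z = word_dist x y \<and>
    prod_list (map \<phi> z) = word_kernel (mixed \<kappa> (\<lambda>l. \<phi> (linv l)) \<phi>) (\<lambda>l. \<phi> (linv l)) \<phi> x y"
  using assms(1,2) unfolding z_def
proof (induction x y rule: word_dist.induct)
  case (1 y)
  then show ?case by simp
next
  case (2 a x)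
  have *: "prod_list (map \<phi> (rev (map linv w))) = prod_list (map (\<lambda>l. \<phi> (linv l)) w)" for w
    using prod_list_map_rev[of \<phi> "map linv w"] by (simp add: comp_def)
  have "foldr act (rev (map linv (a # x))) [] = rev (map linv (a # x))"
    using foldr_fp_cons_append[of A B "rev (map linv (a # x))" "[]"] red_rev_linv[OF 2(1)] by simp
  then show ?case using *[of "a # x"] by (simp del: foldr_append)
next
  case (3 a x b y)
  have *: "prod_list (map \<phi> (rev (map linv w))) = prod_list (map (\<lambda>l. \<phi> (linv l)) w)" for w
    using prod_list_map_rev[of \<phi> "map linv w"] by (simp add: comp_def)
  have rx: "red x" "red y" "fp_letter_ok A B a" "fp_letter_ok A B b"
    and hx: "x = [] \<or> isl a \<noteq> isl (hd x)" and hy: "y = [] \<or> isl b \<noteq> isl (hd y)"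
    using 3(2,3) by (auto simp: fp_reduced_Cons)
  have rr: "red (rev (map linv x))" by (rule red_rev_linv[OF rx(1)])
  have lst: "x = [] \<or> isl a \<noteq> isl (last (rev (map linv x)))"
    using hx by (auto simp: last_rev hd_map)
  show ?case
  proof (cases "a = b")
    case True
    then show ?thesis using 3(1)[OF True rx(1,2)] act_linv_Cons[of a y] 3(3) by simp
  next
    case False
    show ?thesis
    proof (cases "isl a = isl b")
      case True
      obtain c where c: "act (linv a) (b # y) = c # y" "fp_letter_ok A B c" "isl c = isl a" "\<phi> c = \<kappa> a b"
      proof (cases a)
        case (Inl a')
        then obtain b' where b: "b = Inl b'" using True by (cases b) auto
        have ab: "a' \<in> carrier A" "b' \<in> carrier A" "a' \<noteq> b'" using Inl b rx False by (auto simp: fp_letter_ok_def)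
        then have "inv\<^bsub>A\<^esub> a' \<otimes>\<^bsub>A\<^esub> b' \<noteq> \<one>\<^bsub>A\<^esub>" by (metis A.inv_closed A.inv_equality A.inv_inv)
        then show ?thesis using that[of "Inl (inv\<^bsub>A\<^esub> a' \<otimes>\<^bsub>A\<^esub> b')"] ab Inl b
          by (auto simp: fp_linv_def fp_letter_ok_def \<kappa>_def same_side_def)
      next
        case (Inr a')
        then obtain b' where b: "b = Inr b'" using True by (cases b) auto
        have ab: "a' \<in> carrier B" "b' \<in> carrier B" "a' \<noteq> b'" using Inr b rx False by (auto simp: fp_letter_ok_def)
        then have "inv\<^bsub>B\<^esub> a' \<otimes>\<^bsub>B\<^esub> b' \<noteq> \<one>\<^bsub>B\<^esub>" by (metis B.inv_closed B.inv_equality B.inv_inv)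
        then show ?thesis using that[of "Inr (inv\<^bsub>B\<^esub> a' \<otimes>\<^bsub>B\<^esub> b')"] ab Inr b
          by (auto simp: fp_linv_def fp_letter_ok_def \<kappa>_def same_side_def)
      qed
      have "red (rev (map linv x) @ c # y)"
        unfolding fp_reduced_append fp_reduced_Cons using rr rx c(2,3) lst hy True by auto
      then have "foldr act (rev (map linv (a # x))) (b # y) = rev (map linv x) @ c # y"
        using foldr_fp_cons_append c(1) by fastforce
      then show ?thesis using False True c(4) *[of x] by (simp add: mixed_def mult_ac del: foldr_append)
    next
      case sides: False
      have red: "red (linv a # b # y)"
        unfolding fp_reduced_Cons using rx hy sides fp_letter_ok_linv by auto
      then have "act (linv a) (b # y) = linv a # b # y" by (rule fp_cons_reduced_eq)
      moreover have "red (rev (map linv x) @ linv a # b # y)"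
        unfolding fp_reduced_append using rr red lst by auto
      ultimately have "foldr act (rev (map linv (a # x))) (b # y) = rev (map linv x) @ linv a # b # y"
        using foldr_fp_cons_append by fastforce
      then show ?thesis using False sides *[of x] by (simp add: mixed_def mult_ac del: foldr_append)
    qed
  qed
qed

end

section \<open>Kernels on words\<close>

text \<open>The pivot stays in the index set, with zero row and column, so that the complement can
  be pulled back along maps which hit \<open>p\<close>.\<close>

lemma psd_schur_complement_normalized:
  assumes "psd I K" "finite I" "p \<in> I" "K p p = 1"
  shows "psd I (\<lambda>i j. K i j - K i p * K p j)"
proof -
  have I: "insert p (I - {p}) = I" using assms(3) by blast
  have "psd (I - {p}) (\<lambda>i j. K i j - K i p * K p j / K p p)"
    by (rule psd_schur_complement) (use assms I in auto)
  then have "psd I (\<lambda>i j. cnj (of_bool (i \<noteq> p)) * of_bool (j \<noteq> p) * (K i j - K i p * K p j / K p p))"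
    by (rule psd_weighted_pullback[where h = "\<lambda>i. i"]) (use assms in auto)
  then show ?thesis by (rule psd_cong) (use assms(4) in auto)
qed

definition head :: "'l list \<Rightarrow> 'l option" where
  "head x = (case x of [] \<Rightarrow> None | a # _ \<Rightarrow> Some a)"

text \<open>This is \<open>word_kernel\<close> on words of length at most one, with
  \<open>None\<close> for the empty word.\<close>

fun letter_kernel :: "('l \<Rightarrow> 'l \<Rightarrow> complex) \<Rightarrow> ('l \<Rightarrow> complex) \<Rightarrow> ('l \<Rightarrow> complex)
    \<Rightarrow> 'l option \<Rightarrow> 'l option \<Rightarrow> complex" where
  "letter_kernel q f g None None = 1"
| "letter_kernel q f g (Some a) None = f a"
| "letter_kernel q f g None (Some b) = g b"
| "letter_kernel q f g (Some a) (Some b) = (if a = b then 1 else q a b)"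

text \<open>The kernel of words is the kernel of first letters times
  \<open>\<langle>u\<^sub>x, u\<^sub>y\<rangle> + [head x = head y] (W - W(\<cdot>, []) W([], \<cdot>)) (tl x) (tl y)\<close>, where the second summand is
  a Schur complement of the kernel of shorter words.\<close>
lemma psd_word_kernel_bounded_length:
  assumes \<Lambda>: "finite \<Lambda>" "psd (insert None (Some ` \<Lambda>)) (letter_kernel q f g)"
  shows "finite T \<Longrightarrow> (\<And>x. x \<in> T \<Longrightarrow> set x \<subseteq> \<Lambda> \<and> length x \<le> n) \<Longrightarrow> psd T (word_kernel q f g)"
proof (induction n arbitrary: T)
  case 0
  have "x = []" if "x \<in> T" for x using 0(2)[OF that] by simp
  then show ?case using psd_cong[OF psd_rank_one[OF 0(1), of "\<lambda>_. 1"], of "word_kernel q f g"]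
    by (metis complex_cnj_one list.simps(8) mult_1 prod_list.Nil word_kernel.simps(1))
next
  case (Suc n)
  let ?W = "word_kernel q f g"
  \<comment> \<open>The empty word is the pivot of the Schur complement, so it has to be
    present.\<close>
  define T' where "T' = insert [] (tl ` T)"
  have T': "finite T'" using Suc by (simp add: T'_def)
  have "psd T' ?W"
  proof (rule Suc.IH[OF T'])
    fix x assume "x \<in> T'"
    then consider "x = []" | z where "z \<in> T" "x = tl z" by (auto simp: T'_def)
    then show "set x \<subseteq> \<Lambda> \<and> length x \<le> n"
    proof cases
      case (2 z)
      then show ?thesis using Suc.prems(2)[of z] by (cases z) auto
    qed simp
  qed
  note W = this
  have M: "psd T' (\<lambda>i j. ?W i j - ?W i [] * ?W [] j)"
    by (rule psd_schur_complement_normalized[OF W T']) (auto simp: T'_def)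
  define u where "u = (\<lambda>y. ?W [] (tl y))"
  have cu: "cnj (u x) = ?W (tl x) []" if "x \<in> T" for x
    unfolding u_def using psd_herm[OF W, of "[]" "tl x"] that by (auto simp: T'_def)
  have tl: "tl ` T \<subseteq> T'" by (auto simp: T'_def)
  have hd: "head ` T \<subseteq> insert None (Some ` \<Lambda>)"
    using Suc.prems(2) by (fastforce simp: head_def split: list.splits)
  have fin: "finite (insert None (Some ` \<Lambda>))" using \<Lambda> by simp
  have "psd T (\<lambda>x y. letter_kernel q f g (head x) (head y) * (cnj (u x) * u y
      + of_bool (head x = head y) * (?W (tl x) (tl y) - ?W (tl x) [] * ?W [] (tl y))))"
    by (intro psd_mult psd_add psd_rank_one psd_delta psd_pullback[OF \<Lambda>(2) fin _ hd]
        psd_pullback[OF M T' _ tl] Suc.prems(1))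
  then show ?case
  proof (rule psd_cong)
    fix x y assume "x \<in> T" "y \<in> T"
    then show "letter_kernel q f g (head x) (head y) * (cnj (u x) * u y
      + of_bool (head x = head y) * (?W (tl x) (tl y) - ?W (tl x) [] * ?W [] (tl y))) = ?W x y"
      unfolding cu[OF \<open>x \<in> T\<close>] unfolding u_def
      by (cases x; cases y) (auto simp: head_def word_kernel_Nil2)
  qed
qed

lemma psd_word_kernel:
  assumes "finite \<Lambda>" "psd (insert None (Some ` \<Lambda>)) (letter_kernel q f g)" "finite T" "T \<subseteq> lists \<Lambda>"
  shows "psd T (word_kernel q f g)"
proof (rule psd_word_kernel_bounded_length[OF assms(1-3)])
  fix x assume "x \<in> T"
  then show "set x \<subseteq> \<Lambda> \<and> length x \<le> Max (length ` T)"
    using assms(3,4) by (auto simp: in_lists_conv_set)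
qed

text \<open>\<open>word_dist\<close> counts the letters of \<open>x\<^sup>-\<^sup>1 y\<close>, so
  each letter can absorb one factor \<open>c\<close>: a merged pair takes one, a separate pair two.
  Positivity of the damped kernel thus becomes a question about single letters.\<close>

lemma word_kernel_scale:
  fixes c :: complex
  shows "c ^ word_dist x y * word_kernel (mixed \<kappa> f g) f g x y =
    word_kernel (mixed (\<lambda>a b. c * \<kappa> a b) (\<lambda>a. c * f a) (\<lambda>b. c * g b)) (\<lambda>a. c * f a) (\<lambda>b. c * g b) x y"
proof (induction x y rule: word_dist.induct)
  case (1 y)
  then show ?case by (induction y) (auto simp: mult_ac)
next
  case (2 a x)
  have "c ^ length x * prod_list (map f x) = prod_list (map (\<lambda>a. c * f a) x)" for f
    by (induction x) (auto simp: mult_ac)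
  from this[of f] show ?case by (auto simp: mult_ac)
next
  case (3 a x b y)
  have *: "prod_list (map (\<lambda>a. c * f a) x) = c ^ length x * prod_list (map f x)" for f and x :: "('a + 'b) list"
    by (induction x) (auto simp: mult_ac)
  show ?case using 3 by (auto simp: mixed_def * power_add power2_eq_square mult_ac)
qed

section \<open>Layers of fixed word distance\<close>

definition pre :: "nat \<Rightarrow> 'l list \<Rightarrow> 'l list" where "pre i x = take (length x - i) x"
definition suf :: "nat \<Rightarrow> 'l list \<Rightarrow> 'l list" where "suf i x = drop (length x - i) x"

text \<open>Cuts are counted from the end of the word, so \<open>i\<close> is the number of letters
  left after the cut. For \<open>i > length x\<close> truncated subtraction would cut at the front;
  the indicator discards this case.\<close>

definition suf_weight :: "('l \<Rightarrow> complex) \<Rightarrow> nat \<Rightarrow> 'l list \<Rightarrow> complex" where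
  "suf_weight f i x = of_bool (i \<le> length x) * prod_list (map f (suf i x))"

definition tl_weight :: "('l \<Rightarrow> complex) \<Rightarrow> nat \<Rightarrow> 'l list \<Rightarrow> complex" where
  "tl_weight f i x = of_bool (0 < i \<and> i \<le> length x) * prod_list (map f (tl (suf i x)))"

text \<open>The part of \<open>word_kernel\<close> where \<open>i\<close> letters of \<open>x\<close> and \<open>j\<close> letters of \<open>y\<close> follow the common
  prefix and no letters merge, respectively where the first of these letters merge.\<close>
definition split_part :: "('a + 'b \<Rightarrow> complex) \<Rightarrow> ('a + 'b \<Rightarrow> complex) \<Rightarrow> nat \<Rightarrow> nat
    \<Rightarrow> ('a + 'b) list \<Rightarrow> ('a + 'b) list \<Rightarrow> complex" where
  "split_part f g i j x y = suf_weight f i x * of_bool (pre i x = pre j y) * suf_weight g j y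
     - (of_bool (0 < i) * suf_weight f i x)
       * of_bool ((pre i x, isl (hd (suf i x))) = (pre j y, isl (hd (suf j y))))
       * (of_bool (0 < j) * suf_weight g j y)"

definition merge_part :: "('a + 'b \<Rightarrow> 'a + 'b \<Rightarrow> complex) \<Rightarrow> ('a + 'b \<Rightarrow> complex) \<Rightarrow> ('a + 'b \<Rightarrow> complex)
    \<Rightarrow> nat \<Rightarrow> nat \<Rightarrow> ('a + 'b) list \<Rightarrow> ('a + 'b) list \<Rightarrow> complex" where
  "merge_part \<kappa> f g i j x y = of_bool (pre i x = pre j y) *
     (tl_weight f i x * (\<kappa> (hd (suf i x)) (hd (suf j y)) - of_bool (hd (suf i x) = hd (suf j y))) * tl_weight g j y)"

lemma common_prefix_decomposition:
  "\<exists>w u v. x = w @ u \<and> y = w @ v \<and> (u = [] \<or> v = [] \<or> hd u \<noteq> hd v)"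
proof (induction x arbitrary: y)
  case (Cons a x)
  show ?case
  proof (cases "y \<noteq> [] \<and> hd y = a")
    case True
    then obtain y' where y: "y = a # y'" by (cases y) auto
    obtain w u v where "x = w @ u" "y' = w @ v" "u = [] \<or> v = [] \<or> hd u \<noteq> hd v" using Cons.IH by blast
    then show ?thesis unfolding y by (intro exI[of _ "a # w"] exI[of _ u] exI[of _ v]) auto
  next
    case False
    then show ?thesis by (intro exI[of _ "[]"] exI[of _ "a # x"] exI[of _ y]) auto
  qed
qed auto

text \<open>By maximality of \<open>w\<close> an equal prefix cannot reach beyond \<open>w\<close>;
  if it ends inside \<open>w\<close>, the next letter of both words is the same letter of
  \<open>w\<close>.\<close>

lemma pre_eq_cases:
  assumes uv: "u = [] \<or> v = [] \<or> hd u \<noteq> hd v"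
    and ij: "i \<le> length (w @ u)" "j \<le> length (w @ v)" "pre i (w @ u) = pre j (w @ v)"
  shows "(i = length u \<and> j = length v) \<or> (0 < i \<and> 0 < j \<and> hd (suf i (w @ u)) = hd (suf j (w @ v)))"
proof -
  define m where "m = length (w @ u) - i"
  have m': "m = length (w @ v) - j"
    using ij(2) arg_cong[OF ij(3), of length] by (simp add: pre_def m_def)
  have le: "m \<le> length (w @ u)" "m \<le> length (w @ v)" using m' by (auto simp: m_def)
  have eq: "take m (w @ u) = take m (w @ v)"
    using ij(3) unfolding pre_def m_def[symmetric] m'[symmetric] .
  consider "m < length w" | "m = length w" | "length w < m" by linarith
  then show ?thesis
  proof cases
    case 1
    then have "hd (drop m (w @ u)) = w ! m" "hd (drop m (w @ v)) = w ! m"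
      by (auto simp: hd_drop_conv_nth nth_append)
    moreover have "0 < i" "0 < j" using 1 m' ij by (auto simp: m_def)
    ultimately show ?thesis unfolding suf_def m_def[symmetric] m'[symmetric] by simp
  next
    case 2
    then show ?thesis using m' ij by (auto simp: m_def)
  next
    case 3
    then have ne: "u \<noteq> []" "v \<noteq> []" using le by auto
    have "(w @ u) ! length w = (w @ v) ! length w" using 3 eq by (metis nth_take)
    then have "hd u = hd v" using ne by (simp add: nth_append hd_conv_nth)
    then show ?thesis using uv ne by blast
  qed
qed

text \<open>Equality of prefixes is a condition of the form \<open>p x = q y\<close>, being the
  longest common prefix is not. The subtracted terms repair this: at a cut inside the common prefix
  the next letters agree, so the two terms of \<open>split_part\<close> cancel, and
  \<open>merge_part\<close> vanishes since \<open>\<kappa> a a = 1\<close>. At the true cut, the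
  subtraction in \<open>split_part\<close> removes exactly the pairs that merge.\<close>

lemma word_kernel_decomposition:
  assumes \<kappa>: "\<And>a b. isl a \<noteq> isl b \<Longrightarrow> \<kappa> a b = 0" "\<And>a. a \<in> set x \<Longrightarrow> \<kappa> a a = 1"
  shows "of_bool (word_dist x y = n) * word_kernel (mixed \<kappa> f g) f g x y
    = (\<Sum>i\<le>n. split_part f g i (n - i) x y) + (\<Sum>i\<in>{1..n}. merge_part \<kappa> f g i (Suc n - i) x y)"
proof -
  obtain w u v where wuv: "x = w @ u" "y = w @ v" "u = [] \<or> v = [] \<or> hd u \<noteq> hd v"
    using common_prefix_decomposition by blast
  let ?p = "length u" and ?s = "length v"
  have mem: "hd (suf i x) \<in> set x" if "0 < i" "i \<le> length x" for i
    using that by (auto simp: suf_def hd_drop_conv_nth)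
  have split0: "split_part f g i j x y = 0" if "\<not> (i = ?p \<and> j = ?s)" for i j
  proof (cases "i \<le> length x \<and> j \<le> length y \<and> pre i x = pre j y")
    case True
    then have "0 < i \<and> 0 < j \<and> hd (suf i x) = hd (suf j y)"
      using pre_eq_cases[OF wuv(3), of i w j] that unfolding wuv(1,2) by blast
    then show ?thesis using True by (simp add: split_part_def)
  next
    case False
    then show ?thesis by (auto simp: split_part_def suf_weight_def)
  qed
  have merge0: "merge_part \<kappa> f g i j x y = 0" if "\<not> (i = ?p \<and> j = ?s)" for i j
  proof (cases "i \<le> length x \<and> j \<le> length y \<and> pre i x = pre j y")
    case True
    then have "0 < i \<and> 0 < j \<and> hd (suf i x) = hd (suf j y)"
      using pre_eq_cases[OF wuv(3), of i w j] that unfolding wuv(1,2) by blast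
    then show ?thesis using True \<kappa>(2)[OF mem[of i]] by (simp add: merge_part_def)
  next
    case False
    then show ?thesis by (auto simp: merge_part_def tl_weight_def)
  qed
  have suf: "suf ?p x = u" "suf ?s y = v" "pre ?p x = w" "pre ?s y = w"
    by (auto simp: wuv suf_def pre_def)
  have split: "split_part f g ?p ?s x y = prod_list (map f u) * prod_list (map g v)
      * (1 - of_bool (u \<noteq> [] \<and> v \<noteq> [] \<and> isl (hd u) = isl (hd v)))"
    by (simp add: split_part_def suf suf_weight_def) (simp add: wuv)
  have merge: "merge_part \<kappa> f g ?p ?s x y = of_bool (u \<noteq> [] \<and> v \<noteq> []) *
      (prod_list (map f (tl u)) * \<kappa> (hd u) (hd v) * prod_list (map g (tl v)))"
    using wuv(3) by (auto simp: merge_part_def suf tl_weight_def) (auto simp: wuv)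
  have sum_split: "(\<Sum>i\<le>n. split_part f g i (n - i) x y) = of_bool (?p + ?s = n) * split_part f g ?p ?s x y"
  proof (cases "?p + ?s = n")
    case True
    have "(\<Sum>i\<le>n. split_part f g i (n - i) x y) = (\<Sum>i\<in>{?p}. split_part f g i (n - i) x y)"
      by (rule sum.mono_neutral_right) (use True split0 in auto)
    then show ?thesis using True by auto
  next
    case False
    then have "(\<Sum>i\<le>n. split_part f g i (n - i) x y) = 0"
      by (intro sum.neutral ballI split0) auto
    then show ?thesis using False by simp
  qed
  \<comment> \<open>Two letters become one, so the remaining lengths add up to \<open>n + 1\<close>;
    the range \<open>{1..n}\<close> leaves at least one letter on each side.\<close>
  have sum_merge: "(\<Sum>i\<in>{1..n}. merge_part \<kappa> f g i (Suc n - i) x y)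
      = of_bool (?p + ?s = Suc n) * merge_part \<kappa> f g ?p ?s x y"
  proof (cases "?p + ?s = Suc n \<and> 0 < ?p \<and> 0 < ?s")
    case True
    have "(\<Sum>i\<in>{1..n}. merge_part \<kappa> f g i (Suc n - i) x y) = (\<Sum>i\<in>{?p}. merge_part \<kappa> f g i (Suc n - i) x y)"
    proof (rule sum.mono_neutral_right)
      show "{?p} \<subseteq> {1..n}" using True by (simp only: insert_subset atLeastAtMost_iff empty_subsetI) arith
    qed (use merge0 in auto)
    moreover have "Suc n - ?p = ?s" using True by linarith
    ultimately show ?thesis using True by auto
  next
    case False
    have "(\<Sum>i\<in>{1..n}. merge_part \<kappa> f g i (Suc n - i) x y) = 0"
      by (intro sum.neutral ballI merge0) (use False in auto)
    then show ?thesis using False merge by auto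
  qed
  have dist: "word_dist x y = word_dist u v"
    unfolding wuv(1,2) by (induction w) auto
  have ker: "word_kernel q f g x y = word_kernel q f g u v" for q
    unfolding wuv(1,2) by (induction w) auto
  show ?thesis
    unfolding dist ker sum_split sum_merge split merge using wuv(3) \<kappa>(1)
    by (cases u; cases v) (auto simp: mixed_def)
qed

section \<open>Schur norm estimates for the layers\<close>

lemma norm_prod_list_le:
  assumes "\<And>l. l \<in> set w \<Longrightarrow> cmod (f l) \<le> c" "0 \<le> c"
  shows "cmod (prod_list (map f w)) \<le> c ^ length w"
  using assms(1) by (induction w) (auto simp: norm_mult intro!: mult_mono assms(2))

text \<open>Telescoping over the letters. The exponential constant is harmless because lengths are
  bounded before \<open>\<delta>\<close> is chosen.\<close>

lemma norm_prod_list_diff_le: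
  fixes \<delta> :: real
  assumes "\<And>l. l \<in> set w \<Longrightarrow> cmod (f l) \<le> 2 \<and> cmod (g l) \<le> 2 \<and> cmod (f l - g l) \<le> \<delta>" "0 \<le> \<delta>"
  shows "cmod (prod_list (map f w) - prod_list (map g w)) \<le> real (length w) * 2 ^ length w * \<delta>"
  using assms(1)
proof (induction w)
  case (Cons l w)
  let ?P = "prod_list (map f w)" and ?Q = "prod_list (map g w)" and ?k = "length w"
  have "cmod (f l * ?P - g l * ?Q) = cmod ((f l - g l) * ?P + g l * (?P - ?Q))" by (simp add: algebra_simps)
  also have "\<dots> \<le> cmod (f l - g l) * cmod ?P + cmod (g l) * cmod (?P - ?Q)"
    by (metis norm_mult norm_triangle_ineq)
  also have "\<dots> \<le> \<delta> * 2 ^ ?k + 2 * (real ?k * 2 ^ ?k * \<delta>)"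
    using Cons norm_prod_list_le[of w f 2] assms(2) by (intro add_mono mult_mono) auto
  also have "\<dots> \<le> real (length (l # w)) * 2 ^ length (l # w) * \<delta>"
    using assms(2) by (simp add: algebra_simps)
  finally show ?case by simp
qed simp

lemma set_suf: "set (suf i x) \<subseteq> set x"
  by (simp add: suf_def set_drop_subset)

lemma hd_suf_in_set: "0 < i \<Longrightarrow> i \<le> length x \<Longrightarrow> hd (suf i x) \<in> set x"
  by (auto simp: suf_def hd_drop_conv_nth)

lemma hd_suf_of_tl_weight: "tl_weight f i x \<noteq> 0 \<Longrightarrow> hd (suf i x) \<in> set x"
  by (auto simp: tl_weight_def hd_suf_in_set split: if_splits)

lemma norm_weights_le:
  assumes "\<And>l. l \<in> set x \<Longrightarrow> cmod (f l) \<le> c" "1 \<le> c" "i \<le> m"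
  shows "cmod (suf_weight f i x) \<le> c ^ m" "cmod (tl_weight f i x) \<le> c ^ m"
proof -
  have *: "cmod (prod_list (map f w)) \<le> c ^ m" if "set w \<subseteq> set x" "length w \<le> m" for w
    using norm_prod_list_le[of w f c] that assms(1,2) power_increasing[of "length w" m c] by force
  have 0: "0 \<le> c ^ m" using assms(2) by simp
  show "cmod (suf_weight f i x) \<le> c ^ m"
    using *[of "suf i x"] set_suf[of i x] assms(3) 0 by (auto simp: suf_weight_def norm_mult suf_def)
  have "set (tl (suf i x)) \<subseteq> set x" using set_suf[of i x] list.set_sel(2)[of "suf i x"] by (cases "suf i x") auto
  then show "cmod (tl_weight f i x) \<le> c ^ m"
    using *[of "tl (suf i x)"] assms(3) 0 by (auto simp: tl_weight_def norm_mult suf_def)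
qed

lemma norm_weights_diff_le:
  fixes \<delta> :: real
  assumes f: "\<And>l. l \<in> set x \<Longrightarrow> cmod (f l) \<le> 2 \<and> cmod (g l) \<le> 2 \<and> cmod (f l - g l) \<le> \<delta>" and "0 \<le> \<delta>" "i \<le> m"
  shows "cmod (suf_weight f i x - suf_weight g i x) \<le> real m * 2 ^ m * \<delta>"
    "cmod (tl_weight f i x - tl_weight g i x) \<le> real m * 2 ^ m * \<delta>"
proof -
  have *: "cmod (prod_list (map f w) - prod_list (map g w)) \<le> real m * 2 ^ m * \<delta>" if "set w \<subseteq> set x" "length w \<le> m" for w
  proof -
    have "cmod (prod_list (map f w) - prod_list (map g w)) \<le> real (length w) * 2 ^ length w * \<delta>"
      by (rule norm_prod_list_diff_le) (use that f assms(2) in auto)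
    moreover have "real (length w) * 2 ^ length w \<le> real m * 2 ^ m"
      using that by (intro mult_mono power_increasing) auto
    then have "real (length w) * 2 ^ length w * \<delta> \<le> real m * 2 ^ m * \<delta>" using mult_right_mono[OF _ assms(2)] by simp
    ultimately show ?thesis by linarith
  qed
  have 0: "0 \<le> real m * 2 ^ m * \<delta>" using assms(2) by simp
  show "cmod (suf_weight f i x - suf_weight g i x) \<le> real m * 2 ^ m * \<delta>"
    using *[of "suf i x"] set_suf[of i x] assms(3) 0 by (auto simp: suf_weight_def suf_def)
  have "set (tl (suf i x)) \<subseteq> set x" using set_suf[of i x] by (cases "suf i x") auto
  then show "cmod (tl_weight f i x - tl_weight g i x) \<le> real m * 2 ^ m * \<delta>"
    using *[of "tl (suf i x)"] assms(3) 0 by (auto simp: tl_weight_def suf_def)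
qed

text \<open>There are \<open>n + 1\<close> split parts and \<open>n\<close> merge parts. Each is a
  difference of two kernels of Schur norm at most 1, because all weights are contractive; hence
  linear growth in \<open>n\<close>.\<close>

lemma schur_bd_layer:
  assumes fin: "finite \<Lambda>" "finite T" and T: "T \<subseteq> lists \<Lambda>"
    and \<kappa>: "\<And>a b. isl a \<noteq> isl b \<Longrightarrow> \<kappa> a b = 0" "\<And>a. a \<in> \<Lambda> \<Longrightarrow> \<kappa> a a = 1" "schur_bd \<Lambda> 1 \<kappa>"
    and fg: "\<And>l. l \<in> \<Lambda> \<Longrightarrow> cmod (f l) \<le> 1 \<and> cmod (g l) \<le> 1"
  shows "schur_bd T (4 * (real n + 1)) (\<lambda>x y. of_bool (word_dist x y = n) * word_kernel (mixed \<kappa> f g) f g x y)"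
proof -
  have sub: "set x \<subseteq> \<Lambda>" if "x \<in> T" for x using T that by (auto simp: in_lists_conv_set)
  have mem: "hd (suf i x) \<in> \<Lambda>" if "x \<in> T" "tl_weight h i x \<noteq> 0" for h i x
    using sub[OF that(1)] hd_suf_of_tl_weight[OF that(2)] by blast
  have wt: "cmod (suf_weight f i x) \<le> 1" "cmod (tl_weight f i x) \<le> 1"
    "cmod (suf_weight g i x) \<le> 1" "cmod (tl_weight g i x) \<le> 1" if "x \<in> T" for i x
    using norm_weights_le[of x f 1 i i] norm_weights_le[of x g 1 i i] fg sub[OF that] by auto
  have split: "schur_bd T 2 (split_part f g i j)" for i j
  proof -
    have "schur_bd T (1 * 1 * 1 + 1 * 1 * 1) (split_part f g i j)"
      unfolding split_part_def
      by (intro schur_bd_diff schur_bd_weighted schur_bd_delta) (use fin wt in \<open>auto simp: norm_mult\<close>)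
    then show ?thesis by simp
  qed
  have merge: "schur_bd T 2 (merge_part \<kappa> f g i j)" for i j
  proof -
    have k: "schur_bd \<Lambda> (1 + 1) (\<lambda>a b. \<kappa> a b - of_bool (a = b))"
      by (intro schur_bd_diff \<kappa>(3) schur_bd_delta fin) auto
    have "schur_bd T (1 * (1 + 1) * 1) (\<lambda>x y. tl_weight f i x *
        (\<kappa> (hd (suf i x)) (hd (suf j y)) - of_bool (hd (suf i x) = hd (suf j y))) * tl_weight g j y)"
      by (rule schur_bd_weighted_pullback[OF k fin])
        (use wt mem in auto)
    from schur_bd_mult_delta[OF this fin(2)] show ?thesis unfolding merge_part_def by simp
  qed
  have "schur_bd T ((\<Sum>i\<le>n. 2) + (\<Sum>i\<in>{1..n}. 2)) (\<lambda>x y. (\<Sum>i\<le>n. split_part f g i (n - i) x y)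
      + (\<Sum>i\<in>{1..n}. merge_part \<kappa> f g i (Suc n - i) x y))"
    by (intro schur_bd_add schur_bd_sum split merge fin) auto
  then have "schur_bd T (4 * (real n + 1)) (\<lambda>x y. (\<Sum>i\<le>n. split_part f g i (n - i) x y)
      + (\<Sum>i\<in>{1..n}. merge_part \<kappa> f g i (Suc n - i) x y))"
    by (rule schur_bd_mono) simp
  then show ?thesis
  proof (rule schur_bd_cong)
    fix x y assume xy: "x \<in> T" "y \<in> T"
    show "(\<Sum>i\<le>n. split_part f g i (n - i) x y) + (\<Sum>i\<in>{1..n}. merge_part \<kappa> f g i (Suc n - i) x y)
      = of_bool (word_dist x y = n) * word_kernel (mixed \<kappa> f g) f g x y"
      by (rule word_kernel_decomposition[symmetric]; use \<kappa> sub[OF xy(1)] in blast)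
  qed
qed

text \<open>Telescoping in the order \<open>F\<close>, \<open>k\<close>, \<open>G\<close>. The
  intermediate products contain only \<open>F'\<close> and \<open>G\<close> as undifferenced
  weights, so these are the two that need the bound \<open>a\<close>.\<close>

lemma schur_bd_weighted_pullback_diff:
  assumes k: "schur_bd S c k" "schur_bd S c' k'" "schur_bd S e (\<lambda>s t. k s t - k' s t)" and fin: "finite S" "finite T"
    and mem: "\<And>x. x \<in> T \<Longrightarrow> F x \<noteq> 0 \<or> F' x \<noteq> 0 \<Longrightarrow> p x \<in> S" "\<And>x. x \<in> T \<Longrightarrow> G x \<noteq> 0 \<or> G' x \<noteq> 0 \<Longrightarrow> q x \<in> S"
    and bd: "\<And>x. x \<in> T \<Longrightarrow> cmod (F' x) \<le> a \<and> cmod (F x - F' x) \<le> d"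
      "\<And>x. x \<in> T \<Longrightarrow> cmod (G x) \<le> a \<and> cmod (G x - G' x) \<le> d"
    and nonneg: "0 \<le> a" "0 \<le> d" "0 \<le> c" "0 \<le> c'" "0 \<le> e"
  shows "schur_bd T (d * c * a + a * e * a + a * c' * d)
    (\<lambda>x y. F x * k (p x) (q y) * G y - F' x * k' (p x) (q y) * G' y)"
proof -
  have mem': "F x - F' x \<noteq> 0 \<Longrightarrow> p x \<in> S" "F' x \<noteq> 0 \<Longrightarrow> p x \<in> S"
    "G x - G' x \<noteq> 0 \<Longrightarrow> q x \<in> S" "G x \<noteq> 0 \<Longrightarrow> q x \<in> S" if "x \<in> T" for x
    using mem[OF that] by force+
  have "schur_bd T (d * c * a + a * e * a + a * c' * d)
    (\<lambda>x y. (F x - F' x) * k (p x) (q y) * G y + F' x * (k (p x) (q y) - k' (p x) (q y)) * G y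
      + F' x * k' (p x) (q y) * (G y - G' y))"
    by (intro schur_bd_add schur_bd_weighted_pullback[OF k(1) fin] schur_bd_weighted_pullback[OF k(2) fin]
        schur_bd_weighted_pullback[OF k(3) fin] mem') (use bd nonneg in auto)
  then show ?thesis by (rule schur_bd_cong) (simp add: algebra_simps)
qed

text \<open>With weights of size \<open>a = 2 ^ Suc n\<close> and weight errors
  \<open>d = (n + 1) * a * \<delta>\<close>, a split part costs \<open>4 * d * a\<close> and a merge
  part \<open>5 * d * a + a\<^sup>2 * \<delta>\<close>. The constant is the sum over the
  \<open>n + 1\<close> and \<open>n\<close> parts, divided by \<open>\<delta>\<close>.\<close>

definition layer_const :: "nat \<Rightarrow> real" where
  "layer_const n = (real n + 1) * (4 * (real n + 1) * (2 ^ Suc n)\<^sup>2)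
     + real n * (5 * (real n + 1) * (2 ^ Suc n)\<^sup>2 + (2 ^ Suc n)\<^sup>2)"

lemma layer_const_nonneg: "0 \<le> layer_const n"
  by (simp add: layer_const_def)

lemma schur_bd_layer_diff:
  fixes \<delta> :: real
  assumes fin: "finite \<Lambda>" "finite T" and T: "T \<subseteq> lists \<Lambda>" and \<delta>: "0 \<le> \<delta>" "\<delta> \<le> 1"
    and \<kappa>: "\<And>a b. isl a \<noteq> isl b \<Longrightarrow> \<kappa> a b = 0" "\<And>a. a \<in> \<Lambda> \<Longrightarrow> \<kappa> a a = 1"
    and \<kappa>': "\<And>a b. isl a \<noteq> isl b \<Longrightarrow> \<kappa>' a b = 0" "\<And>a. a \<in> \<Lambda> \<Longrightarrow> \<kappa>' a a = 1"
    and schur: "schur_bd \<Lambda> 1 \<kappa>'" "schur_bd \<Lambda> \<delta> (\<lambda>a b. \<kappa> a b - \<kappa>' a b)"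
    and f: "\<And>l. l \<in> \<Lambda> \<Longrightarrow> cmod (f l) \<le> 2 \<and> cmod (f' l) \<le> 2 \<and> cmod (f l - f' l) \<le> \<delta>"
    and g: "\<And>l. l \<in> \<Lambda> \<Longrightarrow> cmod (g l) \<le> 2 \<and> cmod (g' l) \<le> 2 \<and> cmod (g l - g' l) \<le> \<delta>"
  shows "schur_bd T (layer_const n * \<delta>) (\<lambda>x y. of_bool (word_dist x y = n) *
    (word_kernel (mixed \<kappa> f g) f g x y - word_kernel (mixed \<kappa>' f' g') f' g' x y))"
proof -
  have sub: "set x \<subseteq> \<Lambda>" if "x \<in> T" for x using T that by (auto simp: in_lists_conv_set)
  have mem: "hd (suf i x) \<in> \<Lambda>" if "x \<in> T" "tl_weight h i x \<noteq> 0" for h i x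
    using sub[OF that(1)] hd_suf_of_tl_weight[OF that(2)] by blast
  \<comment> \<open>A weight involves at most \<open>n + 1\<close> letters, each of modulus at most
    2.\<close>
  define a :: real where "a = 2 ^ Suc n"
  define d where "d = (real n + 1) * a * \<delta>"
  have ad: "0 \<le> a" "0 \<le> d" using \<delta> by (auto simp: a_def d_def)
  have wf: "cmod (suf_weight f' i x) \<le> a" "cmod (tl_weight f' i x) \<le> a"
    "cmod (suf_weight f i x - suf_weight f' i x) \<le> d" "cmod (tl_weight f i x - tl_weight f' i x) \<le> d"
    if "x \<in> T" "i \<le> Suc n" for i x
    using norm_weights_le[of x f' 2 i "Suc n"] norm_weights_diff_le[of x f f' \<delta> i "Suc n"] f sub[OF that(1)] that(2) \<delta>
    unfolding a_def d_def by (auto simp: subset_iff algebra_simps)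
  have wg: "cmod (suf_weight g i x) \<le> a" "cmod (tl_weight g i x) \<le> a"
    "cmod (suf_weight g i x - suf_weight g' i x) \<le> d" "cmod (tl_weight g i x - tl_weight g' i x) \<le> d"
    if "x \<in> T" "i \<le> Suc n" for i x
    using norm_weights_le[of x g 2 i "Suc n"] norm_weights_diff_le[of x g g' \<delta> i "Suc n"] g sub[OF that(1)] that(2) \<delta>
    unfolding a_def d_def by (auto simp: subset_iff algebra_simps)
  have split: "schur_bd T (4 * d * a) (\<lambda>x y. split_part f g i j x y - split_part f' g' i j x y)"
    if ij: "i \<le> Suc n" "j \<le> Suc n" for i j
  proof -
    have zero: "schur_bd T 0 (\<lambda>x y. of_bool (s x = t y) - of_bool (s x = t y))"
      for s t :: "('a + 'b) list \<Rightarrow> 'z" using schur_bd_zero[OF fin(2)] by simp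
    have 1: "schur_bd T (d * 1 * a + a * 0 * a + a * 1 * d) (\<lambda>x y.
        F x * of_bool (s x = t y) * G y - F' x * of_bool (s x = t y) * G' y)"
      if "\<And>x. x \<in> T \<Longrightarrow> cmod (F' x) \<le> a \<and> cmod (F x - F' x) \<le> d"
        "\<And>x. x \<in> T \<Longrightarrow> cmod (G x) \<le> a \<and> cmod (G x - G' x) \<le> d" for F F' G G' and s t :: "('a + 'b) list \<Rightarrow> 'z"
      using schur_bd_weighted_pullback_diff[where p = "\<lambda>x. x" and q = "\<lambda>x. x",
          OF schur_bd_delta[OF fin(2)] schur_bd_delta[OF fin(2)] zero fin(2) fin(2), of F F' G G' a d s t]
        that ad by simp
    have "schur_bd T ((d * 1 * a + a * 0 * a + a * 1 * d) + (d * 1 * a + a * 0 * a + a * 1 * d)) (\<lambda>x y.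
       (suf_weight f i x * of_bool (pre i x = pre j y) * suf_weight g j y
         - suf_weight f' i x * of_bool (pre i x = pre j y) * suf_weight g' j y)
       - ((of_bool (0 < i) * suf_weight f i x)
           * of_bool ((pre i x, isl (hd (suf i x))) = (pre j y, isl (hd (suf j y))))
           * (of_bool (0 < j) * suf_weight g j y)
         - (of_bool (0 < i) * suf_weight f' i x)
           * of_bool ((pre i x, isl (hd (suf i x))) = (pre j y, isl (hd (suf j y))))
           * (of_bool (0 < j) * suf_weight g' j y)))"
      by (intro schur_bd_diff 1) (use wf wg ij ad fin in \<open>auto simp: norm_mult right_diff_distrib[symmetric]\<close>)
    then have "schur_bd T (4 * d * a) (\<lambda>x y.
       (suf_weight f i x * of_bool (pre i x = pre j y) * suf_weight g j y
         - suf_weight f' i x * of_bool (pre i x = pre j y) * suf_weight g' j y)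
       - ((of_bool (0 < i) * suf_weight f i x)
           * of_bool ((pre i x, isl (hd (suf i x))) = (pre j y, isl (hd (suf j y))))
           * (of_bool (0 < j) * suf_weight g j y)
         - (of_bool (0 < i) * suf_weight f' i x)
           * of_bool ((pre i x, isl (hd (suf i x))) = (pre j y, isl (hd (suf j y))))
           * (of_bool (0 < j) * suf_weight g' j y)))"
      by (rule schur_bd_mono) (simp add: algebra_simps)
    then show ?thesis unfolding split_part_def by (rule schur_bd_cong) (simp add: algebra_simps)
  qed
  have merge: "schur_bd T (5 * d * a + a\<^sup>2 * \<delta>) (\<lambda>x y. merge_part \<kappa> f g i j x y - merge_part \<kappa>' f' g' i j x y)"
    if ij: "i \<le> Suc n" "j \<le> Suc n" for i j
  proof -
    \<comment> \<open>The two merging kernels, with the equality kernel subtracted, have bounds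
      \<open>1 + \<delta> + 1 \<le> 3\<close> and 2; these add up to the 5 in
      \<open>layer_const\<close>.\<close>
    have \<kappa>2: "schur_bd \<Lambda> (1 + \<delta>) \<kappa>" using schur_bd_add[OF schur] by simp
    have k: "schur_bd \<Lambda> (1 + \<delta> + 1) (\<lambda>a b. \<kappa> a b - of_bool (a = b))"
      by (intro schur_bd_diff \<kappa>2 schur_bd_delta fin) auto
    then have k3: "schur_bd \<Lambda> 3 (\<lambda>a b. \<kappa> a b - of_bool (a = b))" by (rule schur_bd_mono) (use \<delta> in simp)
    have k': "schur_bd \<Lambda> (1 + 1) (\<lambda>a b. \<kappa>' a b - of_bool (a = b))"
      by (intro schur_bd_diff schur(1) schur_bd_delta fin) auto
    have kk': "schur_bd \<Lambda> \<delta> (\<lambda>a b. (\<kappa> a b - of_bool (a = b)) - (\<kappa>' a b - of_bool (a = b)))"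
      using schur(2) by simp
    have "schur_bd T (d * 3 * a + a * \<delta> * a + a * (1 + 1) * d) (\<lambda>x y.
        tl_weight f i x * (\<kappa> (hd (suf i x)) (hd (suf j y)) - of_bool (hd (suf i x) = hd (suf j y))) * tl_weight g j y
        - tl_weight f' i x * (\<kappa>' (hd (suf i x)) (hd (suf j y)) - of_bool (hd (suf i x) = hd (suf j y))) * tl_weight g' j y)"
      by (rule schur_bd_weighted_pullback_diff[OF k3 k' kk' fin])
        (use wf wg ij ad \<delta> mem in auto)
    from schur_bd_mult_delta[OF this fin(2), of "pre i" "pre j"]
    have "schur_bd T (5 * d * a + a\<^sup>2 * \<delta>) (\<lambda>x y. of_bool (pre i x = pre j y) * (
        tl_weight f i x * (\<kappa> (hd (suf i x)) (hd (suf j y)) - of_bool (hd (suf i x) = hd (suf j y))) * tl_weight g j y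
        - tl_weight f' i x * (\<kappa>' (hd (suf i x)) (hd (suf j y)) - of_bool (hd (suf i x) = hd (suf j y))) * tl_weight g' j y))"
      by (rule schur_bd_mono) (simp add: algebra_simps power2_eq_square)
    then show ?thesis unfolding merge_part_def by (rule schur_bd_cong) (simp add: right_diff_distrib)
  qed
  have "schur_bd T ((\<Sum>i\<le>n. 4 * d * a) + (\<Sum>i\<in>{1..n}. 5 * d * a + a\<^sup>2 * \<delta>)) (\<lambda>x y.
      (\<Sum>i\<le>n. split_part f g i (n - i) x y - split_part f' g' i (n - i) x y)
      + (\<Sum>i\<in>{1..n}. merge_part \<kappa> f g i (Suc n - i) x y - merge_part \<kappa>' f' g' i (Suc n - i) x y))"
    by (intro schur_bd_add schur_bd_sum split merge fin) auto
  moreover have "(\<Sum>i\<le>n. 4 * d * a) + (\<Sum>i\<in>{1..n}. 5 * d * a + a\<^sup>2 * \<delta>) = layer_const n * \<delta>"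
    by (simp add: layer_const_def d_def a_def[symmetric] del: power_Suc) (simp add: algebra_simps power2_eq_square)
  ultimately have "schur_bd T (layer_const n * \<delta>) (\<lambda>x y.
      (\<Sum>i\<le>n. split_part f g i (n - i) x y - split_part f' g' i (n - i) x y)
      + (\<Sum>i\<in>{1..n}. merge_part \<kappa> f g i (Suc n - i) x y - merge_part \<kappa>' f' g' i (Suc n - i) x y))" by simp
  then show ?thesis
  proof (rule schur_bd_cong)
    fix x y assume xy: "x \<in> T" "y \<in> T"
    have "of_bool (word_dist x y = n) * word_kernel (mixed \<kappa> f g) f g x y
      = (\<Sum>i\<le>n. split_part f g i (n - i) x y) + (\<Sum>i\<in>{1..n}. merge_part \<kappa> f g i (Suc n - i) x y)"
      "of_bool (word_dist x y = n) * word_kernel (mixed \<kappa>' f' g') f' g' x y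
      = (\<Sum>i\<le>n. split_part f' g' i (n - i) x y) + (\<Sum>i\<in>{1..n}. merge_part \<kappa>' f' g' i (Suc n - i) x y)"
      by (intro word_kernel_decomposition; use \<kappa> \<kappa>' sub[OF xy(1)] in blast)+
    then show "(\<Sum>i\<le>n. split_part f g i (n - i) x y - split_part f' g' i (n - i) x y)
      + (\<Sum>i\<in>{1..n}. merge_part \<kappa> f g i (Suc n - i) x y - merge_part \<kappa>' f' g' i (Suc n - i) x y)
      = of_bool (word_dist x y = n) * (word_kernel (mixed \<kappa> f g) f g x y - word_kernel (mixed \<kappa>' f' g') f' g' x y)"
      unfolding right_diff_distrib by (simp add: sum_subtractf)
  qed
qed

text \<open>A block-diagonal sum: each letter meets only the block of its own factor, so the bounds
  do not add. The weights \<open>w\<close> and \<open>w'\<close> switch off \<open>projl\<close> and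
  \<open>projr\<close> on letters of the wrong factor.\<close>

lemma schur_bd_same_side:
  assumes k: "schur_bd S c k" "schur_bd S' c k'" and fin: "finite S" "finite S'" "finite \<Lambda>"
    and \<Lambda>: "\<And>a. Inl a \<in> \<Lambda> \<Longrightarrow> a \<in> S" "\<And>b. Inr b \<in> \<Lambda> \<Longrightarrow> b \<in> S'"
  shows "schur_bd \<Lambda> c (same_side k k')"
proof -
  obtain R where R: "psd (S <+> S) R" "\<And>s t. s \<in> S \<Longrightarrow> t \<in> S \<Longrightarrow> R (Inl s) (Inr t) = k s t"
    "\<And>i. i \<in> S <+> S \<Longrightarrow> Re (R i i) \<le> c" using schur_bdE[OF k(1)] by metis
  obtain Q where Q: "psd (S' <+> S') Q" "\<And>s t. s \<in> S' \<Longrightarrow> t \<in> S' \<Longrightarrow> Q (Inl s) (Inr t) = k' s t"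
    "\<And>i. i \<in> S' <+> S' \<Longrightarrow> Re (Q i i) \<le> c" using schur_bdE[OF k(2)] by metis
  define w :: "('a + 'b) + ('a + 'b) \<Rightarrow> complex" where "w = (\<lambda>i. of_bool (isl (case_sum id id i)))"
  define w' :: "('a + 'b) + ('a + 'b) \<Rightarrow> complex" where "w' = (\<lambda>i. of_bool (\<not> isl (case_sum id id i)))"
  have "psd (\<Lambda> <+> \<Lambda>) (\<lambda>i j. cnj (w i) * w j * R (map_sum projl projl i) (map_sum projl projl j)
      + cnj (w' i) * w' j * Q (map_sum projr projr i) (map_sum projr projr j))"
    by (intro psd_add psd_weighted_pullback[OF R(1)] psd_weighted_pullback[OF Q(1)])
      (use fin \<Lambda> in \<open>auto simp: w_def w'_def isl_def elim!: PlusE split: sum.splits\<close>)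
  then show ?thesis
  proof (rule schur_bdI)
    fix x y assume "x \<in> \<Lambda>" "y \<in> \<Lambda>"
    then show "cnj (w (Inl x)) * w (Inr y) * R (map_sum projl projl (Inl x)) (map_sum projl projl (Inr y))
      + cnj (w' (Inl x)) * w' (Inr y) * Q (map_sum projr projr (Inl x)) (map_sum projr projr (Inr y)) = same_side k k' x y"
      using \<Lambda> R(2) Q(2) by (cases x; cases y) (auto simp: w_def w'_def same_side_def)
  next
    fix i assume i: "i \<in> \<Lambda> <+> \<Lambda>"
    obtain x where x: "x \<in> \<Lambda>" "i = Inl x \<or> i = Inr x" using i by auto
    show "Re (cnj (w i) * w i * R (map_sum projl projl i) (map_sum projl projl i)
      + cnj (w' i) * w' i * Q (map_sum projr projr i) (map_sum projr projr i)) \<le> c"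
      using x \<Lambda> by (cases x) (auto simp: w_def w'_def intro!: R(3) Q(3))
  qed
qed

lemma word_dist_refl: "word_dist x x = 0"
  by (induction x) auto

lemma word_kernel_refl: "word_kernel q f g x x = 1"
  by (induction x) auto

text \<open>A convex combination of \<open>P\<close> with the equality kernel, so damping leaves the
  diagonal at 1.\<close>

lemma psd_damp:
  assumes "psd S P" "finite S" "\<And>s. s \<in> S \<Longrightarrow> P s s = 1" "0 \<le> r" "r \<le> 1"
  shows "psd S (\<lambda>s t. if s = t then 1 else of_real r * P s t)"
proof (rule psd_cong)
  show "psd S (\<lambda>s t. of_real r * P s t + of_real (1 - r) * of_bool (s = t))"
    using assms psd_delta[of S "\<lambda>s. s"] by (intro psd_add psd_scale) auto
qed (use assms(3) in auto)

section \<open>Multipliers of the free product\<close>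

lemma summable_linear_geometric: "0 \<le> r \<Longrightarrow> r < 1 \<Longrightarrow> summable (\<lambda>n. 4 * (real n + 1) * r ^ n)"
proof -
  assume "0 \<le> r" "r < 1"
  then have "summable (\<lambda>n. real (Suc n) * r ^ n)"
    using geometric_deriv_sums[of r] by (auto simp: sums_iff)
  from summable_mult[OF this, of 4] show ?thesis by (simp add: algebra_simps)
qed

context two_groups
begin

text \<open>The counterpart of \<open>\<phi>(a\<^sup>-\<^sup>1)\<close> for a kernel that is not
  translation invariant; \<open>kernel_one_letter\<close> is that of
  \<open>\<phi>(a)\<close>.\<close>

definition kernel_letter_one :: "('a \<Rightarrow> 'a \<Rightarrow> complex) \<Rightarrow> ('b \<Rightarrow> 'b \<Rightarrow> complex) \<Rightarrow> 'a + 'b \<Rightarrow> complex" where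
  "kernel_letter_one k k' l = (case l of Inl a \<Rightarrow> k a \<one>\<^bsub>A\<^esub> | Inr b \<Rightarrow> k' b \<one>\<^bsub>B\<^esub>)"

definition kernel_one_letter :: "('a \<Rightarrow> 'a \<Rightarrow> complex) \<Rightarrow> ('b \<Rightarrow> 'b \<Rightarrow> complex) \<Rightarrow> 'a + 'b \<Rightarrow> complex" where
  "kernel_one_letter k k' l = (case l of Inl a \<Rightarrow> k \<one>\<^bsub>A\<^esub> a | Inr b \<Rightarrow> k' \<one>\<^bsub>B\<^esub> b)"

text \<open>On letters, the kernel of the free product is the product of the kernels of the two
  projections of the words of length at most one onto \<open>A\<close> and \<open>B\<close>.\<close>
lemma psd_damped_word_kernel:
  assumes P: "psd S P" "finite S" "\<And>s. s \<in> S \<Longrightarrow> P s s = 1" "\<one>\<^bsub>A\<^esub> \<in> S"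
    and P': "psd S' P'" "finite S'" "\<And>s. s \<in> S' \<Longrightarrow> P' s s = 1" "\<one>\<^bsub>B\<^esub> \<in> S'"
    and \<Lambda>: "finite \<Lambda>" "\<And>l. l \<in> \<Lambda> \<Longrightarrow> fp_letter_ok A B l" "\<And>a. Inl a \<in> \<Lambda> \<Longrightarrow> a \<in> S" "\<And>b. Inr b \<in> \<Lambda> \<Longrightarrow> b \<in> S'"
    and r: "0 \<le> r" "r \<le> 1" and T: "finite T" "T \<subseteq> lists \<Lambda>"
  defines "\<kappa> \<equiv> same_side P P'" and "f \<equiv> kernel_letter_one P P'" and "g \<equiv> kernel_one_letter P P'"
  shows "psd T (\<lambda>x y. of_real r ^ word_dist x y * word_kernel (mixed \<kappa> f g) f g x y)"
proof -
  let ?r = "complex_of_real r"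
  define k where "k = (\<lambda>s t. if s = t then 1 else ?r * P s t)"
  define k' where "k' = (\<lambda>s t. if s = t then 1 else ?r * P' s t)"
  \<comment> \<open>The empty word and the letters of the other factor go to the unit. For letters
    of different factors both kernels then contribute one damped value, which is the product
    required by \<open>mixed\<close>.\<close>
  define p :: "('a + 'b) option \<Rightarrow> 'a" where "p = (\<lambda>x. case x of Some (Inl a) \<Rightarrow> a | _ \<Rightarrow> \<one>\<^bsub>A\<^esub>)"
  define p' :: "('a + 'b) option \<Rightarrow> 'b" where "p' = (\<lambda>x. case x of Some (Inr b) \<Rightarrow> b | _ \<Rightarrow> \<one>\<^bsub>B\<^esub>)"
  let ?I = "insert None (Some ` \<Lambda>)"
  have I: "finite ?I" "p ` ?I \<subseteq> S" "p' ` ?I \<subseteq> S'"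
    using \<Lambda> P(4) P'(4) by (auto simp: p_def p'_def split: sum.splits)
  have k: "psd S k" "psd S' k'" unfolding k_def k'_def
    by (rule psd_damp; use P P' r in auto)+
  have "psd ?I (\<lambda>x y. k (p x) (p y) * k' (p' x) (p' y))"
    by (intro psd_mult psd_pullback[OF k(1) P(2) I(1,2)] psd_pullback[OF k(2) P'(2) I(1,3)] I(1))
  then have "psd ?I (letter_kernel (mixed (\<lambda>a b. ?r * \<kappa> a b) (\<lambda>a. ?r * f a) (\<lambda>b. ?r * g b)) (\<lambda>a. ?r * f a) (\<lambda>b. ?r * g b))"
  proof (rule psd_cong)
    fix x y assume xy: "x \<in> ?I" "y \<in> ?I"
    \<comment> \<open>Letters are never units, so \<open>k\<close> takes its damped branch at a
      letter against the unit.\<close>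
    have ne: "a \<noteq> \<one>\<^bsub>A\<^esub>" "\<one>\<^bsub>A\<^esub> \<noteq> a" if "Inl a \<in> \<Lambda>" for a using \<Lambda>(2)[OF that] by (auto simp: fp_letter_ok_def)
    have ne': "b \<noteq> \<one>\<^bsub>B\<^esub>" "\<one>\<^bsub>B\<^esub> \<noteq> b" if "Inr b \<in> \<Lambda>" for b using \<Lambda>(2)[OF that] by (auto simp: fp_letter_ok_def)
    show "k (p x) (p y) * k' (p' x) (p' y) = letter_kernel (mixed (\<lambda>a b. ?r * \<kappa> a b) (\<lambda>a. ?r * f a) (\<lambda>b. ?r * g b)) (\<lambda>a. ?r * f a) (\<lambda>b. ?r * g b) x y"
    proof (cases x)
      case None
      show ?thesis
      proof (cases y)
        case N: None
        then show ?thesis using None by (simp add: p_def p'_def k_def k'_def)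
      next
        case (Some m)
        then show ?thesis using None xy ne ne'
          by (cases m) (auto simp: p_def p'_def k_def k'_def g_def kernel_one_letter_def)
      qed
    next
      case (Some l)
      show ?thesis
      proof (cases y)
        case None
        then show ?thesis using Some xy ne ne'
          by (cases l) (auto simp: p_def p'_def k_def k'_def f_def kernel_letter_one_def)
      next
        case S: (Some m)
        then show ?thesis using Some xy ne ne'
          by (cases l; cases m) (auto simp: p_def p'_def k_def k'_def f_def kernel_letter_one_def g_def
              kernel_one_letter_def mixed_def \<kappa>_def same_side_def)
      qed
    qed
  qed
  from psd_word_kernel[OF \<Lambda>(1) this T] show ?thesis unfolding word_kernel_scale .
qed

lemma free_product_kernel_schur_bd:
  fixes \<phi> :: "'a \<Rightarrow> complex" and \<phi>' :: "'b \<Rightarrow> complex" and \<delta> r :: real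
  assumes \<phi>: "\<phi> \<one>\<^bsub>A\<^esub> = 1" "\<And>S. finite S \<Longrightarrow> S \<subseteq> carrier A \<Longrightarrow> \<exists>P. psd S P \<and> (\<forall>s\<in>S. P s s = 1) \<and>
      schur_bd S \<delta> (\<lambda>s t. \<phi> (inv\<^bsub>A\<^esub> s \<otimes>\<^bsub>A\<^esub> t) - P s t)"
    and \<phi>': "\<phi>' \<one>\<^bsub>B\<^esub> = 1" "\<And>S. finite S \<Longrightarrow> S \<subseteq> carrier B \<Longrightarrow> \<exists>P. psd S P \<and> (\<forall>s\<in>S. P s s = 1) \<and>
      schur_bd S \<delta> (\<lambda>s t. \<phi>' (inv\<^bsub>B\<^esub> s \<otimes>\<^bsub>B\<^esub> t) - P s t)"
    and \<delta>: "0 \<le> \<delta>" "\<delta> \<le> 1" and r: "0 \<le> r" "r \<le> 1"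
    and tail: "\<And>N. (\<Sum>n\<in>{Suc D..<N}. 4 * (real n + 1) * r ^ n) \<le> \<epsilon> / 2"
    and small: "(\<Sum>n\<le>D. layer_const n * r ^ n) * \<delta> \<le> \<epsilon> / 2"
    and T: "finite T" "T \<subseteq> carrier FP"
  defines "\<psi> \<equiv> \<lambda>w. if length w \<le> D then of_real r ^ length w * prod_list (map (case_sum \<phi> \<phi>') w) else 0"
  shows "schur_bd T (1 + \<epsilon>) (\<lambda>x y. \<psi> (inv\<^bsub>FP\<^esub> x \<otimes>\<^bsub>FP\<^esub> y))"
proof -
  let ?r = "complex_of_real r"
  define \<Lambda> where "\<Lambda> = (\<Union>x\<in>T. set x)"
  have red: "red x" if "x \<in> T" for x using T that by (auto simp: free_product_def)
  have \<Lambda>: "finite \<Lambda>" "\<And>l. l \<in> \<Lambda> \<Longrightarrow> fp_letter_ok A B l" "T \<subseteq> lists \<Lambda>"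
    using T(1) red by (auto simp: \<Lambda>_def fp_reduced_def)
  \<comment> \<open>The unit is added because \<open>f'\<close> and \<open>g'\<close> evaluate
    \<open>P\<close> at a letter against the unit.\<close>
  define S where "S = insert \<one>\<^bsub>A\<^esub> (Inl -` \<Lambda>)"
  define S' where "S' = insert \<one>\<^bsub>B\<^esub> (Inr -` \<Lambda>)"
  have S: "finite S" "S \<subseteq> carrier A" "\<And>a. Inl a \<in> \<Lambda> \<Longrightarrow> a \<in> S" "\<one>\<^bsub>A\<^esub> \<in> S"
    using \<Lambda>(1,2) by (auto simp: S_def fp_letter_ok_def intro!: finite_vimageI dest!: \<Lambda>(2))
  have S': "finite S'" "S' \<subseteq> carrier B" "\<And>b. Inr b \<in> \<Lambda> \<Longrightarrow> b \<in> S'" "\<one>\<^bsub>B\<^esub> \<in> S'"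
    using \<Lambda>(1,2) by (auto simp: S'_def fp_letter_ok_def intro!: finite_vimageI dest!: \<Lambda>(2))
  obtain P where P: "psd S P" "\<And>s. s \<in> S \<Longrightarrow> P s s = 1" "schur_bd S \<delta> (\<lambda>s t. \<phi> (inv\<^bsub>A\<^esub> s \<otimes>\<^bsub>A\<^esub> t) - P s t)"
    using \<phi>(2)[OF S(1,2)] by blast
  obtain P' where P': "psd S' P'" "\<And>s. s \<in> S' \<Longrightarrow> P' s s = 1" "schur_bd S' \<delta> (\<lambda>s t. \<phi>' (inv\<^bsub>B\<^esub> s \<otimes>\<^bsub>B\<^esub> t) - P' s t)"
    using \<phi>'(2)[OF S'(1,2)] by blast
  define \<kappa> where "\<kappa> = same_side (\<lambda>a a'. \<phi> (inv\<^bsub>A\<^esub> a \<otimes>\<^bsub>A\<^esub> a')) (\<lambda>b b'. \<phi>' (inv\<^bsub>B\<^esub> b \<otimes>\<^bsub>B\<^esub> b'))"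
  define f where "f = (\<lambda>l. case_sum \<phi> \<phi>' (linv l))"
  define g where "g = case_sum \<phi> \<phi>'"
  define \<kappa>' where "\<kappa>' = same_side P P'"
  define f' where "f' = kernel_letter_one P P'"
  define g' where "g' = kernel_one_letter P P'"
  define W where "W = word_kernel (mixed \<kappa> f g) f g"
  define W' where "W' = word_kernel (mixed \<kappa>' f' g') f' g'"
  have ker: "\<psi> (inv\<^bsub>FP\<^esub> x \<otimes>\<^bsub>FP\<^esub> y) = of_bool (word_dist x y \<le> D) * ?r ^ word_dist x y * W x y"
    if "x \<in> T" "y \<in> T" for x y
  proof -
    have "inv\<^bsub>FP\<^esub> x \<otimes>\<^bsub>FP\<^esub> y = foldr act (rev (map linv x)) y"
      by (simp add: free_product_inv red that) (simp add: free_product_def)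
    then show ?thesis
      using foldr_act_inverse_product[OF red[OF that(1)] red[OF that(2)], of g]
      unfolding \<psi>_def W_def \<kappa>_def f_def g_def by simp
  qed
  have \<kappa>: "\<kappa> a b = 0" "\<kappa>' a b = 0" if "isl a \<noteq> isl b" for a b
    using that by (cases a; cases b; simp add: \<kappa>_def \<kappa>'_def same_side_def)+
  have \<kappa>1: "\<kappa> l l = 1" "\<kappa>' l l = 1" if l: "l \<in> \<Lambda>" for l
    using \<Lambda>(2)[OF l] \<phi>(1) \<phi>'(1) P(2) P'(2) S(3) S'(3) l
    by (cases l; simp add: \<kappa>_def \<kappa>'_def same_side_def fp_letter_ok_def)+
  have s1: "schur_bd \<Lambda> 1 \<kappa>'" unfolding \<kappa>'_def
    by (rule schur_bd_same_side[OF schur_bd_psd[OF P(1)] schur_bd_psd[OF P'(1)]])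
      (use P(2) P'(2) S S' \<Lambda> in auto)
  have s2: "schur_bd \<Lambda> \<delta> (\<lambda>a b. \<kappa> a b - \<kappa>' a b)"
    by (rule schur_bd_cong[OF schur_bd_same_side[OF P(3) P'(3) S(1) S'(1) \<Lambda>(1) S(3) S'(3)]])
      (auto simp: \<kappa>_def \<kappa>'_def same_side_def split: sum.splits)
  have P1: "cmod (P s t) \<le> 1" if "s \<in> S" "t \<in> S" for s t
    using schur_bd_norm[OF schur_bd_psd[OF P(1) S(1), of 1] S(1) that] P(2) by simp
  have P1': "cmod (P' s t) \<le> 1" if "s \<in> S'" "t \<in> S'" for s t
    using schur_bd_norm[OF schur_bd_psd[OF P'(1) S'(1), of 1] S'(1) that] P'(2) by simp
  have fg': "cmod (f' l) \<le> 1" "cmod (g' l) \<le> 1" if "l \<in> \<Lambda>" for l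
    using that P1 P1' S S' by (cases l; auto simp: f'_def g'_def kernel_letter_one_def kernel_one_letter_def)+
  have fg: "cmod (f l - f' l) \<le> \<delta>" "cmod (g l - g' l) \<le> \<delta>" if l: "l \<in> \<Lambda>" for l
  proof -
    have "cmod (f l - f' l) \<le> \<delta> \<and> cmod (g l - g' l) \<le> \<delta>"
    proof (cases l)
      case (Inl a)
      then have a: "a \<in> S" "a \<in> carrier A" using S l by auto
      show ?thesis
        using schur_bd_norm[OF P(3) S(1) a(1) S(4)] schur_bd_norm[OF P(3) S(1) S(4) a(1)] a(2) Inl
        by (simp add: f_def f'_def g_def g'_def kernel_letter_one_def kernel_one_letter_def fp_linv_def)
    next
      case (Inr b)
      then have b: "b \<in> S'" "b \<in> carrier B" using S' l by auto
      show ?thesis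
        using schur_bd_norm[OF P'(3) S'(1) b(1) S'(4)] schur_bd_norm[OF P'(3) S'(1) S'(4) b(1)] b(2) Inr
        by (simp add: f_def f'_def g_def g'_def kernel_letter_one_def kernel_one_letter_def fp_linv_def)
    qed
    then show "cmod (f l - f' l) \<le> \<delta>" "cmod (g l - g' l) \<le> \<delta>" by auto
  qed
  have f2: "cmod (f l) \<le> 2 \<and> cmod (f' l) \<le> 2 \<and> cmod (f l - f' l) \<le> \<delta>"
    "cmod (g l) \<le> 2 \<and> cmod (g' l) \<le> 2 \<and> cmod (g l - g' l) \<le> \<delta>" if "l \<in> \<Lambda>" for l
    using fg[OF that] fg'[OF that] \<delta> norm_triangle_sub[of "f l" "f' l"] norm_triangle_sub[of "g l" "g' l"] by auto
  have main: "schur_bd T 1 (\<lambda>x y. ?r ^ word_dist x y * W' x y)"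
  proof (rule schur_bd_psd)
    show "psd T (\<lambda>x y. ?r ^ word_dist x y * W' x y)"
      unfolding W'_def \<kappa>'_def f'_def g'_def
      by (rule psd_damped_word_kernel[OF P(1) S(1) P(2) S(4) P'(1) S'(1) P'(2) S'(4) \<Lambda>(1,2) S(3) S'(3) r T(1) \<Lambda>(3)])
  qed (use T in \<open>auto simp: W'_def word_dist_refl word_kernel_refl\<close>)
  have far: "schur_bd T (4 * (real n + 1) * r ^ n) (\<lambda>x y. ?r ^ n * (of_bool (word_dist x y = n) * W' x y))" for n
  proof -
    have "schur_bd T (4 * (real n + 1)) (\<lambda>x y. of_bool (word_dist x y = n) * W' x y)"
      unfolding W'_def by (rule schur_bd_layer[OF \<Lambda>(1) T(1) \<Lambda>(3)]) (use \<kappa> \<kappa>1 s1 fg' in auto)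
    from schur_bd_cmult[OF this T(1), of "?r ^ n"] show ?thesis
      using r by (simp add: norm_power mult.commute)
  qed
  have near: "schur_bd T (layer_const n * r ^ n * \<delta>) (\<lambda>x y. ?r ^ n * (of_bool (word_dist x y = n) * (W x y - W' x y)))" for n
  proof -
    have "schur_bd T (layer_const n * \<delta>) (\<lambda>x y. of_bool (word_dist x y = n) * (W x y - W' x y))"
      unfolding W_def W'_def
      by (rule schur_bd_layer_diff[OF \<Lambda>(1) T(1) \<Lambda>(3) \<delta> \<kappa>(1) \<kappa>1(1) \<kappa>(2) \<kappa>1(2) s1 s2 f2])
    from schur_bd_cmult[OF this T(1), of "?r ^ n"] show ?thesis
      using r \<delta> layer_const_nonneg[of n] by (simp add: norm_power mult_ac)
  qed
  \<comment> \<open>Only finitely many distances occur on \<open>T\<close>, so the infinite tail is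
    a finite sum here; its bound is uniform in \<open>N\<close>.\<close>
  define N where "N = Suc (Max (insert 0 ((\<lambda>(x, y). word_dist x y) ` (T \<times> T))))"
  have N: "word_dist x y < N" if "x \<in> T" "y \<in> T" for x y
    unfolding N_def less_Suc_eq_le using T(1) that by (intro Max_ge) auto
  \<comment> \<open>Beyond \<open>D\<close> the subtracted sum cancels the positive kernel; up to
    \<open>D\<close> the added sum turns \<open>W'\<close> into \<open>W\<close>.\<close>
  have "schur_bd T (1 + (\<Sum>n\<in>{Suc D..<N}. 4 * (real n + 1) * r ^ n) + (\<Sum>n\<le>D. layer_const n * r ^ n * \<delta>))
    (\<lambda>x y. ?r ^ word_dist x y * W' x y - (\<Sum>n\<in>{Suc D..<N}. ?r ^ n * (of_bool (word_dist x y = n) * W' x y))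
      + (\<Sum>n\<le>D. ?r ^ n * (of_bool (word_dist x y = n) * (W x y - W' x y))))"
    by (intro schur_bd_add schur_bd_diff schur_bd_sum main far near T(1) sum_nonneg) (use r in auto)
  then have "schur_bd T (1 + \<epsilon>)
    (\<lambda>x y. ?r ^ word_dist x y * W' x y - (\<Sum>n\<in>{Suc D..<N}. ?r ^ n * (of_bool (word_dist x y = n) * W' x y))
      + (\<Sum>n\<le>D. ?r ^ n * (of_bool (word_dist x y = n) * (W x y - W' x y))))"
  proof (rule schur_bd_mono)
    show "1 + (\<Sum>n\<in>{Suc D..<N}. 4 * (real n + 1) * r ^ n) + (\<Sum>n\<le>D. layer_const n * r ^ n * \<delta>) \<le> 1 + \<epsilon>"
      using tail[of N] small unfolding sum_distrib_right by linarith
  qed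
  then show ?thesis
  proof (rule schur_bd_cong)
    fix x y assume xy: "x \<in> T" "y \<in> T"
    let ?d = "word_dist x y"
    have pick: "(\<Sum>n\<in>M. ?r ^ n * (of_bool (?d = n) * z)) = of_bool (?d \<in> M) * ?r ^ ?d * z"
      if "finite M" for M :: "nat set" and z
    proof -
      have "(\<Sum>n\<in>M. ?r ^ n * (of_bool (?d = n) * z)) = (\<Sum>n\<in>M. if ?d = n then ?r ^ ?d * z else 0)"
        by (rule sum.cong) auto
      then show ?thesis using that by (simp add: sum.delta)
    qed
    show "?r ^ ?d * W' x y - (\<Sum>n\<in>{Suc D..<N}. ?r ^ n * (of_bool (?d = n) * W' x y))
      + (\<Sum>n\<le>D. ?r ^ n * (of_bool (?d = n) * (W x y - W' x y))) = \<psi> (inv\<^bsub>FP\<^esub> x \<otimes>\<^bsub>FP\<^esub> y)"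
      unfolding ker[OF xy] pick[OF finite_atLeastLessThan] pick[OF finite_atMost] using N[OF xy]
      by (auto simp: algebra_simps)
  qed
qed

text \<open>The parameters are chosen in the order \<open>r\<close>, \<open>D\<close>,
  \<open>\<delta>\<close>, and then the two multipliers: \<open>r\<close> depends on the lengths of
  the words in \<open>E\<close>, \<open>D\<close> on the tail of the series in \<open>r\<close>, and
  \<open>\<delta>\<close> on the layer constants up to \<open>D\<close>.\<close>

lemma free_product_multiplier:
  assumes "weakly_amenable_CH1 A" "weakly_amenable_CH1 B" and E: "finite E" "E \<subseteq> carrier FP" and \<epsilon>: "0 < \<epsilon>"
  shows "\<exists>\<psi>. finite {w \<in> carrier FP. \<psi> w \<noteq> 0} \<and> (\<forall>w\<in>E. cmod (\<psi> w - 1) \<le> \<epsilon>) \<and> cb_norm FP \<psi> \<le> ereal (1 + \<epsilon>)"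
proof -
  have half: "c * (e / (2 * c)) = e / 2" if "0 < c" for c e :: real using that by simp
  define L where "L = Max (insert 0 (length ` E))"
  have L: "length w \<le> L" if "w \<in> E" for w unfolding L_def using E that by (intro Max_ge) auto
  \<comment> \<open>By Bernoulli, \<open>1 - r ^ n \<le> n * \<eta> \<le> \<epsilon> / 2\<close> for
    all lengths \<open>n \<le> L\<close>; the bound \<open>1 / 2\<close> keeps \<open>r\<close>
    positive.\<close>
  define \<eta> where "\<eta> = min (1 / 2) (\<epsilon> / (2 * (real L + 1)))"
  define r where "r = 1 - \<eta>"
  have \<eta>: "0 < \<eta>" "\<eta> \<le> 1 / 2" "L * \<eta> \<le> \<epsilon> / 2"
  proof -
    show "0 < \<eta>" using \<epsilon> by (simp add: \<eta>_def)
    show "\<eta> \<le> 1 / 2" unfolding \<eta>_def by (rule min.cobounded1)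
    have "L * \<eta> \<le> (real L + 1) * (\<epsilon> / (2 * (real L + 1)))"
      using \<epsilon> \<open>0 < \<eta>\<close> by (intro mult_mono) (auto simp: \<eta>_def)
    also have "\<dots> = \<epsilon> / 2" by (rule half) simp
    finally show "L * \<eta> \<le> \<epsilon> / 2" .
  qed
  have r: "0 < r" "r < 1" using \<eta> by (auto simp: r_def)
  have rn: "1 - r ^ n \<le> \<epsilon> / 2" "r ^ n \<le> 1" if "n \<le> L" for n
  proof -
    have "1 + real n * (- \<eta>) \<le> (1 + (- \<eta>)) ^ n" using \<eta> by (intro Bernoulli_inequality) auto
    moreover have "real n * \<eta> \<le> real L * \<eta>" using \<eta> that by (intro mult_right_mono) auto
    ultimately show "1 - r ^ n \<le> \<epsilon> / 2" using \<eta>(3) by (simp add: r_def)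
    show "r ^ n \<le> 1" using r by (intro power_le_one) auto
  qed
  obtain N0 where N0: "\<And>m n. m \<ge> N0 \<Longrightarrow> norm (\<Sum>n\<in>{m..<n}. 4 * (real n + 1) * r ^ n) < \<epsilon> / 2"
    using summable_linear_geometric[of r] r \<epsilon> unfolding summable_Cauchy by (meson half_gt_zero less_imp_le)
  \<comment> \<open>Taking \<open>D \<ge> L\<close> keeps the words of \<open>E\<close> below the
    cutoff.\<close>
  define D where "D = max N0 L"
  have tail: "(\<Sum>n\<in>{Suc D..<N}. 4 * (real n + 1) * r ^ n) \<le> \<epsilon> / 2" for N
  proof -
    have "N0 \<le> Suc D" by (simp add: D_def)
    from N0[OF this, of N] show ?thesis unfolding real_norm_def by linarith
  qed
  define c where "c = (\<Sum>n\<le>D. layer_const n * r ^ n)"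
  have c: "0 \<le> c" unfolding c_def using r layer_const_nonneg by (intro sum_nonneg mult_nonneg_nonneg) auto
  define b where "b = real L * 2 ^ L"
  have b: "0 \<le> b" by (simp add: b_def)
  \<comment> \<open>Here \<open>c\<close> pays for the Schur error of the layers up to
    \<open>D\<close> and \<open>b\<close> for the pointwise error on words of \<open>E\<close>; the
    summand 1 keeps the denominator positive.\<close>
  define \<delta> where "\<delta> = min 1 (\<epsilon> / (2 * (b + c + 1)))"
  have \<delta>: "0 < \<delta>" "\<delta> \<le> 1" using \<epsilon> b c by (auto simp: \<delta>_def)
  have "(b + c + 1) * \<delta> \<le> (b + c + 1) * (\<epsilon> / (2 * (b + c + 1)))"
    using b c by (intro mult_left_mono) (auto simp: \<delta>_def)
  also have "\<dots> = \<epsilon> / 2" by (rule half) (use b c in linarith)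
  finally have bc: "(b + c + 1) * \<delta> \<le> \<epsilon> / 2" .
  have "c * \<delta> \<le> (b + c + 1) * \<delta>" "b * \<delta> \<le> (b + c + 1) * \<delta>" using b c \<delta> by (auto intro!: mult_right_mono)
  then have bc\<delta>: "c * \<delta> \<le> \<epsilon> / 2" "b * \<delta> \<le> \<epsilon> / 2" using bc by linarith+
  define \<Lambda> where "\<Lambda> = (\<Union>w\<in>E. set w)"
  have \<Lambda>: "finite \<Lambda>" "\<And>l. l \<in> \<Lambda> \<Longrightarrow> fp_letter_ok A B l"
    using E by (auto simp: \<Lambda>_def free_product_def fp_reduced_def)
  have "finite (Inl -` \<Lambda>)" "Inl -` \<Lambda> \<subseteq> carrier A" "finite (Inr -` \<Lambda>)" "Inr -` \<Lambda> \<subseteq> carrier B"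
    using \<Lambda> by (auto intro!: finite_vimageI simp: fp_letter_ok_def dest!: \<Lambda>(2))
  note ES = this
  obtain \<phi> where \<phi>: "finite {a \<in> carrier A. \<phi> a \<noteq> 0}" "\<phi> \<one>\<^bsub>A\<^esub> = 1"
    "\<And>a. a \<in> Inl -` \<Lambda> \<Longrightarrow> cmod (\<phi> a - 1) \<le> \<delta>"
    "\<And>S. finite S \<Longrightarrow> S \<subseteq> carrier A \<Longrightarrow> \<exists>P. psd S P \<and> (\<forall>s\<in>S. P s s = 1) \<and>
      schur_bd S \<delta> (\<lambda>s t. \<phi> (inv\<^bsub>A\<^esub> s \<otimes>\<^bsub>A\<^esub> t) - P s t)"
    by (rule normalized_multipliers[OF A.group_axioms assms(1) ES(1,2) \<delta>(1)]) (rule that; assumption)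
  obtain \<phi>' where \<phi>': "finite {b \<in> carrier B. \<phi>' b \<noteq> 0}" "\<phi>' \<one>\<^bsub>B\<^esub> = 1"
    "\<And>b. b \<in> Inr -` \<Lambda> \<Longrightarrow> cmod (\<phi>' b - 1) \<le> \<delta>"
    "\<And>S. finite S \<Longrightarrow> S \<subseteq> carrier B \<Longrightarrow> \<exists>P. psd S P \<and> (\<forall>s\<in>S. P s s = 1) \<and>
      schur_bd S \<delta> (\<lambda>s t. \<phi>' (inv\<^bsub>B\<^esub> s \<otimes>\<^bsub>B\<^esub> t) - P s t)"
    by (rule normalized_multipliers[OF B.group_axioms assms(2) ES(3,4) \<delta>(1)]) (rule that; assumption)
  define \<psi> where "\<psi> = (\<lambda>w. if length w \<le> D then of_real r ^ length w * prod_list (map (case_sum \<phi> \<phi>') w) else 0)"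
  have "finite {w \<in> carrier FP. \<psi> w \<noteq> 0}"
  proof (rule finite_subset)
    let ?L = "Inl ` {a \<in> carrier A. \<phi> a \<noteq> 0} \<union> Inr ` {b \<in> carrier B. \<phi>' b \<noteq> 0}"
    show "finite {w. set w \<subseteq> ?L \<and> length w \<le> D}" using \<phi>(1) \<phi>'(1) by (intro finite_lists_length_le) auto
    show "{w \<in> carrier FP. \<psi> w \<noteq> 0} \<subseteq> {w. set w \<subseteq> ?L \<and> length w \<le> D}"
    proof (clarify)
      fix w assume w: "w \<in> carrier FP" "\<psi> w \<noteq> 0"
      then have len: "length w \<le> D" and "prod_list (map (case_sum \<phi> \<phi>') w) \<noteq> 0"
        by (auto simp: \<psi>_def split: if_splits)
      then have nz: "case_sum \<phi> \<phi>' l \<noteq> 0" if "l \<in> set w" for l using that by (auto simp: prod_list_zero_iff)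
      have "l \<in> ?L" if "l \<in> set w" for l
        using nz[OF that] w(1) that by (cases l) (auto simp: free_product_def fp_reduced_def fp_letter_ok_def)
      then show "set w \<subseteq> ?L \<and> length w \<le> D" using len by blast
    qed
  qed
  moreover have "cmod (\<psi> w - 1) \<le> \<epsilon>" if w: "w \<in> E" for w
  proof -
    let ?P = "prod_list (map (case_sum \<phi> \<phi>') w)" and ?R = "complex_of_real r ^ length w"
    have len: "length w \<le> L" "length w \<le> D" using L[OF w] by (auto simp: D_def)
    have "cmod (?P - prod_list (map (\<lambda>_. 1) w)) \<le> real (length w) * 2 ^ length w * \<delta>"
    proof (rule norm_prod_list_diff_le)
      fix l assume "l \<in> set w"
      then have "l \<in> \<Lambda>" using w by (auto simp: \<Lambda>_def)
      then have "cmod (case_sum \<phi> \<phi>' l - 1) \<le> \<delta>" using \<phi>(3) \<phi>'(3) by (cases l) auto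
      moreover then have "cmod (case_sum \<phi> \<phi>' l) \<le> 2"
        using norm_triangle_sub[of "case_sum \<phi> \<phi>' l" 1] \<delta>(2) by simp
      ultimately show "cmod (case_sum \<phi> \<phi>' l) \<le> 2 \<and> cmod (1::complex) \<le> 2 \<and> cmod (case_sum \<phi> \<phi>' l - 1) \<le> \<delta>" by simp
    qed (use \<delta> in simp)
    also have "prod_list (map (\<lambda>_. 1) w) = (1::complex)" by (induction w) auto
    also have "real (length w) * 2 ^ length w \<le> b"
      unfolding b_def using len by (intro mult_mono power_increasing) auto
    finally have P: "cmod (?P - 1) \<le> \<epsilon> / 2" using bc\<delta>(2) \<delta>(1) by (smt (verit) mult_right_mono)
    have "\<psi> w - 1 = ?R * (?P - 1) + (?R - 1)" using len by (simp add: \<psi>_def algebra_simps)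
    then have "cmod (\<psi> w - 1) \<le> cmod ?R * cmod (?P - 1) + cmod (?R - 1)"
      by (metis norm_mult norm_triangle_ineq)
    also have "cmod ?R * cmod (?P - 1) \<le> 1 * (\<epsilon> / 2)"
      using P rn(2)[OF len(1)] r by (intro mult_mono) (auto simp: norm_power)
    also have "cmod (?R - 1) = 1 - r ^ length w"
    proof -
      have "?R - 1 = of_real (r ^ length w - 1)" by simp
      then show ?thesis using rn(2)[OF len(1)] by (simp only: norm_of_real)
    qed
    also have "1 - r ^ length w \<le> \<epsilon> / 2" by (rule rn(1)[OF len(1)])
    finally show ?thesis by simp
  qed
  moreover have "cb_norm FP \<psi> \<le> ereal (1 + \<epsilon>)"
  proof (rule cb_norm_le[OF free_product_group])
    fix T assume T: "finite T" "T \<subseteq> carrier FP"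
    show "schur_bd T (1 + \<epsilon>) (\<lambda>s t. \<psi> (inv\<^bsub>FP\<^esub> s \<otimes>\<^bsub>FP\<^esub> t))"
      unfolding \<psi>_def
      by (rule free_product_kernel_schur_bd[OF \<phi>(2,4) \<phi>'(2,4) less_imp_le[OF \<delta>(1)] \<delta>(2) less_imp_le[OF r(1)]
            less_imp_le[OF r(2)] tail _ T]) (use bc\<delta>(1) in \<open>auto simp: c_def\<close>)
  qed (use \<epsilon> in simp)
  ultimately show ?thesis by blast
qed

end

section \<open>The approximating net\<close>

theorem mainTheorem3:
  fixes A :: "('a,'m) monoid_scheme" and B :: "('b,'n) monoid_scheme"
  assumes "group A" and "group B"
    and "weakly_amenable_CH1 A" and "weakly_amenable_CH1 B"
  shows "weakly_amenable_CH1 (free_product A B)"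
proof -
  interpret two_groups A B using assms by (intro two_groups.intro)
  \<comment> \<open>The net over finite sets \<open>E\<close> and tolerances
    \<open>\<epsilon>\<close> is encoded by the filter with base \<open>M (E, \<epsilon>)\<close>.
    The base is directed through unions and minima, and its members are nonempty by
    \<open>free_product_multiplier\<close>.\<close>
  define M where "M = (\<lambda>(E, \<epsilon>). {\<psi>. finite {w \<in> carrier FP. \<psi> w \<noteq> 0} \<and> (\<forall>w\<in>E. cmod (\<psi> w - 1) \<le> \<epsilon>)
    \<and> cb_norm FP \<psi> \<le> ereal (1 + \<epsilon>)})"
  define I where "I = {E. finite E \<and> E \<subseteq> carrier FP} \<times> {\<epsilon> :: real. 0 < \<epsilon>}"
  define F where "F = (INF i\<in>I. principal (M i))"
  have ev: "eventually Q F \<longleftrightarrow> (\<exists>i\<in>I. eventually Q (principal (M i)))" for Q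
    unfolding F_def
  proof (rule eventually_INF_base)
    show "I \<noteq> {}" unfolding I_def by (auto intro!: exI[of _ "{}"] exI[of _ 1])
    fix i j assume ij: "i \<in> I" "j \<in> I"
    obtain E \<epsilon> E' \<epsilon>' where i: "i = (E, \<epsilon>)" "j = (E', \<epsilon>')" by (cases i; cases j) auto
    have "M (E \<union> E', min \<epsilon> \<epsilon>') \<subseteq> M i \<inter> M j"
      unfolding i M_def by (auto elim!: order_trans)
    moreover have "(E \<union> E', min \<epsilon> \<epsilon>') \<in> I" using ij by (auto simp: I_def i)
    ultimately show "\<exists>k\<in>I. principal (M k) \<le> inf (principal (M i)) (principal (M j))"
      by (intro bexI[of _ "(E \<union> E', min \<epsilon> \<epsilon>')"]) auto
  qed
  have evI: "eventually Q F" if "finite E" "E \<subseteq> carrier FP" "0 < \<epsilon>" "\<And>\<psi>. \<psi> \<in> M (E, \<epsilon>) \<Longrightarrow> Q \<psi>" for Q E \<epsilon>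
    unfolding ev using that by (intro bexI[of _ "(E, \<epsilon>)"]) (auto simp: eventually_principal I_def)
  have "F \<noteq> bot"
  proof
    assume "F = bot"
    then have "eventually (\<lambda>_. False) F" by simp
    then obtain E \<epsilon> where "(E, \<epsilon>) \<in> I" "M (E, \<epsilon>) = {}" unfolding ev by (auto simp: eventually_principal)
    then show False using free_product_multiplier[OF assms(3,4), of E \<epsilon>] by (auto simp: I_def M_def)
  qed
  moreover have "eventually (\<lambda>\<psi>. finite {w \<in> carrier FP. \<psi> w \<noteq> 0}) F"
    by (rule evI[of "{}" 1]) (auto simp: M_def)
  moreover have "\<forall>w\<in>carrier FP. ((\<lambda>\<psi>. \<psi> w) \<longlongrightarrow> 1) F"
  proof (intro ballI tendstoI)
    fix w and e :: real assume "w \<in> carrier FP" "0 < e"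
    then show "eventually (\<lambda>\<psi>. dist (\<psi> w) 1 < e) F"
      by (intro evI[of "{w}" "e / 2"]) (auto simp: M_def dist_norm)
  qed
  moreover have "Limsup F (cb_norm FP) \<le> 1"
    unfolding Limsup_le_iff
  proof (intro allI impI)
    fix y :: ereal assume "1 < y"
    \<comment> \<open>The tolerance \<open>z - 1\<close> makes the cb-norm bound equal to
      \<open>z\<close>, strictly below \<open>y\<close>.\<close>
    then obtain z where z: "1 < ereal z" "ereal z < y" using ereal_dense2 by blast
    then show "eventually (\<lambda>\<psi>. cb_norm FP \<psi> < y) F"
      by (intro evI[of "{}" "z - 1"]) (auto simp: M_def one_ereal_def)
  qed
  ultimately show ?thesis unfolding weakly_amenable_CH1_def by blast
qed

end
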